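(* Let $d\ge1$, let $a=(a_n)_{n\in\mathbb{Z}^d}$ be an odd sequence with $\sum_n|a_n|<\infty$ and let $f(x)=\sum_{n\in\mathbb{Z}^d\setminus\{0\}}a_n\{n\cdot x\}$. Assume that $\mathrm{supp}(a)$ is sparse, that $\theta_a\le 1$, and that $0<\gamma_a<\infty$. Then for every real $h\in[0,\gamma_a]$ and every nonempty open set $W\subseteq\mathbb{R}^d$, \[ \dim_{\mathrm H}\bigl(\{x\in\mathbb{R}^d: h_f(x)=h\}\cap W\bigr)=d-1+\frac{h}{\gamma_a}. \]
   Context: $\{x\}=x-\lfloor x\rfloor-\tfrac12$ for $x\notin\mathbb{Z}$, $\{x\}=0$ for $x\in\mathbb{Z}$. Odd: $a_{-n}=-a_n$. $|n|$ is the Euclidean norm; $\mathrm{supp}(a)=\{n:a_n\ne0\}$. A set $Q\subseteq\mathbb{R}^d$ is sparse if $\lim_{R\to\infty}\log\#(Q\cap B(0,R))/\log R=0$. $A_q=2\sum_{l\ge1}a_{lq}$, $\overline a_q=\sup_{l\ge1}|a_{lq}|$, $\theta_a=\limsup_{q\to\infty,\,q\in\mathrm{supp}(\overline a)}\log|A_q|/\log|\overline a_q|$, and $\gamma_a=\liminf_{n\to\infty,\,n\in\mathrm{supp}(a)}(-\log|a_n|)/\log|n|$. Hölder exponent: $f\in C^\alpha(x_0)$ if $|f(x)-P(x)|\le C|x-x_0|^\alpha$ near $x_0$ for some $C>0$ and polynomial $P$ of degree $<\alpha$; $h_f(x_0)=\sup\{\alpha\ge0:f\in C^\alpha(x_0)\}$.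 $\dim_{\mathrm H}$ is Hausdorff dimension. *)

theory Defs
  imports "HOL-Analysis.Analysis"
begin

section \<open>Hausdorff dimension\<close>

text \<open>Nonnegative base and exponent, with the convention \<open>r\<^sup>0 = 1\<close> also for \<open>r = 0\<close>
  (whereas \<^term>\<open>0 powr 0 = (0::real)\<close>).\<close>

definition rpow :: "real \<Rightarrow> real \<Rightarrow> real" where
  "rpow r s = (if s = 0 then 1 else r powr s)"

text \<open>The boundedness condition on the covering sets is needed because \<^const>\<open>diameter\<close> is
  real-valued and has no meaningful value on unbounded sets.\<close>

definition hausdorff_gauge :: "real \<Rightarrow> 'a::metric_space set \<Rightarrow> ennreal" where
  "hausdorff_gauge s U = (if U = {} then 0 else ennreal (rpow (diameter U) s))"

definition hausdorff_premeasure :: "real \<Rightarrow> real \<Rightarrow> 'a::metric_space set \<Rightarrow> ennreal" where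
  "hausdorff_premeasure s \<delta> E =
     Inf {(\<Sum>i. hausdorff_gauge s (U i)) | U :: nat \<Rightarrow> 'a set.
            E \<subseteq> (\<Union>i. U i) \<and> (\<forall>i. bounded (U i) \<and> diameter (U i) \<le> \<delta>)}"

definition hausdorff_measure :: "real \<Rightarrow> 'a::metric_space set \<Rightarrow> ennreal" where
  "hausdorff_measure s E = (SUP \<delta>\<in>{0<..}. hausdorff_premeasure s \<delta> E)"

definition hausdorff_dim :: "'a::metric_space set \<Rightarrow> ereal" where
  "hausdorff_dim E = Inf {ereal s | s. 0 \<le> s \<and> hausdorff_measure s E = 0}"

section \<open>Pointwise Hoelder exponent\<close>

text \<open>Polynomial functions in the coordinates of total degree \<open>< \<alpha>\<close>; the zero polynomial has
  degree \<open>-\<infinity>\<close>, so it is the only one for \<open>\<alpha> = 0\<close>.\<close>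

definition polynomial_deg_less ::
    "real \<Rightarrow> (real ^ 'd \<Rightarrow> 'k::{real_normed_field,banach}) \<Rightarrow> bool" where
  "polynomial_deg_less \<alpha> P \<longleftrightarrow>
     (\<exists>(K :: ('d \<Rightarrow> nat) set) c. finite K \<and> (\<forall>k\<in>K. real (\<Sum>i\<in>UNIV. k i) < \<alpha>) \<and>
        (\<forall>x. P x = (\<Sum>k\<in>K. c k * of_real (\<Prod>i\<in>UNIV. (x $ i) ^ k i))))"

definition holder_at ::
    "(real ^ 'd \<Rightarrow> 'k::{real_normed_field,banach}) \<Rightarrow> real \<Rightarrow> real ^ 'd \<Rightarrow> bool" where
  "holder_at f \<alpha> x0 \<longleftrightarrow>
     (\<exists>C>0. \<exists>P. polynomial_deg_less \<alpha> P \<and>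
        (\<forall>\<^sub>F x in nhds x0. norm (f x - P x) \<le> C * rpow (norm (x - x0)) \<alpha>))"

definition holder_exponent ::
    "(real ^ 'd \<Rightarrow> 'k::{real_normed_field,banach}) \<Rightarrow> real ^ 'd \<Rightarrow> ereal" where
  "holder_exponent f x0 = Sup {ereal \<alpha> | \<alpha>. 0 \<le> \<alpha> \<and> holder_at f \<alpha> x0}"

section \<open>Davenport series\<close>

definition sawtooth :: "real \<Rightarrow> real" where
  "sawtooth x = (if x \<in> \<int> then 0 else x - of_int \<lfloor>x\<rfloor> - 1/2)"

definition rvec :: "int ^ 'd \<Rightarrow> real ^ 'd" where
  "rvec n = (\<chi> i. real_of_int (n $ i))"

definition davenport ::
    "(int ^ 'd \<Rightarrow> 'k::{real_normed_field,banach}) \<Rightarrow> real ^ 'd \<Rightarrow> 'k" where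
  "davenport a x = (\<Sum>\<^sub>\<infinity>n\<in>UNIV - {0}. a n * of_real (sawtooth (rvec n \<bullet> x)))"

definition supp :: "('i \<Rightarrow> 'k::zero) \<Rightarrow> 'i set" where
  "supp a = {n. a n \<noteq> 0}"

text \<open>Finiteness is part of the definition because \<^const>\<open>card\<close> is \<open>0\<close> on infinite sets.\<close>

definition sparse_set :: "'a::real_normed_vector set \<Rightarrow> bool" where
  "sparse_set Q \<longleftrightarrow>
     (\<forall>R. finite (Q \<inter> ball 0 R)) \<and>
     ((\<lambda>R. ln (real (card (Q \<inter> ball 0 R))) / ln R) \<longlongrightarrow> 0) at_top"

text \<open>The filter \<open>|n| \<rightarrow> \<infinity>\<close>, \<open>n \<in> S\<close>.\<close>

definition to_infinity_in :: "(int ^ 'd) set \<Rightarrow> (int ^ 'd) filter" where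
  "to_infinity_in S = inf (filtercomap rvec at_infinity) (principal S)"

text \<open>Logarithm with \<open>log 0 = -\<infinity>\<close>. In \<open>theta\<close> below, \<open>A q\<close> may vanish at points of
  \<open>supp (abar a)\<close>, where the denominator is eventually negative; the quotient is then \<open>+\<infinity>\<close>
  (whereas \<^term>\<open>ln 0 = (0::real)\<close>).\<close>

definition elog :: "real \<Rightarrow> ereal" where
  "elog x = (if x = 0 then -\<infinity> else ereal (ln x))"

definition Asum :: "(int ^ 'd \<Rightarrow> 'k::{real_normed_field,banach}) \<Rightarrow> int ^ 'd \<Rightarrow> 'k" where
  "Asum a q = 2 * (\<Sum>\<^sub>\<infinity>l\<in>{1::nat..}. a (int l *s q))"

definition abar :: "(int ^ 'd \<Rightarrow> 'k::real_normed_vector) \<Rightarrow> int ^ 'd \<Rightarrow> real" where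
  "abar a q = (SUP l\<in>{1::nat..}. norm (a (int l *s q)))"

definition theta :: "(int ^ 'd \<Rightarrow> 'k::{real_normed_field,banach}) \<Rightarrow> ereal" where
  "theta a = Limsup (to_infinity_in (supp (abar a)))
     (\<lambda>q. elog (norm (Asum a q)) / elog \<bar>abar a q\<bar>)"

definition gamma :: "(int ^ 'd \<Rightarrow> 'k::real_normed_vector) \<Rightarrow> ereal" where
  "gamma a = Liminf (to_infinity_in (supp a))
     (\<lambda>n. - elog (norm (a n)) / ereal (ln (norm (rvec n))))"

end

theory Submission
  imports Defs
begin

text \<open>
  Let \<open>S\<close> be the support of \<open>a\<close> and \<open>\<parallel>t\<parallel>\<close> the distance from \<open>t\<close> to the integers. Sparseness makes
  \<open>\<Sum>|a\<^sub>n| |n|\<^sup>b\<close> finite for \<open>b < \<gamma>\<close>, so \<open>f\<close> is of class \<open>C\<^sup>\<alpha>\<close> at \<open>x\<close> as soon as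
  \<open>\<parallel>n \<bullet> x\<parallel> \<ge> c |n|\<^bsup>1 - \<tau>\<^esup>\<close> on \<open>S\<close> for some \<open>\<tau> < \<gamma> / \<alpha>\<close>. Conversely, \<open>f\<close> jumps by \<open>A\<^sub>q\<close> across
  the hyperplane \<open>q \<bullet> x = p\<close> when \<open>q\<close> and \<open>p\<close> have no common factor, and \<open>\<theta> \<le> 1\<close> bounds \<open>|A\<^sub>q|\<close> from below by
  about the largest \<open>|a\<^sub>l\<^sub>q|\<close>. So \<open>h\<^sub>f(x) = h > 0\<close> means that \<open>\<gamma> / h\<close> is the exact order at which the
  hyperplanes \<open>n \<bullet> x \<in> \<int>\<close>, \<open>n \<in> S\<close>, approximate \<open>x\<close>.

  The upper bound on the dimension comes from covering the slabs around these hyperplanes. For the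
  lower bound, slice along a coordinate that dominates infinitely many extremal \<open>n \<in> S\<close>. Each slice
  contains a Cantor set of dimension \<open>h / \<gamma>\<close> of points approximated to order \<open>\<gamma> / h\<close>, and a
  Borel-Cantelli argument in its natural parametrization discards the points that are approximated
  better. For \<open>h = 0\<close> one hyperplane with a nonzero jump suffices.
\<close>


section \<open>Sets of Hausdorff measure zero\<close>

text \<open>Two obstacles shape the proof. All multiples of \<open>q\<close> jump across the same
  hyperplane and their coefficients may cancel, so one large coefficient proves nothing by itself.
  The hypothesis on \<open>theta\<close> limits the cancellation to a power \<open>1 + e\<close>,
  but only for long \<open>q\<close>; hence the control of common factors before any jump is used.

  The lower bound needs points approximated to order \<tau> = \<gamma>/h and to no order \<tau>' >
  \<tau>. This is possible because sparseness makes the sum of |n| to the power -e finite for every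
  e > 0: a Hoelder exponent \<sigma>' of the inverse parametrization can be placed strictly between
  1/\<tau>' and 1/\<tau>, and the exceptional parameters then have a convergent cover. Vectors with
  a zero entry in the slicing direction do not react to the parameter; they are dealt with by
  discarding a null set of slices. The scales of the Cantor set and its Hoelder constants must be
  the same on all slices, since the slice estimates are integrated with one constant; only the
  offsets of the grids vary.\<close>

lemma hausdorff_premeasure_leI:
  assumes "E \<subseteq> (\<Union>i. U i)" "\<And>i. bounded (U i)" "\<And>i. diameter (U i) \<le> \<delta>"
    "(\<Sum>i. hausdorff_gauge s (U i)) \<le> B"
  shows "hausdorff_premeasure s \<delta> E \<le> B"
  unfolding hausdorff_premeasure_def
  by (rule Inf_lower2[OF _ assms(4)]) (use assms(1-3) in blast)

lemma hausdorff_measure_0_iff: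
  "hausdorff_measure s E = 0 \<longleftrightarrow> (\<forall>\<delta>>0. hausdorff_premeasure s \<delta> E = 0)"
  by (auto simp: hausdorff_measure_def bot_ennreal[symmetric] SUP_bot_conv)

lemma hausdorff_measure_0_cover:
  assumes "hausdorff_measure s E = 0" "0 < \<delta>" "0 < \<eta>"
  obtains U :: "nat \<Rightarrow> 'a::metric_space set" where
    "E \<subseteq> (\<Union>i. U i)" "\<And>i. bounded (U i)" "\<And>i. diameter (U i) \<le> \<delta>"
    "(\<Sum>i. hausdorff_gauge s (U i)) < \<eta>"
proof -
  have "hausdorff_premeasure s \<delta> E < \<eta>"
    using assms by (simp add: hausdorff_measure_0_iff)
  then show thesis
    unfolding hausdorff_premeasure_def Inf_less_iff using that by blast
qed

lemma hausdorff_measure_0I: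
  assumes "\<And>\<delta> \<eta>. 0 < \<delta> \<Longrightarrow> 0 < \<eta> \<Longrightarrow> hausdorff_premeasure s \<delta> E \<le> ennreal \<eta>"
  shows "hausdorff_measure s E = 0"
  unfolding hausdorff_measure_0_iff
  using assms by (metis ennreal_le_epsilon le_zero_eq add_0)

lemma hausdorff_measure_0_mono:
  assumes "hausdorff_measure s F = 0" "E \<subseteq> F"
  shows "hausdorff_measure s E = 0"
proof (rule hausdorff_measure_0I)
  fix \<delta> \<eta> :: real assume "0 < \<delta>" "0 < \<eta>"
  then obtain U where U: "F \<subseteq> (\<Union>i. U i)" "\<And>i. bounded (U i)" "\<And>i. diameter (U i) \<le> \<delta>"
      "(\<Sum>i. hausdorff_gauge s (U i)) < ennreal \<eta>"
    by (metis hausdorff_measure_0_cover[OF assms(1)] ennreal_less_zero_iff)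
  show "hausdorff_premeasure s \<delta> E \<le> ennreal \<eta>"
    by (rule hausdorff_premeasure_leI[of _ U]) (use U assms(2) in auto)
qed

lemma hausdorff_gauge_empty [simp]: "hausdorff_gauge s {} = 0"
  by (simp add: hausdorff_gauge_def)

lemma rpow_nonneg: "0 \<le> r \<Longrightarrow> 0 \<le> rpow r s"
  by (simp add: rpow_def)

lemma rpow_of_nat: "0 \<le> r \<Longrightarrow> rpow r (real n) = r ^ n"
  by (simp add: rpow_def powr_realpow')

lemma rpow_mono: "0 \<le> r \<Longrightarrow> r \<le> r' \<Longrightarrow> 0 \<le> s \<Longrightarrow> rpow r s \<le> rpow r' s"
  by (simp add: rpow_def powr_mono2)

lemma hausdorff_gauge_le:
  assumes "bounded U" "diameter U \<le> r" "0 \<le> s"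
  shows "hausdorff_gauge s U \<le> ennreal (rpow r s)"
  using assms by (auto simp: hausdorff_gauge_def intro!: ennreal_leI rpow_mono diameter_ge_0)

text \<open>Every explicit cover below has this shape: for each lattice vector finitely many sets of
  a common size. Bounding the finite subfamilies is what summability over an unordered index set
  provides.\<close>

lemma hausdorff_premeasure_family_le:
  fixes V :: "'n \<Rightarrow> nat \<Rightarrow> 'a::metric_space set"
  assumes "countable S" "0 \<le> s"
    and cov: "E \<subseteq> (\<Union>n\<in>S. \<Union>k<M n. V n k)"
    and V: "\<And>n k. n \<in> S \<Longrightarrow> k < M n \<Longrightarrow> bounded (V n k)"
      "\<And>n k. n \<in> S \<Longrightarrow> k < M n \<Longrightarrow> diameter (V n k) \<le> r n"
    and r: "\<And>n. n \<in> S \<Longrightarrow> 0 \<le> r n" "\<And>n. n \<in> S \<Longrightarrow> r n \<le> \<delta>" "0 < \<delta>"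
    and sum: "\<And>F. finite F \<Longrightarrow> F \<subseteq> S \<Longrightarrow> (\<Sum>n\<in>F. real (M n) * rpow (r n) s) \<le> \<eta>"
  shows "hausdorff_premeasure s \<delta> E \<le> ennreal \<eta>"
proof -
  define e where "e = to_nat_on S"
  define d where "d = from_nat_into S"
  have ed: "d (e n) = n" if "n \<in> S" for n
    using assms(1) that by (simp add: e_def d_def)
  \<comment> \<open>\<open>from_nat_into\<close> repeats elements when \<open>S\<close> is finite.
    \<open>ok\<close> keeps one index for each element of \<open>S\<close>; all other indices
    receive the empty set, whose gauge is 0.\<close>
  define ok where "ok j \<longleftrightarrow> d j \<in> S \<and> e (d j) = j" for j
  define W where "W = (\<lambda>(j, k). if ok j \<and> k < M (d j) then V (d j) k else {})"
  define U where "U = (\<lambda>i. W (prod_decode i))"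
  have bW: "bounded (W p)" and dW: "diameter (W p) \<le> \<delta>" for p
    using V r by (cases p; fastforce simp: W_def ok_def diameter_empty)+
  have gW: "hausdorff_gauge s (W (j,k)) \<le>
      (if ok j \<and> k < M (d j) then ennreal (rpow (r (d j)) s) else 0)" for j k
    using V assms(2) by (auto simp: W_def ok_def intro: hausdorff_gauge_le)
  have inner: "(\<Sum>k. hausdorff_gauge s (W (j,k)))
      \<le> (if ok j then ennreal (real (M (d j)) * rpow (r (d j)) s) else 0)" for j
  proof -
    have "(\<Sum>k. hausdorff_gauge s (W (j,k))) \<le>
        (\<Sum>k. if ok j \<and> k < M (d j) then ennreal (rpow (r (d j)) s) else 0)"
      by (intro suminf_le gW) auto
    also have "\<dots> = (\<Sum>k<M (d j). if ok j \<and> k < M (d j) then ennreal (rpow (r (d j)) s) else 0)"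
      by (rule suminf_finite) auto
    also have "\<dots> = (if ok j then of_nat (M (d j)) * ennreal (rpow (r (d j)) s) else 0)"
      by (auto)
    also have "\<dots> = (if ok j then ennreal (real (M (d j)) * rpow (r (d j)) s) else 0)"
      using r(1) by (auto simp: ennreal_mult rpow_nonneg ok_def ennreal_of_nat_eq_real_of_nat)
    finally show ?thesis .
  qed
  have "(\<Sum>i. hausdorff_gauge s (U i)) = (\<Sum>j. \<Sum>k. hausdorff_gauge s (W (j,k)))"
    unfolding U_def by (rule suminf_ennreal_2dimen) simp
  also have "\<dots> \<le> (\<Sum>j. if ok j then ennreal (real (M (d j)) * rpow (r (d j)) s) else 0)"
    by (intro suminf_le inner) auto
  also have "\<dots> \<le> ennreal \<eta>"
  proof (rule suminf_le_const)
    fix N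
    let ?F = "d ` {j. j < N \<and> ok j}"
    have inj: "inj_on d {j. j < N \<and> ok j}"
      by (rule inj_onI) (metis (mono_tags, lifting) mem_Collect_eq ok_def)
    have "(\<Sum>j<N. if ok j then ennreal (real (M (d j)) * rpow (r (d j)) s) else 0)
        = (\<Sum>j | j < N \<and> ok j. ennreal (real (M (d j)) * rpow (r (d j)) s))"
      by (subst sum.inter_filter[symmetric]) (auto simp: lessThan_def)
    also have "\<dots> = (\<Sum>n\<in>?F. ennreal (real (M n) * rpow (r n) s))"
      using inj by (simp add: sum.reindex)
    also have "\<dots> = ennreal (\<Sum>n\<in>?F. real (M n) * rpow (r n) s)"
      using r(1) by (intro sum_ennreal) (auto simp: ok_def rpow_nonneg)
    also have "\<dots> \<le> ennreal \<eta>"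
      by (intro ennreal_leI sum) (auto simp: ok_def)
    finally show "(\<Sum>j<N. if ok j then ennreal (real (M (d j)) * rpow (r (d j)) s) else 0) \<le> ennreal \<eta>" .
  qed auto
  finally have le: "(\<Sum>i. hausdorff_gauge s (U i)) \<le> ennreal \<eta>" .
  have "E \<subseteq> (\<Union>i. U i)"
  proof
    fix x assume "x \<in> E"
    then obtain n k where nk: "n \<in> S" "k < M n" "x \<in> V n k" using cov by blast
    then have "x \<in> W (e n, k)"
      by (simp add: W_def ok_def ed)
    then have "x \<in> U (prod_encode (e n, k))" by (simp add: U_def)
    then show "x \<in> (\<Union>i. U i)" by blast
  qed
  then show ?thesis
    by (rule hausdorff_premeasure_leI) (use bW dW le in \<open>auto simp: U_def\<close>)
qed

lemma hausdorff_measure_0_UN: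
  fixes E :: "nat \<Rightarrow> 'a::metric_space set"
  assumes "\<And>k. hausdorff_measure s (E k) = 0"
  shows "hausdorff_measure s (\<Union>k. E k) = 0"
proof (rule hausdorff_measure_0I)
  fix \<delta> \<eta> :: real assume *: "0 < \<delta>" "0 < \<eta>"
  have "\<exists>U. E k \<subseteq> (\<Union>i. U i) \<and> (\<forall>i. bounded (U i)) \<and> (\<forall>i. diameter (U i) \<le> \<delta>) \<and>
      (\<Sum>i. hausdorff_gauge s (U i)) < ennreal (\<eta> * (1/2)^Suc k)" for k
  proof -
    have "0 < ennreal (\<eta> * (1/2)^Suc k)" using * by simp
    from hausdorff_measure_0_cover[OF assms[of k] *(1) this] show ?thesis by metis
  qed
  then obtain U where U: "\<And>k. E k \<subseteq> (\<Union>i. U k i)" "\<And>k i. bounded (U k i)"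
      "\<And>k i. diameter (U k i) \<le> \<delta>"
      "\<And>k. (\<Sum>i. hausdorff_gauge s (U k i)) < ennreal (\<eta> * (1/2)^Suc k)"
    by metis
  define V where "V = (\<lambda>i. (\<lambda>(k, j). U k j) (prod_decode i))"
  have "(\<Sum>i. hausdorff_gauge s (V i)) = (\<Sum>k. \<Sum>j. hausdorff_gauge s (U k j))"
    unfolding V_def by (subst suminf_ennreal_2dimen[symmetric, where f="\<lambda>(k,j). hausdorff_gauge s (U k j)"])
      (auto simp: case_prod_beta)
  also have "\<dots> \<le> (\<Sum>k. ennreal (\<eta> * (1/2)^Suc k))"
    by (intro suminf_le less_imp_le[OF U(4)]) auto
  also have "\<dots> = ennreal \<eta>"
    using * sums_mult[OF power_half_series, of \<eta>]
    by (intro suminf_ennreal_eq) auto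
  finally have le: "(\<Sum>i. hausdorff_gauge s (V i)) \<le> ennreal \<eta>" .
  have "(\<Union>k. E k) \<subseteq> (\<Union>i. V i)"
  proof
    fix x assume "x \<in> (\<Union>k. E k)"
    then obtain k i where "x \<in> U k i" using U(1) by blast
    then have "x \<in> V (prod_encode (k, i))" by (simp add: V_def)
    then show "x \<in> (\<Union>i. V i)" by blast
  qed
  then show "hausdorff_premeasure s \<delta> (\<Union>k. E k) \<le> ennreal \<eta>"
    by (rule hausdorff_premeasure_leI) (use U le in \<open>auto simp: V_def case_prod_beta\<close>)
qed

text \<open>A set of diameter r lies in a cube of side 2r centred at any of its points, so Lebesgue
  outer measure is at most \<open>2 ^ DIM('a)\<close> times the sum of the gauges.\<close>

lemma hausdorff_measure_DIM_0_imp_negligible: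
  fixes E :: "'a::euclidean_space set"
  assumes "hausdorff_measure (real DIM('a)) E = 0"
  shows "negligible E"
  unfolding negligible_outer_le
proof (intro allI impI)
  fix e :: real assume e: "0 < e"
  define K where "K = (2::real)^DIM('a)"
  have K: "0 < K" by (simp add: K_def)
  obtain U where U: "E \<subseteq> (\<Union>i. U i)" "\<And>i. bounded (U i)"
      "(\<Sum>i. hausdorff_gauge (real DIM('a)) (U i)) < ennreal (e / K)"
    using e K by (metis hausdorff_measure_0_cover[OF assms zero_less_one] ennreal_less_zero_iff zero_less_divide_iff)
  define u where "u i = (SOME x. x \<in> U i)" for i
  define B where "B i = (if U i = {} then {} else
      cbox (u i - diameter (U i) *\<^sub>R One) (u i + diameter (U i) *\<^sub>R One))" for i
  have UB: "U i \<subseteq> B i" for i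
  proof (cases "U i = {}")
    case False
    then have ui: "u i \<in> U i" by (simp add: u_def some_in_eq)
    show ?thesis
    proof
      fix x assume x: "x \<in> U i"
      have "\<bar>(x - u i) \<bullet> b\<bar> \<le> diameter (U i)" if "b \<in> Basis" for b
        using Basis_le_norm[OF that, of "x - u i"] diameter_bounded_bound[OF U(2) x ui]
        by (simp add: dist_norm)
      then show "x \<in> B i"
        using False by (force simp: B_def mem_box inner_diff_left inner_add_left abs_le_iff algebra_simps)
    qed
  qed (simp add: B_def)
  have mB: "emeasure lebesgue (B i) \<le> ennreal K * hausdorff_gauge (real DIM('a)) (U i)" for i
  proof (cases "U i = {}")
    case False
    have d: "0 \<le> diameter (U i)" by (rule diameter_ge_0[OF U(2)])
    have "emeasure lebesgue (B i) = ennreal (\<Prod>b\<in>(Basis::'a set). 2 * diameter (U i))"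
      using False d by (simp add: B_def emeasure_lborel_cbox_eq algebra_simps inner_add_left inner_diff_left)
    also have "\<dots> = ennreal (K * rpow (diameter (U i)) (real DIM('a)))"
      using d by (simp add: K_def rpow_of_nat power_mult_distrib)
    finally show ?thesis using False K d
      by (simp add: hausdorff_gauge_def ennreal_mult rpow_nonneg)
  qed (simp add: B_def)
  have meas: "B i \<in> sets lebesgue" for i by (simp add: B_def)
  have "emeasure lebesgue (\<Union>i. B i) \<le> (\<Sum>i. emeasure lebesgue (B i))"
    using meas by (intro emeasure_subadditive_countably) auto
  also have "\<dots> \<le> (\<Sum>i. ennreal K * hausdorff_gauge (real DIM('a)) (U i))"
    by (intro suminf_le mB) auto
  also have "\<dots> = ennreal K * (\<Sum>i. hausdorff_gauge (real DIM('a)) (U i))"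
    by simp
  also have "\<dots> \<le> ennreal K * ennreal (e / K)"
    using U(3) by (intro mult_left_mono) auto
  also have "\<dots> = ennreal e"
    using K e by (simp add: ennreal_mult[symmetric])
  finally have le: "emeasure lebesgue (\<Union>i. B i) \<le> ennreal e" .
  have "emeasure lebesgue (\<Union>i. B i) < \<infinity>"
    using le by (rule le_less_trans) simp
  then have "(\<Union>i. B i) \<in> lmeasurable"
    using meas by (intro fmeasurableI) auto
  moreover have "measure lebesgue (\<Union>i. B i) \<le> e"
    using le e by (simp add: measure_def enn2real_leI)
  moreover have "E \<subseteq> (\<Union>i. B i)" using U(1) UB by blast
  ultimately show "\<exists>T. E \<subseteq> T \<and> T \<in> lmeasurable \<and> measure lebesgue T \<le> e" by blast
qed


section \<open>Slabs around integer hyperplanes\<close>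

definition dist_int :: "real \<Rightarrow> real" where
  "dist_int t = \<bar>t - of_int (round t)\<bar>"

lemma dist_int_nonneg [simp]: "0 \<le> dist_int t"
  by (simp add: dist_int_def)

lemma dist_int_le: "dist_int t \<le> \<bar>t - of_int p\<bar>"
  unfolding dist_int_def by (rule round_diff_minimal)

lemma dist_int_le_half: "dist_int t \<le> 1/2"
  using of_int_round_abs_le[of t] by (simp add: dist_int_def abs_minus_commute)

lemma dist_int_pos_iff: "0 < dist_int t \<longleftrightarrow> t \<notin> \<int>"
proof -
  have "dist_int t = 0 \<longleftrightarrow> t \<in> \<int>"
    unfolding dist_int_def by (auto elim: Ints_cases simp: eq_iff_diff_eq_0[symmetric]) (metis Ints_of_int)
  then show ?thesis using dist_int_nonneg[of t] by linarith
qed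

abbreviation rnorm :: "int ^ 'd \<Rightarrow> real" where
  "rnorm n \<equiv> norm (rvec n)"

lemma rvec_nth [simp]: "rvec n $ i = real_of_int (n $ i)"
  by (simp add: rvec_def)

lemma inj_rvec: "inj rvec"
  by (auto simp: inj_def vec_eq_iff)

lemma norm_rvec_ge_1: "n \<noteq> 0 \<Longrightarrow> 1 \<le> rnorm n"
proof -
  assume "n \<noteq> 0"
  then obtain i where "n $ i \<noteq> 0" by (auto simp: vec_eq_iff)
  then have "1 \<le> \<bar>rvec n $ i\<bar>" by simp
  also have "\<dots> \<le> rnorm n" by (rule component_le_norm_cart)
  finally show ?thesis .
qed

lemma exists_dominant_coordinate:
  fixes v :: "real ^ 'd"
  obtains i where "\<And>j. \<bar>v $ j\<bar> \<le> \<bar>v $ i\<bar>" "norm v \<le> real CARD('d) * \<bar>v $ i\<bar>"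
proof -
  have "Max (range (\<lambda>j. \<bar>v $ j\<bar>)) \<in> range (\<lambda>j. \<bar>v $ j\<bar>)" by (rule Max_in) auto
  then obtain i where "Max (range (\<lambda>j. \<bar>v $ j\<bar>)) = \<bar>v $ i\<bar>" by blast
  then have i: "\<bar>v $ j\<bar> \<le> \<bar>v $ i\<bar>" for j
    by (metis Max_ge finite finite_imageI rangeI)
  have "norm v \<le> (\<Sum>j\<in>UNIV. \<bar>v $ j\<bar>)" by (rule norm_le_l1_cart)
  also have "\<dots> \<le> (\<Sum>j\<in>(UNIV::'d set). \<bar>v $ i\<bar>)" by (intro sum_mono i)
  finally have "norm v \<le> real CARD('d) * \<bar>v $ i\<bar>" by simp
  with i show thesis by (rule that)
qed

text \<open>The set covered is the \<open>r\<close>-neighbourhood of the hyperplanes on which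
  \<open>n\<close> takes integer values. A fixed box meets O(|n|) of them, and each takes
  O(\<open>r\<close> to the power 1 - d) sets of diameter O(\<open>r\<close>). The constant
  \<open>C\<close> is the same for all \<open>n\<close> and \<open>r\<close>.\<close>

definition slab_covering :: "real \<Rightarrow> real \<Rightarrow> int^'d \<Rightarrow> real \<Rightarrow> nat \<Rightarrow> (nat \<Rightarrow> (real^'d) set) \<Rightarrow> bool" where
  "slab_covering C R n r M V \<longleftrightarrow>
     {x. (\<forall>j. \<bar>x $ j\<bar> \<le> R) \<and> dist_int (rvec n \<bullet> x) \<le> r * rnorm n} \<subseteq> (\<Union>k<M. V k) \<and>
     (\<forall>k<M. bounded (V k) \<and> diameter (V k) \<le> C * r) \<and>
     real M \<le> C * rnorm n * (1 / r) ^ (CARD('d) - 1)"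

text \<open>The cells of the cover prescribe every coordinate up to \<open>r\<close> except a dominant coordinate
  of \<open>n\<close>, for which they prescribe the value of \<open>n \<bullet> x\<close> instead.\<close>

lemma slab_cover:
  fixes R :: real
  assumes R: "0 < R"
  obtains C :: real where "1 \<le> C"
    "\<And>(n::int^'d) r. n \<noteq> 0 \<Longrightarrow> 0 < r \<Longrightarrow> r \<le> 1 \<Longrightarrow> \<exists>M V. slab_covering C R n r M V"
proof -
  define D where "D = real CARD('d)"
  have D: "1 \<le> D" by (simp add: D_def Suc_leI)
  \<comment> \<open>The first entry bounds the diameter of a cell, \<open>D\<close> coordinates with
    a spread of \<open>4 * D * r\<close> each; the second bounds the number of cells.\<close>
  define C where "C = max (4 * D * D) ((2 * D * R + 5) * (2 * R + 5) ^ (CARD('d) - 1))"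
  have "1 * 1 \<le> D * D" by (intro mult_mono D) (use D in auto)
  then have C1: "1 \<le> C" by (simp add: C_def)
  have "\<exists>M V. slab_covering C R n r M V"
    if n: "n \<noteq> 0" and r: "0 < r" "r \<le> 1" for n :: "int^'d" and r
  proof -
    define \<nu> where "\<nu> = rnorm n"
    have \<nu>: "1 \<le> \<nu>" using norm_rvec_ge_1[OF n] by (simp add: \<nu>_def)
    obtain i where i: "\<And>j. \<bar>rvec n $ j\<bar> \<le> \<bar>rvec n $ i\<bar>" and \<nu>i: "\<nu> \<le> D * \<bar>rvec n $ i\<bar>"
      unfolding \<nu>_def D_def by (metis exists_dominant_coordinate)
    define m where "m = \<bar>rvec n $ i\<bar>"
    have m: "0 < m" using \<nu>i \<nu> D unfolding m_def
      by (metis abs_ge_zero le_less mult_zero_right not_one_le_zero order_trans)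
    define P where "P = \<lceil>\<nu> * (D * R) + 1\<rceil>"
    define K where "K = \<lceil>R / r + 1\<rceil>"
    define I where "I = PiE UNIV (\<lambda>j. if j = i then {-P..P} else {-K..K})"
    define U where "U f = {x::real^'d. (\<forall>j. j \<noteq> i \<longrightarrow> \<bar>x $ j - r * of_int (f j)\<bar> \<le> r)
        \<and> \<bar>rvec n \<bullet> x - of_int (f i)\<bar> \<le> r * \<nu>}" for f :: "'d \<Rightarrow> int"
    have finI: "finite I" unfolding I_def by (intro finite_PiE) auto
    have P0: "0 \<le> P" "real_of_int P \<le> \<nu> * (D * R + 2)"
    proof -
      have "0 \<le> \<nu> * (D * R) + 1" using \<nu> D R by simp
      then show "0 \<le> P" unfolding P_def by (metis ceiling_mono ceiling_zero)
      have "real_of_int P \<le> \<nu> * (D * R) + 2" unfolding P_def by linarith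
      then show "real_of_int P \<le> \<nu> * (D * R + 2)" using \<nu> by (simp add: algebra_simps)
    qed
    have K0: "0 \<le> K" "real_of_int K \<le> (R + 2) / r"
    proof -
      have "0 \<le> R / r + 1" using R r by simp
      then show "0 \<le> K" unfolding K_def by (metis ceiling_mono ceiling_zero)
      have "real_of_int K \<le> R / r + 2" unfolding K_def by linarith
      also have "\<dots> \<le> R / r + 2 / r" using r by (simp add: field_simps)
      finally show "real_of_int K \<le> (R + 2) / r" by (simp add: add_divide_distrib)
    qed
    have "real (card I) = (\<Prod>j\<in>UNIV. real (card (if j = i then {-P..P} else {-K..K})))"
      unfolding I_def by (subst card_PiE) auto
    also have "\<dots> = real_of_int (2 * P + 1) * (\<Prod>j\<in>UNIV - {i}. real_of_int (2 * K + 1))"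
      by (subst prod.remove[of UNIV i]) (use P0 K0 in \<open>auto intro!: prod.cong\<close>)
    also have "\<dots> = real_of_int (2 * P + 1) * real_of_int (2 * K + 1) ^ (CARD('d) - 1)"
      by simp
    also have "\<dots> \<le> (\<nu> * (2 * D * R + 5)) * ((2 * R + 5) / r) ^ (CARD('d) - 1)"
    proof (intro mult_mono power_mono)
      show "real_of_int (2 * P + 1) \<le> \<nu> * (2 * D * R + 5)"
        using P0 \<nu> by (simp add: algebra_simps)
      have "1 \<le> 1 / r" using r by simp
      then show "real_of_int (2 * K + 1) \<le> (2 * R + 5) / r"
        using K0 by (simp add: add_divide_distrib)
      show "0 \<le> \<nu> * (2 * D * R + 5)" using \<nu> D R by simp
    qed (use K0 in auto)
    also have "\<dots> = ((2 * D * R + 5) * (2 * R + 5) ^ (CARD('d) - 1)) * (\<nu> * (1 / r) ^ (CARD('d) - 1))"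
      by (simp add: power_divide)
    also have "\<dots> \<le> C * (\<nu> * (1 / r) ^ (CARD('d) - 1))"
      using \<nu> r by (intro mult_right_mono) (auto simp: C_def)
    finally have cardI: "real (card I) \<le> C * \<nu> * (1 / r) ^ (CARD('d) - 1)" by simp
    have close: "norm (x - x') \<le> C * r" if x: "x \<in> U f" "x' \<in> U f" for x x' f
    proof -
      have j: "\<bar>x $ j - x' $ j\<bar> \<le> 2 * r" if "j \<noteq> i" for j
      proof -
        have "\<bar>x $ j - r * of_int (f j)\<bar> \<le> r" "\<bar>x' $ j - r * of_int (f j)\<bar> \<le> r"
          using x that by (auto simp: U_def)
        then show ?thesis by linarith
      qed
      \<comment> \<open>The coordinate \<open>i\<close> is recovered from the product with
        \<open>n\<close>. Dividing by the entry of \<open>n\<close> of largest absolute value costs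
        only a constant, since the other entries are no larger and |n| is at most \<open>D\<close>
        times that entry.\<close>
      have "rvec n \<bullet> (x - x') = (\<Sum>j\<in>UNIV. rvec n $ j * (x $ j - x' $ j))"
        by (simp add: inner_vec_def)
      also have "\<dots> = rvec n $ i * (x $ i - x' $ i) + (\<Sum>j\<in>UNIV - {i}. rvec n $ j * (x $ j - x' $ j))"
        by (subst sum.remove[of UNIV i]) auto
      finally have eq: "rvec n $ i * (x $ i - x' $ i) =
          rvec n \<bullet> (x - x') - (\<Sum>j\<in>UNIV - {i}. rvec n $ j * (x $ j - x' $ j))" by simp
      have "\<bar>\<Sum>j\<in>UNIV - {i}. rvec n $ j * (x $ j - x' $ j)\<bar> \<le> (\<Sum>j\<in>UNIV - {i}. m * (2 * r))"
        by (rule order_trans[OF sum_abs], rule sum_mono, subst abs_mult, rule mult_mono)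
          (use i j m in \<open>auto simp: m_def\<close>)
      also have "\<dots> \<le> D * (m * (2 * r))"
        using m r D by (simp add: D_def algebra_simps card_Diff_singleton)
      finally have 1: "\<bar>\<Sum>j\<in>UNIV - {i}. rvec n $ j * (x $ j - x' $ j)\<bar> \<le> D * (m * (2 * r))" .
      have "\<bar>rvec n \<bullet> x - of_int (f i)\<bar> \<le> r * \<nu>" "\<bar>rvec n \<bullet> x' - of_int (f i)\<bar> \<le> r * \<nu>"
        using x by (auto simp: U_def)
      then have "\<bar>rvec n \<bullet> (x - x')\<bar> \<le> 2 * (r * \<nu>)" by (simp add: inner_diff_right)
      also have "\<dots> \<le> 2 * (r * (D * m))"
        using \<nu>i r by (simp add: m_def)
      finally have 2: "\<bar>rvec n \<bullet> (x - x')\<bar> \<le> D * (m * (2 * r))" by (simp add: mult_ac)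
      have "m * \<bar>x $ i - x' $ i\<bar> \<le> D * (m * (2 * r)) + D * (m * (2 * r))"
        using 1 2 eq unfolding m_def abs_mult[symmetric] by linarith
      then have "m * \<bar>x $ i - x' $ i\<bar> \<le> m * (4 * D * r)" by (simp add: algebra_simps)
      then have xi: "\<bar>x $ i - x' $ i\<bar> \<le> 4 * D * r" using m by simp
      have "2 * r \<le> 4 * D * r" using D r by (intro mult_right_mono) auto
      then have "\<bar>(x - x') $ j\<bar> \<le> 4 * D * r" for j
        using xi j[of j] by (cases "j = i") auto
      then have "norm (x - x') \<le> (\<Sum>j\<in>(UNIV::'d set). 4 * D * r)"
        by (intro order_trans[OF norm_le_l1_cart] sum_mono)
      also have "\<dots> = 4 * D * D * r" by (simp add: D_def)
      also have "\<dots> \<le> C * r" using r by (intro mult_right_mono) (auto simp: C_def)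
      finally show ?thesis .
    qed
    have dia: "bounded (U f)" "diameter (U f) \<le> C * r" for f
    proof -
      show "bounded (U f)"
        unfolding bounded_def dist_norm using close by blast
      show "diameter (U f) \<le> C * r"
        by (rule diameter_le) (use close C1 r in auto)
    qed
    obtain e where e: "bij_betw e {0..<card I} I" using ex_bij_betw_nat_finite[OF finI] by blast
    have cov: "{x. (\<forall>j. \<bar>x $ j\<bar> \<le> R) \<and> dist_int (rvec n \<bullet> x) \<le> r * \<nu>} \<subseteq> (\<Union>k<card I. U (e k))"
    proof
      fix x :: "real^'d" assume "x \<in> {x. (\<forall>j. \<bar>x $ j\<bar> \<le> R) \<and> dist_int (rvec n \<bullet> x) \<le> r * \<nu>}"
      then have x: "\<And>j. \<bar>x $ j\<bar> \<le> R" "dist_int (rvec n \<bullet> x) \<le> r * \<nu>" by auto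
      define f where "f j = (if j = i then round (rvec n \<bullet> x) else \<lfloor>x $ j / r\<rfloor>)" for j
      have "norm x \<le> (\<Sum>j\<in>(UNIV::'d set). R)" by (intro order_trans[OF norm_le_l1_cart] sum_mono x)
      then have "norm x \<le> D * R" by (simp add: D_def)
      then have "\<bar>rvec n \<bullet> x\<bar> \<le> \<nu> * (D * R)"
        unfolding \<nu>_def by (intro order_trans[OF Cauchy_Schwarz_ineq2] mult_left_mono) auto
      then have "\<bar>real_of_int (round (rvec n \<bullet> x))\<bar> \<le> \<nu> * (D * R) + 1"
        using of_int_round_abs_le[of "rvec n \<bullet> x"] by linarith
      then have fi: "f i \<in> {-P..P}" unfolding P_def f_def by (simp add: abs_le_iff) linarith
      have fj: "f j \<in> {-K..K}" if "j \<noteq> i" for j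
      proof -
        have "\<bar>x $ j / r\<bar> \<le> R / r" using x(1)[of j] r by (simp add: divide_right_mono)
        then have "\<bar>real_of_int \<lfloor>x $ j / r\<rfloor>\<bar> \<le> R / r + 1" by linarith
        then show ?thesis using that unfolding K_def f_def by (simp add: abs_le_iff) linarith
      qed
      have "f \<in> I" unfolding I_def using fi fj by (intro PiE_I) auto
      moreover have "x \<in> U f"
      proof -
        have "\<bar>x $ j - r * of_int \<lfloor>x $ j / r\<rfloor>\<bar> \<le> r" for j
        proof -
          have "\<bar>x $ j / r - of_int \<lfloor>x $ j / r\<rfloor>\<bar> \<le> 1" by linarith
          then have "r * \<bar>x $ j / r - of_int \<lfloor>x $ j / r\<rfloor>\<bar> \<le> r * 1" using r by (intro mult_left_mono) auto
          moreover have "r * \<bar>x $ j / r - of_int \<lfloor>x $ j / r\<rfloor>\<bar> = \<bar>x $ j - r * of_int \<lfloor>x $ j / r\<rfloor>\<bar>"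
            using r by (subst abs_of_pos[OF r(1), symmetric], subst abs_mult[symmetric])
              (simp add: right_diff_distrib)
          ultimately show ?thesis by simp
        qed
        then show ?thesis using x(2) by (auto simp: U_def f_def dist_int_def)
      qed
      moreover have "I = e ` {0..<card I}" using e by (simp add: bij_betw_def)
      ultimately show "x \<in> (\<Union>k<card I. U (e k))" by (metis UN_iff atLeast0LessThan imageE)
    qed
    show ?thesis
      by (rule exI[of _ "card I"], rule exI[of _ "\<lambda>k. U (e k)"])
        (use cov dia cardI in \<open>auto simp: slab_covering_def \<nu>_def\<close>)
  qed
  with C1 show thesis by (rule that)
qed

text \<open>The complement consists of the points with one constant \<open>c\<close> for all of
  \<open>S\<close>, which is the hypothesis of \<open>holder_at_davenport\<close>. Quantifying over
  all \<open>c\<close>, instead of asking for infinitely many \<open>n\<close>, also puts every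
  point of a hyperplane belonging to a nonzero \<open>n\<close> in \<open>S\<close> into the set,
  and it lets a small \<open>c\<close> take the place of the tail of a series in covering
  arguments.\<close>

definition bad_set :: "(int^'d) set \<Rightarrow> real \<Rightarrow> (real^'d) set" where
  "bad_set S \<tau> = {x. \<forall>c>0. \<exists>n\<in>S. dist_int (rvec n \<bullet> x) < c * rnorm n powr (1 - \<tau>)}"

text \<open>With slabs of thickness \<rho> = c |n|^(-\<tau>), the number of cells is O(|n|
  \<rho>^(1-d)), so the gauges for one \<open>n\<close> add up to O(|n| \<rho>^\<sigma>) =
  O(c^\<sigma> |n|^(1-\<tau>\<sigma>)). The sum over \<open>S\<close> is finite and tends to 0 with
  c.\<close>

lemma hausdorff_measure_bad_set:
  fixes S :: "(int^'d) set"
  assumes S: "0 \<notin> S" and \<tau>: "0 \<le> \<tau>" and \<sigma>: "0 < \<sigma>"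
    and summ: "(\<lambda>n. rnorm n powr (1 - \<tau> * \<sigma>)) summable_on S"
  shows "hausdorff_measure (real CARD('d) - 1 + \<sigma>) (bad_set S \<tau>) = 0"
proof -
  define s where "s = real CARD('d) - 1 + \<sigma>"
  have s: "0 < s" unfolding s_def using \<sigma> by (simp add: Suc_leI add_nonneg_pos)
  have "hausdorff_measure s {x \<in> bad_set S \<tau>. \<forall>j. \<bar>x $ j\<bar> \<le> real (Suc N)}  = 0" for N :: nat
  proof (rule hausdorff_measure_0I)
    fix \<delta> \<eta> :: real assume \<delta>: "0 < \<delta>" and \<eta>: "0 < \<eta>"
    obtain C where C: "1 \<le> C" and cov:
      "\<And>(n::int^'d) \<rho>. n \<noteq> 0 \<Longrightarrow> 0 < \<rho> \<Longrightarrow> \<rho> \<le> 1 \<Longrightarrow> \<exists>M V. slab_covering C (Suc N) n \<rho> M V"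
      by (rule slab_cover[of "real (Suc N)"]) auto
    define T where "T = infsum (\<lambda>n. rnorm n powr (1 - \<tau> * \<sigma>)) S"
    have T: "0 \<le> T" unfolding T_def by (rule infsum_nonneg) auto
    define L where "L = C * C powr s * (T + 1)"
    have L: "0 < L" unfolding L_def using C T by simp
    \<comment> \<open>The entries keep the thickness at most 1 as the slab cover demands, the
      diameters at most \<delta>, and the total \<open>c powr \<sigma> * L\<close> at most
      \<eta>.\<close>
    define c where "c = min 1 (min (\<delta> / C) ((\<eta> / L) powr (1 / \<sigma>)))"
    have c: "0 < c" "c \<le> 1" "c \<le> \<delta> / C" "c \<le> (\<eta> / L) powr (1 / \<sigma>)"
      using C \<delta> \<eta> L by (auto simp: c_def)
    have c\<sigma>: "c powr \<sigma> * L \<le> \<eta>"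
    proof -
      have "c powr \<sigma> \<le> ((\<eta> / L) powr (1 / \<sigma>)) powr \<sigma>" using c \<sigma> by (intro powr_mono2) auto
      also have "\<dots> = \<eta> / L" using \<sigma> \<eta> L by (simp add: powr_powr)
      finally show ?thesis using L by (simp add: field_simps)
    qed
    define \<rho> where "\<rho> n = c * rnorm n powr (- \<tau>)" for n :: "int^'d"
    have n1: "1 \<le> rnorm n" if "n \<in> S" for n
      using that S norm_rvec_ge_1[of n] by metis
    have \<rho>: "0 < \<rho> n" "\<rho> n \<le> c" if "n \<in> S" for n
    proof -
      have "rnorm n powr (- \<tau>) \<le> rnorm n powr 0"
        using n1[OF that] \<tau> by (intro powr_mono) auto
      then show "\<rho> n \<le> c" using c n1[OF that] by (simp add: \<rho>_def mult_left_le split: if_splits)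
      show "0 < \<rho> n" unfolding \<rho>_def using c n1[OF that] by (intro mult_pos_pos) auto
    qed
    have "\<forall>n\<in>S. \<exists>M V. slab_covering C (Suc N) n (\<rho> n) M V"
    proof
      fix n assume "n \<in> S"
      then have "n \<noteq> 0" "0 < \<rho> n" "\<rho> n \<le> 1" using S \<rho>[of n] c by auto
      then show "\<exists>M V. slab_covering C (Suc N) n (\<rho> n) M V" by (rule cov)
    qed
    then obtain M V where "\<And>n. n \<in> S \<Longrightarrow> slab_covering C (Suc N) n (\<rho> n) (M n) (V n)" by metis
    then have MV: "\<And>n. n \<in> S \<Longrightarrow>
       {x. (\<forall>j. \<bar>x $ j\<bar> \<le> real (Suc N)) \<and> dist_int (rvec n \<bullet> x) \<le> \<rho> n * rnorm n} \<subseteq> (\<Union>k<M n. V n k)"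
       "\<And>n k. n \<in> S \<Longrightarrow> k < M n \<Longrightarrow> bounded (V n k)"
       "\<And>n k. n \<in> S \<Longrightarrow> k < M n \<Longrightarrow> diameter (V n k) \<le> C * \<rho> n"
       "\<And>n. n \<in> S \<Longrightarrow> real (M n) \<le> C * rnorm n * (1 / \<rho> n) ^ (CARD('d) - 1)"
      unfolding slab_covering_def by auto
    show "hausdorff_premeasure s \<delta> {x \<in> bad_set S \<tau>. \<forall>j. \<bar>x $ j\<bar> \<le> real (Suc N)} \<le> ennreal \<eta>"
    proof (rule hausdorff_premeasure_family_le[where S=S and M=M and V=V and r="\<lambda>n. C * \<rho> n"])
      show "{x \<in> bad_set S \<tau>. \<forall>j. \<bar>x $ j\<bar> \<le> real (Suc N)} \<subseteq> (\<Union>n\<in>S. \<Union>k<M n. V n k)"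
      proof
        fix x assume x: "x \<in> {x \<in> bad_set S \<tau>. \<forall>j. \<bar>x $ j\<bar> \<le> real (Suc N)}"
        then obtain n where n: "n \<in> S" "dist_int (rvec n \<bullet> x) < c * rnorm n powr (1 - \<tau>)"
          using c(1) unfolding bad_set_def by blast
        have "c * rnorm n powr (1 - \<tau>) = \<rho> n * rnorm n"
          using n1[OF n(1)] by (simp add: \<rho>_def powr_diff powr_minus field_simps)
        then have "x \<in> (\<Union>k<M n. V n k)" using MV(1)[OF n(1)] n x by auto
        then show "x \<in> (\<Union>n\<in>S. \<Union>k<M n. V n k)" using n by blast
      qed
      show "C * \<rho> n \<le> \<delta>" if "n \<in> S" for n
      proof -
        have "C * \<rho> n \<le> C * c" using \<rho>[OF that] C by (intro mult_left_mono) auto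
        also have "\<dots> \<le> \<delta>" using c(3) C by (simp add: field_simps)
        finally show ?thesis .
      qed
      fix F assume F: "finite F" "F \<subseteq> S"
      have cell: "real (M n) * rpow (C * \<rho> n) s \<le> C * C powr s * c powr \<sigma> * rnorm n powr (1 - \<tau> * \<sigma>)"
        if "n \<in> S" for n
      proof -
        define \<nu> where "\<nu> = rnorm n"
        have \<nu>: "0 < \<nu>" using n1[OF that] unfolding \<nu>_def by linarith
        have r: "0 < \<rho> n" by (rule \<rho>[OF that])
        have cd: "(1 / \<rho> n) ^ (CARD('d) - 1) = \<rho> n powr (1 - real CARD('d))"
        proof -
          have "(1 / \<rho> n) ^ (CARD('d) - 1) = (1 / \<rho> n) powr real (CARD('d) - 1)"
            using r by (subst powr_realpow) auto
          also have "(1 / \<rho> n) powr t = \<rho> n powr (- t)" for t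
            using r by (simp add: powr_minus_divide powr_divide)
          finally show ?thesis by (simp add: of_nat_diff Suc_leI)
        qed
        have "real (M n) * rpow (C * \<rho> n) s \<le> (C * \<nu> * (1 / \<rho> n) ^ (CARD('d) - 1)) * rpow (C * \<rho> n) s"
          using MV(4)[OF that] C r by (intro mult_right_mono rpow_nonneg) (auto simp: \<nu>_def)
        also have "\<dots> = C * \<nu> * \<rho> n powr (1 - real CARD('d)) * (C powr s * \<rho> n powr s)"
          using s C r unfolding cd by (simp add: rpow_def powr_mult)
        also have "\<dots> = C * C powr s * \<nu> * (\<rho> n powr (1 - real CARD('d)) * \<rho> n powr s)"
          by simp
        also have "\<rho> n powr (1 - real CARD('d)) * \<rho> n powr s = \<rho> n powr \<sigma>"
          by (simp add: powr_add[symmetric] s_def)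
        also have "\<rho> n powr \<sigma> = c powr \<sigma> * \<nu> powr (- (\<tau> * \<sigma>))"
          using c \<nu> by (simp add: \<rho>_def powr_mult powr_powr \<nu>_def)
        also have "C * C powr s * \<nu> * (c powr \<sigma> * \<nu> powr (- (\<tau> * \<sigma>))) = C * C powr s * c powr \<sigma> * \<nu> powr (1 - \<tau> * \<sigma>)"
          using \<nu> by (simp add: powr_diff powr_minus divide_inverse)
        finally show ?thesis by (simp add: \<nu>_def)
      qed
      have "(\<Sum>n\<in>F. real (M n) * rpow (C * \<rho> n) s) \<le>
          (\<Sum>n\<in>F. C * C powr s * c powr \<sigma> * rnorm n powr (1 - \<tau> * \<sigma>))"
        using F by (intro sum_mono cell) auto
      also have "\<dots> = C * C powr s * c powr \<sigma> * (\<Sum>n\<in>F. rnorm n powr (1 - \<tau> * \<sigma>))"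
        by (simp add: sum_distrib_left)
      also have "\<dots> \<le> C * C powr s * c powr \<sigma> * (T + 1)"
      proof (rule mult_left_mono)
        have "(\<Sum>n\<in>F. rnorm n powr (1 - \<tau> * \<sigma>)) \<le> T"
          unfolding T_def using F summ by (intro finite_sum_le_infsum) auto
        then show "(\<Sum>n\<in>F. rnorm n powr (1 - \<tau> * \<sigma>)) \<le> T + 1" by simp
      qed (use C in auto)
      also have "\<dots> = c powr \<sigma> * L" by (simp add: L_def)
      finally show "(\<Sum>n\<in>F. real (M n) * rpow (C * \<rho> n) s) \<le> \<eta>" using c\<sigma> by linarith
    qed (use MV s \<delta> C \<rho> in \<open>auto simp: less_imp_le\<close>)
  qed
  then have "hausdorff_measure s (\<Union>N::nat. {x \<in> bad_set S \<tau>. \<forall>j. \<bar>x $ j\<bar> \<le> real (Suc N)}) = 0"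
    by (intro hausdorff_measure_0_UN)
  then show ?thesis
    unfolding s_def[symmetric]
  proof (rule hausdorff_measure_0_mono, intro subsetI)
    fix x assume x: "x \<in> bad_set S \<tau>"
    obtain N :: nat where "norm x \<le> real N" using real_arch_simple by blast
    then have "\<bar>x $ j\<bar> \<le> real (Suc N)" for j using component_le_norm_cart[of x j] by simp
    then show "x \<in> (\<Union>N::nat. {x \<in> bad_set S \<tau>. \<forall>j. \<bar>x $ j\<bar> \<le> real (Suc N)})" using x by blast
  qed
qed


section \<open>Sparse supports\<close>

lemma sparse_set_card_le:
  assumes Q: "sparse_set Q" and e: "0 < e"
  obtains B where "0 < B" "\<And>R. 1 \<le> R \<Longrightarrow> real (card (Q \<inter> ball 0 R)) \<le> B * R powr e"
proof -
  have "((\<lambda>R. ln (real (card (Q \<inter> ball 0 R))) / ln R) \<longlongrightarrow> 0) at_top"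
    using Q by (simp add: sparse_set_def)
  then have "\<forall>\<^sub>F R in at_top. ln (real (card (Q \<inter> ball 0 R))) / ln R < e"
    using e by (rule order_tendstoD)
  then obtain R0 where R0: "\<And>R. R0 \<le> R \<Longrightarrow> ln (real (card (Q \<inter> ball 0 R))) / ln R < e"
    by (auto simp: eventually_at_top_linorder)
  define R1 where "R1 = max 2 R0"
  have big: "real (card (Q \<inter> ball 0 R)) \<le> R powr e" if "R1 \<le> R" for R
  proof (cases "card (Q \<inter> ball 0 R) = 0")
    case False
    have R: "2 \<le> R" "R0 \<le> R" using that by (auto simp: R1_def)
    then have "0 < ln R" by simp
    then have "ln (real (card (Q \<inter> ball 0 R))) \<le> e * ln R"
      using R0[OF R(2)] by (simp add: field_simps)
    then have "exp (ln (real (card (Q \<inter> ball 0 R)))) \<le> exp (e * ln R)" by simp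
    then show ?thesis using False R by (simp add: powr_def)
  qed simp
  define B where "B = 1 + real (card (Q \<inter> ball 0 R1))"
  have "real (card (Q \<inter> ball 0 R)) \<le> B * R powr e" if R: "1 \<le> R" for R
  proof (cases "R1 \<le> R")
    case True
    then have "real (card (Q \<inter> ball 0 R)) \<le> R powr e" by (rule big)
    also have "\<dots> \<le> B * R powr e" by (simp add: B_def algebra_simps)
    finally show ?thesis .
  next
    case False
    have "finite (Q \<inter> ball 0 R1)" using Q by (simp add: sparse_set_def)
    then have "card (Q \<inter> ball 0 R) \<le> card (Q \<inter> ball 0 R1)"
      by (rule card_mono) (use False in auto)
    then have "real (card (Q \<inter> ball 0 R)) \<le> B * 1" by (simp add: B_def)
    also have "\<dots> \<le> B * R powr e"
      using R e by (intro mult_left_mono ge_one_powr_ge_zero) (auto simp: B_def)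
    finally show ?thesis .
  qed
  then show thesis by (intro that[of B]) (auto simp: B_def)
qed

text \<open>The k-th dyadic annulus contains O(2^(k e/2)) points, by sparseness with exponent e/2,
  and each contributes at most 2^(-k e). The series is dominated by a geometric one of ratio
  2^(-e/2).\<close>

lemma sparse_set_summable_powr:
  assumes Q: "sparse_set Q" and Q1: "\<And>x. x \<in> Q \<Longrightarrow> 1 \<le> norm x" and e: "0 < e"
  shows "(\<lambda>x. norm x powr - e) summable_on Q"
proof (rule nonneg_bdd_above_summable_on)
  obtain B where B: "0 < B" "\<And>R. 1 \<le> R \<Longrightarrow> real (card (Q \<inter> ball 0 R)) \<le> B * R powr (e/2)"
    using sparse_set_card_le[OF Q, of "e/2"] e by auto
  define z where "z = (2::real) powr (- (e/2))"
  have z: "0 < z" "z < 1" using e by (auto simp: z_def powr_less_one)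
  define T where "T = B * 2 powr (e/2) * (1 / (1 - z))"
  have "(\<Sum>x\<in>F. norm x powr - e) \<le> T" if F: "F \<subseteq> Q" "finite F" for F
  proof -
    obtain K :: nat where K: "\<And>x. x \<in> F \<Longrightarrow> norm x < 2 ^ K"
    proof -
      obtain b where b: "\<And>x. x \<in> F \<Longrightarrow> norm x \<le> b"
        using finite_imp_bounded[OF F(2)] by (auto simp: bounded_iff)
      obtain K where "b < 2 ^ K" using real_arch_pow[of 2 b] by auto
      then show thesis using b that by (meson le_less_trans)
    qed
    define A where "A k = {x \<in> F. 2 ^ k \<le> norm x \<and> norm x < 2 ^ Suc k}" for k :: nat
    have "norm x powr - e \<le> (\<Sum>k<K. if x \<in> A k then (2 ^ k) powr - e else 0)" if x: "x \<in> F" for x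
    proof -
      have "1 \<le> norm x" using x F Q1 by auto
      define k where "k = (LEAST k. norm x < 2 ^ Suc k)"
      have ex: "norm x < 2 ^ Suc K" using K[OF x] by (rule less_le_trans) simp
      have k: "norm x < 2 ^ Suc k" unfolding k_def by (rule LeastI[of _ K]) (use ex in simp)
      have k2: "2 ^ k \<le> norm x"
      proof (cases k)
        case 0 then show ?thesis using \<open>1 \<le> norm x\<close> by simp
      next
        case (Suc j)
        then have "j < k" by simp
        from not_less_Least[OF this[unfolded k_def]] show ?thesis using Suc by simp
      qed
      have kK: "k < K"
      proof (rule ccontr)
        assume "\<not> k < K"
        then have "(2::real) ^ K \<le> 2 ^ k" by (intro power_increasing) auto
        then show False using k2 K[OF x] by linarith
      qed
      have xA: "x \<in> A k" using k k2 x by (simp add: A_def)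
      have "norm x powr - e \<le> (2 ^ k) powr - e" using k2 e by (intro powr_mono2') auto
      also have "\<dots> = (if x \<in> A k then (2 ^ k) powr - e else 0)" using xA by simp
      also have "\<dots> \<le> (\<Sum>k<K. if x \<in> A k then (2 ^ k) powr - e else 0)"
        using kK by (intro member_le_sum) auto
      finally show ?thesis .
    qed
    then have "(\<Sum>x\<in>F. norm x powr - e) \<le> (\<Sum>x\<in>F. \<Sum>k<K. if x \<in> A k then (2 ^ k) powr - e else 0)"
      by (rule sum_mono)
    also have "\<dots> = (\<Sum>k<K. \<Sum>x\<in>F. if x \<in> A k then (2 ^ k) powr - e else 0)" by (rule sum.swap)
    also have "\<dots> = (\<Sum>k<K. real (card (A k)) * (2 ^ k) powr - e)"
    proof (rule sum.cong[OF refl])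
      fix k
      have "(\<Sum>x\<in>F. if x \<in> A k then (2 ^ k) powr - e else 0) = (\<Sum>x\<in>{x\<in>F. x \<in> A k}. (2 ^ k) powr - e)"
        using F(2) by (rule sum.inter_filter[symmetric])
      also have "{x\<in>F. x \<in> A k} = A k" by (auto simp: A_def)
      finally show "(\<Sum>x\<in>F. if x \<in> A k then (2 ^ k) powr - e else 0) = real (card (A k)) * (2 ^ k) powr - e" by simp
    qed
    also have "\<dots> \<le> (\<Sum>k<K. B * 2 powr (e/2) * z ^ k)"
    proof (rule sum_mono)
      fix k
      have "A k \<subseteq> Q \<inter> ball 0 (2 ^ Suc k)" using F by (auto simp: A_def)
      then have "card (A k) \<le> card (Q \<inter> ball 0 (2 ^ Suc k))"
        using Q by (intro card_mono) (auto simp: sparse_set_def)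
      then have "real (card (A k)) \<le> B * (2 ^ Suc k) powr (e/2)"
        using B(2)[of "2 ^ Suc k"] one_le_power[of "2::real" "Suc k"] by linarith
      then have "real (card (A k)) * (2 ^ k) powr - e \<le> B * (2 ^ Suc k) powr (e/2) * (2 ^ k) powr - e"
        by (intro mult_right_mono) auto
      also have "\<dots> = B * 2 powr (e/2) * ((2 ^ k) powr (e/2) * (2 ^ k) powr - e)"
        by (simp add: powr_mult)
      also have "(2 ^ k) powr (e/2) * (2 ^ k) powr - e = ((2::real) ^ k) powr (- (e/2))"
        by (subst powr_add[symmetric]) (simp add: field_simps)
      also have "\<dots> = z ^ k"
        unfolding z_def by (subst (1 2) powr_realpow[symmetric]) (auto simp: powr_powr mult.commute)
      finally show "real (card (A k)) * (2 ^ k) powr - e \<le> B * 2 powr (e/2) * z ^ k" .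
    qed
    also have "\<dots> = B * 2 powr (e/2) * (\<Sum>k<K. z ^ k)" by (simp add: sum_distrib_left)
    also have "\<dots> \<le> T"
    proof -
      have "(\<Sum>k<K. z ^ k) \<le> (\<Sum>k. z ^ k)" using z by (intro sum_le_suminf summable_geometric) auto
      also have "\<dots> = 1 / (1 - z)" using z by (intro suminf_geometric) auto
      finally show ?thesis unfolding T_def using B by (intro mult_left_mono) auto
    qed
    finally show ?thesis .
  qed
  then show "bdd_above (sum (\<lambda>x. norm x powr - e) ` {F. F \<subseteq> Q \<and> finite F})"
    by (intro bdd_aboveI2[where M=T]) auto
qed auto

section \<open>Growth of the coefficients and lower bounds for the sums \<open>Asum\<close>\<close>

lemma eventually_to_infinity_in:
  "eventually P (to_infinity_in S) \<longleftrightarrow> (\<exists>R. \<forall>n\<in>S. R \<le> rnorm n \<longrightarrow> P n)"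
  unfolding to_infinity_in_def eventually_inf_principal eventually_filtercomap eventually_at_infinity
proof
  assume "\<exists>Q. (\<exists>b. \<forall>x. b \<le> norm x \<longrightarrow> Q x) \<and> (\<forall>x. Q (rvec x) \<longrightarrow> x \<in> S \<longrightarrow> P x)"
  then show "\<exists>R. \<forall>n\<in>S. R \<le> rnorm n \<longrightarrow> P n" by blast
next
  assume "\<exists>R. \<forall>n\<in>S. R \<le> rnorm n \<longrightarrow> P n"
  then obtain R where "\<forall>n\<in>S. R \<le> rnorm n \<longrightarrow> P n" by blast
  then show "\<exists>Q. (\<exists>b. \<forall>x. b \<le> norm x \<longrightarrow> Q x) \<and> (\<forall>x. Q (rvec x) \<longrightarrow> x \<in> S \<longrightarrow> P x)"
    by (intro exI[of _ "\<lambda>x. R \<le> norm x"]) auto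
qed

locale sparse_davenport =
  fixes a :: "int ^ 'd \<Rightarrow> 'k::{real_normed_field,banach}"
  assumes odd: "\<And>n. a (- n) = - a n"
    and summable: "(\<lambda>n. norm (a n)) summable_on UNIV"
    and sparse: "sparse_set (rvec ` supp a)"
    and theta: "theta a \<le> 1"
    and gamma: "0 < gamma a" "gamma a < \<infinity>"
begin

definition G :: real where "G = real_of_ereal (gamma a)"

lemma gamma_eq: "gamma a = ereal G"
  using gamma unfolding G_def by (cases "gamma a") auto

lemma G_pos: "0 < G"
  using gamma by (simp add: gamma_eq)

lemma zero_notin_supp: "0 \<notin> supp a"
proof -
  have "a 0 + a 0 = 0" using odd[of 0] by (metis add.right_inverse minus_zero)
  then show ?thesis by (simp add: supp_def mult_2[symmetric])
qed

lemma norm_supp_ge_1: "n \<in> supp a \<Longrightarrow> 1 \<le> rnorm n"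
  using zero_notin_supp norm_rvec_ge_1 by metis

lemma supp_summable_powr: "0 < e \<Longrightarrow> (\<lambda>n. rnorm n powr - e) summable_on supp a"
  using sparse_set_summable_powr[OF sparse, of e] norm_supp_ge_1
  by (subst (asm) summable_on_reindex) (auto simp: inj_on_subset[OF inj_rvec] o_def)

lemma finite_supp_norm_le: "finite {n \<in> supp a. rnorm n \<le> R}"
proof -
  have "finite (rvec ` supp a \<inter> ball 0 (R + 1))" using sparse by (simp add: sparse_set_def)
  then have "finite (rvec ` {n \<in> supp a. rnorm n \<le> R})"
    by (rule rev_finite_subset) auto
  then show ?thesis using inj_on_subset[OF inj_rvec subset_UNIV] by (rule finite_imageD)
qed

lemma coeff_upper:
  assumes "\<beta> < G"
  obtains K where "0 < K" "\<And>n. n \<in> supp a \<Longrightarrow> norm (a n) \<le> K * rnorm n powr - \<beta>"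
proof -
  have "ereal \<beta> < gamma a" using assms by (simp add: gamma_eq)
  then have "\<forall>\<^sub>F n in to_infinity_in (supp a). ereal \<beta> < - elog (norm (a n)) / ereal (ln (rnorm n))"
    unfolding gamma_def by (rule less_LiminfD)
  then obtain R where R: "\<And>n. n \<in> supp a \<Longrightarrow> R \<le> rnorm n \<Longrightarrow>
      ereal \<beta> < - elog (norm (a n)) / ereal (ln (rnorm n))"
    by (auto simp: eventually_to_infinity_in)
  define R' where "R' = max 2 R"
  have big: "norm (a n) \<le> rnorm n powr - \<beta>" if n: "n \<in> supp a" "R' \<le> rnorm n" for n
  proof -
    have n2: "2 \<le> rnorm n" "R \<le> rnorm n" using n by (auto simp: R'_def)
    have a0: "0 < norm (a n)" using n by (simp add: supp_def)
    have l: "0 < ln (rnorm n)" using n2 by (intro ln_gt_zero) linarith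
    have "\<beta> < - ln (norm (a n)) / ln (rnorm n)"
      using R[OF n(1) n2(2)] a0 l by (simp add: elog_def)
    then have "ln (norm (a n)) \<le> - \<beta> * ln (rnorm n)" using l by (simp add: field_simps)
    then have "exp (ln (norm (a n))) \<le> exp (- \<beta> * ln (rnorm n))" by (subst exp_le_cancel_iff)
    moreover have "exp (- \<beta> * ln (rnorm n)) = rnorm n powr - \<beta>" using n2 by (auto simp: powr_def)
    moreover have "exp (ln (norm (a n))) = norm (a n)" using a0 by (rule exp_ln)
    ultimately show ?thesis by simp
  qed
  define F where "F = {n \<in> supp a. rnorm n \<le> R'}"
  have F: "finite F" unfolding F_def by (rule finite_supp_norm_le)
  define K where "K = 1 + (\<Sum>n\<in>F. norm (a n) * rnorm n powr \<beta>)"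
  have K1: "1 \<le> K" by (simp add: K_def sum_nonneg)
  have "norm (a n) \<le> K * rnorm n powr - \<beta>" if n: "n \<in> supp a" for n
  proof (cases "R' \<le> rnorm n")
    case True
    have "norm (a n) \<le> 1 * rnorm n powr - \<beta>" using big[OF n True] by simp
    also have "\<dots> \<le> K * rnorm n powr - \<beta>" using K1 by (intro mult_right_mono) auto
    finally show ?thesis .
  next
    case False
    then have nF: "n \<in> F" using n by (simp add: F_def)
    have p: "0 < rnorm n" using norm_supp_ge_1[OF n] by linarith
    have "norm (a n) * rnorm n powr \<beta> \<le> (\<Sum>n\<in>F. norm (a n) * rnorm n powr \<beta>)"
      using F nF by (intro member_le_sum) auto
    then have "norm (a n) * rnorm n powr \<beta> \<le> K" by (simp add: K_def)
    then show ?thesis using p by (simp add: powr_minus field_simps)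
  qed
  then show thesis using K1 by (intro that[of K]) auto
qed

text \<open>If no such \<open>n\<close> existed beyond \<open>R\<close>, the lower limit would be at
  least \<beta>. This is also the source of arbitrarily long support vectors: over a finite support
  the filter is trivial and \<open>gamma a\<close> would be infinite.\<close>

lemma coeff_lower:
  assumes "G < \<beta>"
  obtains n where "n \<in> supp a" "R \<le> rnorm n" "rnorm n powr - \<beta> \<le> norm (a n)"
proof (rule ccontr)
  assume "\<not> thesis"
  then have *: "norm (a n) < rnorm n powr - \<beta>" if "n \<in> supp a" "R \<le> rnorm n" for n
    using that \<open>\<And>n. \<lbrakk>n \<in> supp a; R \<le> rnorm n; rnorm n powr - \<beta> \<le> norm (a n)\<rbrakk> \<Longrightarrow> thesis\<close>
    by (meson not_le)
  have "ereal \<beta> \<le> - elog (norm (a n)) / ereal (ln (rnorm n))"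
    if n: "n \<in> supp a" "max 2 R \<le> rnorm n" for n
  proof -
    have a0: "0 < norm (a n)" using n by (simp add: supp_def)
    have l: "0 < ln (rnorm n)" using n by (intro ln_gt_zero) linarith
    have "ln (norm (a n)) \<le> ln (rnorm n powr - \<beta>)" using a0 * [of n] n by (subst ln_le_cancel_iff) auto
    also have "\<dots> = - \<beta> * ln (rnorm n)" using n by (subst ln_powr) auto
    finally have "\<beta> \<le> - ln (norm (a n)) / ln (rnorm n)" using l by (simp add: field_simps)
    then show ?thesis using a0 l by (simp add: elog_def)
  qed
  then have "\<forall>\<^sub>F n in to_infinity_in (supp a). ereal \<beta> \<le> - elog (norm (a n)) / ereal (ln (rnorm n))"
    unfolding eventually_to_infinity_in by blast
  then have "ereal \<beta> \<le> gamma a" unfolding gamma_def by (rule Liminf_bounded)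
  then show False using assms by (simp add: gamma_eq)
qed

lemma supp_summable_weighted:
  assumes "\<beta> < G"
  shows "(\<lambda>n. norm (a n) * rnorm n powr \<beta>) summable_on supp a"
proof -
  define b where "b = (\<beta> + G) / 2"
  have b: "\<beta> < b" "b < G" using assms by (auto simp: b_def)
  obtain K where K: "0 < K" "\<And>n. n \<in> supp a \<Longrightarrow> norm (a n) \<le> K * rnorm n powr - b"
    using coeff_upper[OF b(2)] by blast
  have "(\<lambda>n. K * rnorm n powr - (b - \<beta>)) summable_on supp a"
    using b by (intro summable_on_cmult_right supp_summable_powr) auto
  then show ?thesis
  proof (rule summable_on_comparison_test)
    fix n assume n: "n \<in> supp a"
    have "norm (a n) * rnorm n powr \<beta> \<le> K * rnorm n powr - b * rnorm n powr \<beta>"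
      using K(2)[OF n] by (intro mult_right_mono) auto
    also have "\<dots> = K * rnorm n powr - (b - \<beta>)"
      by (simp add: powr_add[symmetric] mult.assoc)
    finally show "norm (a n) * rnorm n powr \<beta> \<le> K * rnorm n powr - (b - \<beta>)" .
  qed auto
qed

lemma rvec_smult: "rvec (int l *s q) = real l *\<^sub>R rvec q"
  by (simp add: vec_eq_iff)

text \<open>The estimate is uniform in \<open>l\<close> because the multiples of \<open>q\<close>
  are no shorter than \<open>q\<close>. It supplies the upper bound without which the real supremum
  in \<open>abar\<close> has no meaning.\<close>

lemma abar_bounds:
  assumes q: "q \<noteq> 0" and "\<beta> < G" "0 \<le> \<beta>"
    and K: "0 < K" "\<forall>n\<in>supp a. norm (a n) \<le> K * rnorm n powr - \<beta>"
  shows "abar a q \<le> K * rnorm q powr - \<beta>" "\<And>l. 1 \<le> l \<Longrightarrow> norm (a (int l *s q)) \<le> abar a q"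
proof -
  have *: "norm (a (int l *s q)) \<le> K * rnorm q powr - \<beta>" if l: "1 \<le> l" for l :: nat
  proof (cases "int l *s q \<in> supp a")
    case True
    have "rnorm q \<le> rnorm (int l *s q)" using l by (simp add: rvec_smult mult_le_cancel_right1)
    then have "rnorm (int l *s q) powr - \<beta> \<le> rnorm q powr - \<beta>"
      using assms(3) norm_rvec_ge_1[OF q] by (intro powr_mono2') auto
    then have "K * rnorm (int l *s q) powr - \<beta> \<le> K * rnorm q powr - \<beta>" using K by simp
    then show ?thesis using bspec[OF K(2) True] by linarith
  next
    case False
    then show ?thesis using K by (simp add: supp_def)
  qed
  show "abar a q \<le> K * rnorm q powr - \<beta>"
    unfolding abar_def by (rule cSUP_least) (use * in auto)
  show "norm (a (int l *s q)) \<le> abar a q" if "1 \<le> l" for l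
    unfolding abar_def by (rule cSUP_upper) (use that * in \<open>auto intro!: bdd_aboveI\<close>)
qed

text \<open>For long \<open>q\<close> the supremum \<open>abar a q\<close> is below 1 and its
  logarithm is negative, so an upper bound on the quotient of logarithms is a lower bound on
  \<open>Asum a q\<close>. The convention for \<open>elog 0\<close> excludes
  \<open>Asum a q = 0\<close>, for which the quotient would be infinite.\<close>

lemma Asum_lower:
  assumes e: "0 < e"
  obtains R where "\<And>q l. R \<le> rnorm q \<Longrightarrow> 1 \<le> l \<Longrightarrow> int l *s q \<in> supp a \<Longrightarrow>
    norm (a (int l *s q)) powr (1 + e) \<le> norm (Asum a q) \<and> Asum a q \<noteq> 0"
proof -
  define b where "b = G / 2"
  have b: "0 < b" "b < G" using G_pos by (auto simp: b_def)
  obtain K where K: "0 < K" "\<And>n. n \<in> supp a \<Longrightarrow> norm (a n) \<le> K * rnorm n powr - b"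
    using coeff_upper[OF b(2)] by blast
  have "theta a < ereal (1 + e)" using theta e by (rule_tac le_less_trans) auto
  then have "\<forall>\<^sub>F q in to_infinity_in (supp (abar a)). elog (norm (Asum a q)) / elog \<bar>abar a q\<bar> < ereal (1 + e)"
    unfolding theta_def by (rule Limsup_lessD)
  then obtain R where R: "\<And>q. q \<in> supp (abar a) \<Longrightarrow> R \<le> rnorm q \<Longrightarrow>
      elog (norm (Asum a q)) / elog \<bar>abar a q\<bar> < ereal (1 + e)"
    by (auto simp: eventually_to_infinity_in)
  \<comment> \<open>The power of \<open>2 * K\<close> makes \<open>K * rnorm q powr - b\<close> at
    most 1/2, hence \<open>abar a q < 1\<close>.\<close>
  define R' where "R' = max R (max 1 ((2 * K) powr (1 / b)))"
  have "norm (a (int l *s q)) powr (1 + e) \<le> norm (Asum a q) \<and> Asum a q \<noteq> 0"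
    if q: "R' \<le> rnorm q" and l: "1 \<le> l" "int l *s q \<in> supp a" for q l
  proof -
    have "1 \<le> rnorm q" using q by (simp add: R'_def)
    then have q0: "q \<noteq> 0" by (auto simp: rvec_def zero_vec_def[symmetric])
    have K': "\<forall>n\<in>supp a. norm (a n) \<le> K * rnorm n powr - b" using K(2) by blast
    note ab = abar_bounds[OF q0 b(2) less_imp_le[OF b(1)] K(1) K']
    have al: "norm (a (int l *s q)) \<le> abar a q" by (rule ab(2)[OF l(1)])
    have a0: "0 < norm (a (int l *s q))" using l by (simp add: supp_def)
    then have pos: "0 < abar a q" using al by linarith
    have "2 * K = ((2 * K) powr (1 / b)) powr b" using K b by (simp add: powr_powr)
    also have "\<dots> \<le> rnorm q powr b" using q b K by (intro powr_mono2) (auto simp: R'_def)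
    finally have "2 * K \<le> rnorm q powr b" .
    moreover have pos_q: "0 < rnorm q powr b" using \<open>1 \<le> rnorm q\<close> by auto
    ultimately have "K * rnorm q powr - b \<le> 1/2"
      using \<open>0 < K\<close> pos_q by (simp add: powr_minus field_simps)
    then have lt: "abar a q < 1" using ab(1) by linarith
    have "elog (norm (Asum a q)) / elog \<bar>abar a q\<bar> < ereal (1 + e)"
      using R[of q] pos q by (simp add: supp_def R'_def)
    then have th: "elog (norm (Asum a q)) / ereal (ln (abar a q)) < ereal (1 + e)"
      using pos by (simp add: elog_def)
    have ln: "ln (abar a q) < 0" using pos lt by simp
    have A0: "Asum a q \<noteq> 0"
    proof
      assume "Asum a q = 0"
      then show False using th ln by (simp add: elog_def divide_ereal_def)
    qed
    then have "ln (norm (Asum a q)) / ln (abar a q) < 1 + e" using th ln by (simp add: elog_def)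
    then have "(1 + e) * ln (abar a q) \<le> ln (norm (Asum a q))" using ln by (simp add: field_simps)
    then have "exp ((1 + e) * ln (abar a q)) \<le> norm (Asum a q)"
      using A0 by (metis exp_le_cancel_iff exp_ln zero_less_norm_iff)
    then have "abar a q powr (1 + e) \<le> norm (Asum a q)" using pos by (simp add: powr_def)
    moreover have "norm (a (int l *s q)) powr (1 + e) \<le> abar a q powr (1 + e)"
      using al e by (intro powr_mono2) auto
    ultimately show ?thesis using A0 by linarith
  qed
  then show thesis by (rule that)
qed

end


section \<open>Jumps of the series\<close>

lemma abs_sawtooth_le: "\<bar>sawtooth x\<bar> \<le> 1/2"
proof -
  have "\<bar>x - of_int \<lfloor>x\<rfloor> - 1/2\<bar> \<le> 1/2" by linarith
  then show ?thesis by (simp add: sawtooth_def)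
qed

lemma sawtooth_floor:
  assumes "of_int k < x" "x < of_int k + 1"
  shows "sawtooth x = x - of_int k - 1/2"
proof -
  have "\<lfloor>x\<rfloor> = k" using assms by (intro floor_unique) auto
  moreover have "x \<notin> \<int>"
  proof
    assume "x \<in> \<int>"
    then obtain j where "x = of_int j" by (auto elim: Ints_cases)
    then show False using assms by auto
  qed
  ultimately show ?thesis by (simp add: sawtooth_def)
qed

lemma sawtooth_diff:
  assumes "\<bar>s - t\<bar> < dist_int t"
  shows "sawtooth s - sawtooth t = s - t"
proof -
  define k where "k = \<lfloor>t\<rfloor>"
  have k: "of_int k \<le> t" "t < of_int k + 1" unfolding k_def by linarith+
  have "dist_int t \<le> t - of_int k" "dist_int t \<le> of_int k + 1 - t"
    using dist_int_le[of t k] dist_int_le[of t "k+1"] k by auto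
  then have "sawtooth s = s - of_int k - 1/2" "sawtooth t = t - of_int k - 1/2"
    using assms by (intro sawtooth_floor; linarith)+
  then show ?thesis by simp
qed

lemma sawtooth_int_shift:
  assumes "t \<in> \<int>" "u \<noteq> 0" "\<bar>u\<bar> < 1"
  shows "sawtooth (t + u) = u - sgn u / 2"
proof -
  obtain k where t: "t = of_int k" using assms(1) by (auto elim: Ints_cases)
  show ?thesis
  proof (cases "0 < u")
    case True
    then have "sawtooth (t + u) = t + u - of_int k - 1/2" using assms t by (intro sawtooth_floor) auto
    then show ?thesis using True t by simp
  next
    case False
    then have "sawtooth (t + u) = t + u - of_int (k - 1) - 1/2" using assms t by (intro sawtooth_floor) auto
    then show ?thesis using False assms t by simp
  qed
qed

lemma sawtooth_jump:
  "((\<lambda>\<epsilon>. sawtooth (t + \<epsilon> * v) - sawtooth (t - \<epsilon> * v)) \<longlongrightarrow> (if t \<in> \<int> then - sgn v else 0)) (at_right 0)"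
proof (cases "v = 0")
  case True then show ?thesis by simp
next
  case v: False
  define L where "L = (if t \<in> \<int> then - sgn v else 0)"
  define d where "d = (if t \<in> \<int> then 1 else dist_int t)"
  have d: "0 < d" by (simp add: d_def dist_int_pos_iff)
  have "((\<lambda>\<epsilon>. L + 2 * \<epsilon> * v) \<longlongrightarrow> L + 2 * 0 * v) (at_right 0)" by (intro tendsto_intros)
  then have lim: "((\<lambda>\<epsilon>. L + 2 * \<epsilon> * v) \<longlongrightarrow> L) (at_right 0)" by simp
  have "\<forall>\<^sub>F \<epsilon> in at_right 0. sawtooth (t + \<epsilon> * v) - sawtooth (t - \<epsilon> * v) = L + 2 * \<epsilon> * v"
    unfolding eventually_at_right_field
  proof (intro exI[of _ "d / \<bar>v\<bar>"] conjI allI impI)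
    show "0 < d / \<bar>v\<bar>" using d v by simp
    fix \<epsilon> :: real assume e: "0 < \<epsilon>" "\<epsilon> < d / \<bar>v\<bar>"
    then have ev: "\<bar>\<epsilon> * v\<bar> < d" "\<epsilon> * v \<noteq> 0" using v by (auto simp: abs_mult field_simps)
    show "sawtooth (t + \<epsilon> * v) - sawtooth (t - \<epsilon> * v) = L + 2 * \<epsilon> * v"
    proof (cases "t \<in> \<int>")
      case True
      have "sawtooth (t + \<epsilon> * v) = \<epsilon> * v - sgn (\<epsilon> * v) / 2"
        using True ev by (intro sawtooth_int_shift) (auto simp: d_def)
      moreover have "sawtooth (t + - (\<epsilon> * v)) = - (\<epsilon> * v) - sgn (- (\<epsilon> * v)) / 2"
        using True ev by (intro sawtooth_int_shift) (auto simp: d_def)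
      ultimately show ?thesis using True e by (simp add: L_def sgn_mult)
    next
      case False
      have "sawtooth (t + \<epsilon> * v) - sawtooth t = t + \<epsilon> * v - t"
        using False ev by (intro sawtooth_diff) (auto simp: d_def)
      moreover have "sawtooth (t - \<epsilon> * v) - sawtooth t = t - \<epsilon> * v - t"
        using False ev by (intro sawtooth_diff) (auto simp: d_def)
      ultimately show ?thesis using False by (simp add: L_def)
    qed
  qed
  then show ?thesis unfolding L_def[symmetric] using lim by (simp add: filterlim_cong)
qed

text \<open>Dominated convergence for unordered sums: the M-test makes the finite partial sums
  converge uniformly in \<open>y\<close>, and the two limits can be exchanged.\<close>

lemma tendsto_infsum_dominated:
  fixes F :: "'b \<Rightarrow> 'a \<Rightarrow> 'c::banach"
  assumes "M summable_on A" and "\<And>y x. x \<in> A \<Longrightarrow> norm (F y x) \<le> M x"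
    and lim: "\<And>x. x \<in> A \<Longrightarrow> ((\<lambda>y. F y x) \<longlongrightarrow> L x) Fl" and "Fl \<noteq> bot"
  shows "((\<lambda>y. infsum (F y) A) \<longlongrightarrow> infsum L A) Fl"
proof (rule swap_uniform_limit'[where F="finite_subsets_at_top A" and S=UNIV])
  show "uniform_limit UNIV (\<lambda>X y. \<Sum>x\<in>X. F y x) (\<lambda>y. infsum (F y) A) (finite_subsets_at_top A)"
    by (rule Weierstrass_m_test_general[where M=M]) (use assms(1,2) in auto)
  show "\<forall>\<^sub>F X in finite_subsets_at_top A. ((\<lambda>y. \<Sum>x\<in>X. F y x) \<longlongrightarrow> (\<Sum>x\<in>X. L x)) Fl"
    by (rule eventually_finite_subsets_at_top_weakI) (use lim in \<open>auto intro!: tendsto_sum\<close>)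
  have "norm (L x) \<le> M x" if "x \<in> A" for x
    by (rule tendsto_upperbound[OF tendsto_norm[OF lim[OF that]]])
      (use assms(2)[OF that] assms(4) in \<open>simp_all add: always_eventually\<close>)
  then have "(\<lambda>x. norm (L x)) summable_on A"
    by (intro summable_on_comparison_test[OF assms(1)]) auto
  then have "L summable_on A" by (rule abs_summable_summable)
  then show "((\<lambda>X. \<Sum>x\<in>X. L x) \<longlongrightarrow> infsum L A) (finite_subsets_at_top A)"
    by (simp add: has_sum_def[symmetric])
qed auto

section \<open>Hyperplanes in lowest terms and the jumps across them\<close>

text \<open>Coprimality is required of \<open>p\<close> together with all entries of
  \<open>q\<close>; \<open>q\<close> itself need not be primitive, as 2x = 1 shows. Each rational
  hyperplane has exactly one such equation up to sign.\<close>

definition reduced :: "int^'d \<Rightarrow> int \<Rightarrow> bool" where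
  "reduced q p \<longleftrightarrow> q \<noteq> 0 \<and> (\<forall>k. k dvd p \<longrightarrow> (\<forall>i. k dvd q $ i) \<longrightarrow> is_unit k)"

lemma exists_reduced:
  fixes n :: "int^'d"
  assumes "n \<noteq> 0"
  obtains l q p' where "1 \<le> l" "n = int l *s q" "p = int l * p'" "reduced q p'"
proof -
  define g where "g = Gcd (insert p (range (($) n)))"
  have g: "g dvd p" "\<And>i. g dvd n $ i" unfolding g_def by (rule Gcd_dvd, simp)+
  obtain i where "n $ i \<noteq> 0" using assms by (auto simp: vec_eq_iff)
  then have "g \<noteq> 0" using g(2)[of i] by auto
  moreover have "0 \<le> g" unfolding g_def by simp
  ultimately have g0: "0 < g" by simp
  define q where "q = (\<chi> i. n $ i div g)"
  have q: "n $ i = g * q $ i" for i using g(2)[of i] by (simp add: q_def)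
  have p: "p = g * (p div g)" using g(1) by simp
  have "reduced q (p div g)" unfolding reduced_def
  proof (intro conjI allI impI)
    show "q \<noteq> 0" using q \<open>n $ i \<noteq> 0\<close> by (metis mult_zero_right zero_index)
    fix k assume k: "k dvd p div g" "\<forall>i. k dvd q $ i"
    have "g * k dvd g" unfolding g_def[symmetric]
      by (subst (2) g_def, rule Gcd_greatest) (use k p q in \<open>auto intro: mult_dvd_mono\<close>)
    then show "is_unit k" using g0 by simp
  qed
  then show thesis
    using that[of "nat g" q "p div g"] g0 p q by (auto simp: vec_eq_iff)
qed

text \<open>Write \<kappa> = u/v in lowest terms. Integrality of \<kappa> q and of \<kappa> p makes
  v divide every entry of \<open>q\<close> and \<open>p\<close>, so v is a unit. Hence the terms
  that jump at a generic point of a reduced hyperplane are those of the multiples of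
  \<open>q\<close>.\<close>

lemma reduced_parallel:
  fixes n q :: "int^'d"
  assumes r: "reduced q p" and par: "rvec n = \<kappa> *\<^sub>R rvec q" and int: "\<kappa> * of_int p \<in> \<int>"
  obtains l where "n = l *s q"
proof -
  obtain i where i: "q $ i \<noteq> 0" using r by (auto simp: reduced_def vec_eq_iff)
  have eq: "of_int (n $ j) = \<kappa> * of_int (q $ j)" for j
    using arg_cong[OF par, of "\<lambda>v. v $ j"] by simp
  have "\<kappa> = of_int (n $ i) / of_int (q $ i)" using eq[of i] i by simp
  then have "\<kappa> \<in> \<rat>" by simp
  then obtain u v where uv: "v > 0" "coprime u v" "\<kappa> = of_int u / of_int v" by (rule Rats_cases')
  obtain m where m: "\<kappa> * of_int p = of_int m" using int by (auto elim: Ints_cases)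
  have "v dvd q $ j" for j
  proof -
    have "real_of_int (v * n $ j) = of_int (u * q $ j)" using eq[of j] uv by (simp add: field_simps)
    then have "v * n $ j = u * q $ j" by (simp only: of_int_eq_iff)
    then have "v dvd u * q $ j" by (metis dvd_triv_left)
    then show ?thesis using uv(2) by (simp add: coprime_dvd_mult_right_iff coprime_commute)
  qed
  moreover have "v dvd p"
  proof -
    have "real_of_int (v * m) = of_int (u * p)" using m uv by (simp add: field_simps)
    then have "v * m = u * p" by (simp only: of_int_eq_iff)
    then have "v dvd u * p" by (metis dvd_triv_left)
    then show ?thesis using uv(2) by (simp add: coprime_dvd_mult_right_iff coprime_commute)
  qed
  ultimately have "is_unit v" using r by (auto simp: reduced_def)
  then have "v = 1" using uv by simp
  then have "real_of_int (n $ j) = of_int (u * q $ j)" for j using eq uv by simp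
  then have "n $ j = u * q $ j" for j by (simp only: of_int_eq_iff)
  then have "n = u *s q" by (simp add: vec_eq_iff)
  then show thesis by (rule that)
qed

text \<open>Move \<open>z\<close> by the projection of a vector u to the orthogonal complement of
  \<open>w\<close>. For \<open>n\<close> not parallel to \<open>w\<close> and an integer m, the
  equation n \<bullet> z' = m confines u to a hyperplane. These are countably many null sets, so
  some small u avoids them all.\<close>

lemma generic_point:
  fixes z :: "real^'d" and w :: "real^'d"
  assumes w: "w \<noteq> 0" and \<epsilon>: "0 < \<epsilon>"
  obtains z' where "dist z z' < \<epsilon>" "w \<bullet> z' = w \<bullet> z"
    "\<And>n::int^'d. rvec n \<bullet> z' \<in> \<int> \<Longrightarrow> \<exists>\<kappa>. rvec n = \<kappa> *\<^sub>R w"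
proof -
  define pr where "pr u = u - ((u \<bullet> w) / (w \<bullet> w)) *\<^sub>R w" for u
  have ww: "w \<bullet> w \<noteq> 0" using w by simp
  define S where "S = {n::int^'d. pr (rvec n) \<noteq> 0}"
  define H where "H = (\<lambda>(n, m::int). {u. pr (rvec n) \<bullet> u = of_int m - rvec n \<bullet> z})"
  have "negligible (\<Union>(H ` (S \<times> UNIV)))"
  proof (rule negligible_countable_Union)
    fix X assume "X \<in> H ` (S \<times> UNIV)"
    then show "negligible X" by (auto simp: S_def H_def intro: negligible_hyperplane)
  qed auto
  then have "\<not> ball 0 (\<epsilon>/2) \<subseteq> \<Union>(H ` (S \<times> UNIV))"
    using negligible_subset open_not_negligible[of "ball (0::real^'d) (\<epsilon>/2)"] \<epsilon> by auto
  then obtain u where "u \<in> ball 0 (\<epsilon>/2)" and u2: "u \<notin> \<Union>(H ` (S \<times> UNIV))" by blast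
  then have u1: "norm u < \<epsilon>/2" by simp
  have "norm (((u \<bullet> w) / (w \<bullet> w)) *\<^sub>R w) \<le> norm u"
  proof -
    have "\<bar>u \<bullet> w\<bar> * norm w \<le> norm u * norm w * norm w"
      by (intro mult_right_mono Cauchy_Schwarz_ineq2) auto
    also have "\<dots> = norm u * (w \<bullet> w)" by (simp add: power2_norm_eq_inner[symmetric] power2_eq_square)
    finally have "\<bar>u \<bullet> w\<bar> * norm w / (w \<bullet> w) \<le> norm u" using w by (simp add: divide_le_eq)
    then show ?thesis by simp
  qed
  then have npr: "norm (pr u) < \<epsilon>" using u1 norm_triangle_ineq4[of u "((u \<bullet> w) / (w \<bullet> w)) *\<^sub>R w"]
    unfolding pr_def by linarith
  have sym: "v \<bullet> pr u = pr v \<bullet> u" for v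
    by (simp add: pr_def inner_diff_left inner_diff_right inner_commute)
  show thesis
  proof (rule that[of "z + pr u"])
    show "dist z (z + pr u) < \<epsilon>" using npr by (simp add: dist_norm)
    show "w \<bullet> (z + pr u) = w \<bullet> z" using ww by (simp add: pr_def inner_add_right inner_diff_right inner_commute)
    fix n :: "int^'d" assume "rvec n \<bullet> (z + pr u) \<in> \<int>"
    then obtain m where "rvec n \<bullet> (z + pr u) = of_int m" by (auto elim: Ints_cases)
    then have "u \<in> H (n, m)" by (simp add: H_def inner_add_right sym)
    then have "n \<notin> S" using u2 by auto
    then show "\<exists>\<kappa>. rvec n = \<kappa> *\<^sub>R w" by (auto simp: S_def pr_def)
  qed
qed

lemma continuous_polynomial_deg_less:
  fixes P :: "real^'d \<Rightarrow> 'k::{real_normed_field,banach}"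
  assumes "polynomial_deg_less \<alpha> P"
  shows "continuous_on UNIV P"
proof -
  obtain K c where P: "\<And>x. P x = (\<Sum>k\<in>K. c k * of_real (\<Prod>i\<in>UNIV. (x $ i) ^ k i))"
    using assms by (auto simp: polynomial_deg_less_def)
  have "P = (\<lambda>x. \<Sum>k\<in>K. c k * of_real (\<Prod>i\<in>UNIV. (x $ i) ^ k i))" using P by (rule ext)
  then show ?thesis by (auto intro!: continuous_intros)
qed

context sparse_davenport
begin

lemma summable_bounded_factor:
  assumes "\<And>n. n \<in> A \<Longrightarrow> \<bar>b n\<bar> \<le> B"
  shows "(\<lambda>n. norm (a n * of_real (b n))) summable_on A"
proof (rule summable_on_comparison_test)
  have "(\<lambda>n. norm (a n)) summable_on A" using summable by (rule summable_on_subset_banach) auto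
  then show "(\<lambda>n. norm (a n) * B) summable_on A" by (rule summable_on_cmult_left)
qed (auto simp: norm_mult intro!: mult_left_mono assms)

lemma davenport_has_sum:
  "((\<lambda>n. a n * of_real (sawtooth (rvec n \<bullet> x))) has_sum davenport a x) (UNIV - {0})"
  unfolding davenport_def
  by (rule has_sum_infsum, rule abs_summable_summable, rule summable_bounded_factor[OF abs_sawtooth_le])

lemma davenport_diff:
  "davenport a x - davenport a y =
     infsum (\<lambda>n. a n * of_real (sawtooth (rvec n \<bullet> x) - sawtooth (rvec n \<bullet> y))) (UNIV - {0})"
proof -
  have "((\<lambda>n. a n * of_real (sawtooth (rvec n \<bullet> x)) + - (a n * of_real (sawtooth (rvec n \<bullet> y))))
      has_sum (davenport a x + - davenport a y)) (UNIV - {0})"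
    by (intro has_sum_add has_sum_uminusI davenport_has_sum)
  then show ?thesis by (intro infsumI[symmetric]) (simp add: algebra_simps)
qed

text \<open>Passing from l to -l changes the sign of the coefficient, by oddness, and the direction
  in which the hyperplane is crossed. Both halves of the line therefore contribute equally, which
  explains the factor 2 in \<open>Asum\<close>.\<close>

lemma infsum_lattice_line:
  assumes q: "q \<noteq> 0"
  shows "infsum (\<lambda>n. a n * of_real (- sgn (rvec n \<bullet> rvec q))) (range (\<lambda>l. l *s q)) = - Asum a q"
proof -
  obtain i where i: "q $ i \<noteq> 0" using q by (auto simp: vec_eq_iff)
  have inj: "inj (\<lambda>l::int. l *s q)"
  proof (rule injI)
    fix l m assume "l *s q = m *s q"
    then have "(l *s q) $ i = (m *s q) $ i" by simp
    then show "l = m" using i by simp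
  qed
  have q2: "0 < rvec q \<bullet> rvec q" using norm_rvec_ge_1[OF q] by auto
  have sg: "sgn (rvec (l *s q) \<bullet> rvec q) = of_int (sgn l)" for l :: int
  proof -
    have "rvec (l *s q) = real_of_int l *\<^sub>R rvec q" by (simp add: vec_eq_iff)
    then show ?thesis using q2 by (auto simp: sgn_if zero_less_mult_iff simp del: inner_gt_zero_iff)
  qed
  define F where "F l = a (l *s q) * of_real (- of_int (sgn l))" for l :: int
  have "(\<lambda>n. a n) summable_on range (\<lambda>l. l *s q)"
    by (rule abs_summable_summable, rule summable_on_subset_banach[OF summable]) simp
  then have s0: "(\<lambda>l. a (l *s q)) summable_on UNIV" using inj by (subst (asm) summable_on_reindex) (auto simp: o_def)
  then have s1: "(\<lambda>l. a (l *s q)) summable_on B" for B by (rule summable_on_subset_banach) auto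
  define s where "s = infsum (\<lambda>l. a (l *s q)) {0<..}"
  have neg: "{..<0::int} = uminus ` {0<..}" by (auto simp: image_iff intro: bexI[of _ "- x" for x])
  have "infsum (\<lambda>n. a n * of_real (- sgn (rvec n \<bullet> rvec q))) (range (\<lambda>l. l *s q)) = infsum F UNIV"
    using inj by (subst infsum_reindex) (auto simp: o_def sg F_def intro!: infsum_cong)
  also have "\<dots> = infsum F ({0<..} \<union> {..<0})"
    by (rule infsum_cong_neutral) (auto simp: F_def sgn_if)
  also have "\<dots> = infsum F {0<..} + infsum F {..<0}"
  proof (rule infsum_Un_disjoint)
    show "F summable_on {0<..}"
      using summable_on_uminus[THEN iffD2, OF s1[of "{0<..}"]] by (rule summable_on_cong[THEN iffD1, rotated]) (simp add: F_def)
    show "F summable_on {..<0}"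
      using s1[of "{..<0}"] by (rule summable_on_cong[THEN iffD1, rotated]) (simp add: F_def)
  qed auto
  also have "infsum F {0<..} = - s"
    unfolding s_def by (subst infsum_uminus[symmetric], rule infsum_cong) (simp add: F_def)
  also have "infsum F {..<0} = infsum (\<lambda>l. F (- l)) {0<..}"
    unfolding neg by (subst infsum_reindex) (auto simp: o_def)
  also have "\<dots> = - s"
    unfolding s_def
  proof (subst infsum_uminus[symmetric], rule infsum_cong)
    fix l :: int assume "l \<in> {0<..}"
    moreover have "(- l) *s q = - (l *s q)" by (simp add: vec_eq_iff)
    ultimately show "F (- l) = - a (l *s q)" by (simp add: F_def odd)
  qed
  also have "s = infsum (\<lambda>l::nat. a (int l *s q)) {1..}"
  proof -
    have "{0<..} = int ` {1..}"
    proof (intro equalityI subsetI)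
      fix x :: int assume "x \<in> {0<..}"
      then show "x \<in> int ` {1..}" by (intro image_eqI[of _ _ "nat x"]) auto
    qed auto
    then show ?thesis unfolding s_def by (simp add: infsum_reindex o_def)
  qed
  finally show ?thesis by (simp add: Asum_def)
qed

text \<open>Every symmetric difference of the sawtooth is bounded by 1, so the limit passes under
  the sum with majorant |a|. At a generic point of the hyperplane only the multiples of
  \<open>q\<close> survive in the limit.\<close>

lemma davenport_jump:
  assumes r: "reduced q p" and z: "rvec q \<bullet> z = of_int p"
    and gen: "\<And>n::int^'d. rvec n \<bullet> z \<in> \<int> \<Longrightarrow> \<exists>\<kappa>. rvec n = \<kappa> *\<^sub>R rvec q"
  shows "((\<lambda>\<epsilon>. davenport a (z + \<epsilon> *\<^sub>R rvec q) - davenport a (z - \<epsilon> *\<^sub>R rvec q)) \<longlongrightarrow> - Asum a q) (at_right 0)"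
proof -
  have q: "q \<noteq> 0" using r by (simp add: reduced_def)
  define L where "L n = (if rvec n \<bullet> z \<in> \<int> then - sgn (rvec n \<bullet> rvec q) else 0)" for n :: "int^'d"
  define d where "d \<epsilon> n = sawtooth (rvec n \<bullet> (z + \<epsilon> *\<^sub>R rvec q)) - sawtooth (rvec n \<bullet> (z - \<epsilon> *\<^sub>R rvec q))" for \<epsilon> and n :: "int^'d"
  have "((\<lambda>\<epsilon>. infsum (\<lambda>n. a n * of_real (d \<epsilon> n)) (UNIV - {0}))
      \<longlongrightarrow> infsum (\<lambda>n. a n * of_real (L n)) (UNIV - {0})) (at_right 0)"
  proof (rule tendsto_infsum_dominated[where M="\<lambda>n. norm (a n)"])
    show "(\<lambda>n. norm (a n)) summable_on UNIV - {0}" using summable by (rule summable_on_subset_banach) auto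
    fix \<epsilon> and n :: "int^'d"
    have "\<bar>d \<epsilon> n\<bar> \<le> 1"
      unfolding d_def using abs_sawtooth_le[of "rvec n \<bullet> (z + \<epsilon> *\<^sub>R rvec q)"]
        abs_sawtooth_le[of "rvec n \<bullet> (z - \<epsilon> *\<^sub>R rvec q)"] by linarith
    then show "norm (a n * of_real (d \<epsilon> n)) \<le> norm (a n)"
      by (simp add: norm_mult mult_left_le)
    show "((\<lambda>\<epsilon>. a n * of_real (d \<epsilon> n)) \<longlongrightarrow> a n * of_real (L n)) (at_right 0)"
      unfolding d_def inner_add_right inner_diff_right inner_scaleR_right L_def
      by (intro tendsto_mult tendsto_const tendsto_of_real sawtooth_jump)
  qed auto
  also have "infsum (\<lambda>n. a n * of_real (L n)) (UNIV - {0})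
      = infsum (\<lambda>n. a n * of_real (- sgn (rvec n \<bullet> rvec q))) (range (\<lambda>l. l *s q))"
  proof (rule infsum_cong_neutral)
    fix n assume n: "n \<in> UNIV - {0} - range (\<lambda>l. l *s q)"
    have "rvec n \<bullet> z \<notin> \<int>"
    proof
      assume I: "rvec n \<bullet> z \<in> \<int>"
      then obtain \<kappa> where l: "rvec n = \<kappa> *\<^sub>R rvec q" using gen by blast
      then have "\<kappa> * of_int p \<in> \<int>" using I z by simp
      then show False using reduced_parallel[OF r l] n by blast
    qed
    then show "a n * of_real (L n) = 0" by (simp add: L_def)
  next
    fix n assume "n \<in> (UNIV - {0}) \<inter> range (\<lambda>l. l *s q)"
    then obtain l where n: "n = l *s q" by blast
    have "rvec n = real_of_int l *\<^sub>R rvec q" by (simp add: vec_eq_iff n)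
    then have "rvec n \<bullet> z = of_int (l * p)" using z by simp
    then have "rvec n \<bullet> z \<in> \<int>" by (metis Ints_of_int)
    then show "a n * of_real (L n) = a n * of_real (- sgn (rvec n \<bullet> rvec q))" by (simp add: L_def)
  next
    fix n assume "n \<in> range (\<lambda>l. l *s q) - (UNIV - {0})"
    then have "n = 0" by simp
    then have "rvec n = 0" by (simp add: vec_eq_iff)
    then show "a n * of_real (- sgn (rvec n \<bullet> rvec q)) = 0" by simp
  qed
  also have "\<dots> = - Asum a q" by (rule infsum_lattice_line[OF q])
  finally show ?thesis by (simp only: davenport_diff d_def)
qed

text \<open>On the ball of radius r the series is within C r^\<alpha> of a continuous function, so a
  jump inside the ball is at most twice that. The jump is read off at a generic point; since
  \<open>z\<close> lies strictly inside the ball, it can be moved along its hyperplane to such a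
  point without leaving the ball.\<close>

lemma holder_at_jump_bound:
  assumes h: "holder_at (davenport a) \<alpha> x0" and \<alpha>: "0 < \<alpha>"
  obtains C R where "0 < C" "0 < R"
    "\<And>q p z r. reduced q p \<Longrightarrow> rvec q \<bullet> z = of_int p \<Longrightarrow> dist z x0 < r \<Longrightarrow> r < R \<Longrightarrow>
       norm (Asum a q) \<le> C * r powr \<alpha>"
proof -
  obtain C P where C: "0 < C" and P: "polynomial_deg_less \<alpha> P"
    and ev: "\<forall>\<^sub>F x in nhds x0. norm (davenport a x - P x) \<le> C * rpow (norm (x - x0)) \<alpha>"
    using h by (auto simp: holder_at_def)
  obtain R where R: "0 < R" "\<And>x. dist x x0 < R \<Longrightarrow> norm (davenport a x - P x) \<le> C * rpow (norm (x - x0)) \<alpha>"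
    using ev by (auto simp: eventually_nhds_metric)
  have "norm (Asum a q) \<le> (2 * C) * r powr \<alpha>"
    if q: "reduced q p" "rvec q \<bullet> z = of_int p" and r: "dist z x0 < r" "r < R" for q p z r
  proof -
    have "rvec q \<noteq> 0" using q(1) norm_rvec_ge_1[of q] by (auto simp: reduced_def)
    moreover have "0 < r - dist z x0" using r by simp
    ultimately obtain z' where z': "dist z z' < r - dist z x0" "rvec q \<bullet> z' = rvec q \<bullet> z"
        "\<And>n::int^'d. rvec n \<bullet> z' \<in> \<int> \<Longrightarrow> \<exists>\<kappa>. rvec n = \<kappa> *\<^sub>R rvec q"
      using generic_point[of "rvec q" "r - dist z x0" z] by blast
    have dz': "dist z' x0 < r" using z'(1) dist_triangle[of z' x0 z] by (simp add: dist_commute)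
    have J: "((\<lambda>\<epsilon>. davenport a (z' + \<epsilon> *\<^sub>R rvec q) - davenport a (z' - \<epsilon> *\<^sub>R rvec q)) \<longlongrightarrow> - Asum a q) (at_right 0)"
      by (rule davenport_jump[OF q(1)]) (use z' q in auto)
    have cP: "isCont P z'" using continuous_polynomial_deg_less[OF P] by (simp add: continuous_on_eq_continuous_at)
    have t1: "((\<lambda>\<epsilon>. z' + \<epsilon> *\<^sub>R rvec q) \<longlongrightarrow> z' + 0 *\<^sub>R rvec q) (at_right (0::real))" by (intro tendsto_intros)
    have t2: "((\<lambda>\<epsilon>. z' - \<epsilon> *\<^sub>R rvec q) \<longlongrightarrow> z' - 0 *\<^sub>R rvec q) (at_right (0::real))" by (intro tendsto_intros)
    have Pl: "((\<lambda>\<epsilon>. P (z' + \<epsilon> *\<^sub>R rvec q) - P (z' - \<epsilon> *\<^sub>R rvec q)) \<longlongrightarrow> P z' - P z') (at_right (0::real))"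
      using t1 t2 by (intro tendsto_diff isCont_tendsto_compose[OF cP]) auto
    have "((\<lambda>\<epsilon>. (2 * C) * r powr \<alpha> + norm (P (z' + \<epsilon> *\<^sub>R rvec q) - P (z' - \<epsilon> *\<^sub>R rvec q))) \<longlongrightarrow>
        (2 * C) * r powr \<alpha> + norm (P z' - P z')) (at_right (0::real))"
      by (intro tendsto_intros Pl)
    then have lim: "((\<lambda>\<epsilon>. (2 * C) * r powr \<alpha> + norm (P (z' + \<epsilon> *\<^sub>R rvec q) - P (z' - \<epsilon> *\<^sub>R rvec q))) \<longlongrightarrow>
        (2 * C) * r powr \<alpha>) (at_right (0::real))" by simp
    have near: "\<forall>\<^sub>F \<epsilon> in at_right (0::real). dist (z' + \<epsilon> *\<^sub>R rvec q) x0 < r"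
      "\<forall>\<^sub>F \<epsilon> in at_right (0::real). dist (z' - \<epsilon> *\<^sub>R rvec q) x0 < r"
      using order_tendstoD(2)[OF tendsto_dist[OF t1 tendsto_const[of x0]], of r]
        order_tendstoD(2)[OF tendsto_dist[OF t2 tendsto_const[of x0]], of r] dz' by auto
    have close: "norm (davenport a x - P x) \<le> C * r powr \<alpha>" if "dist x x0 < r" for x
    proof -
      have "norm (davenport a x - P x) \<le> C * rpow (norm (x - x0)) \<alpha>" using R(2) that r by auto
      also have "\<dots> \<le> C * rpow r \<alpha>" using C \<alpha> that by (intro mult_left_mono rpow_mono) (auto simp: dist_norm)
      finally show ?thesis using \<alpha> by (simp add: rpow_def)
    qed
    have "\<forall>\<^sub>F \<epsilon> in at_right (0::real). norm (davenport a (z' + \<epsilon> *\<^sub>R rvec q) - davenport a (z' - \<epsilon> *\<^sub>R rvec q))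
       \<le> (2 * C) * r powr \<alpha> + norm (P (z' + \<epsilon> *\<^sub>R rvec q) - P (z' - \<epsilon> *\<^sub>R rvec q))"
      using near
    proof eventually_elim
      case (elim \<epsilon>)
      define x y where "x = z' + \<epsilon> *\<^sub>R rvec q" and "y = z' - \<epsilon> *\<^sub>R rvec q"
      have "norm (davenport a x - davenport a y) = norm ((davenport a x - P x) - (davenport a y - P y) + (P x - P y))"
        by (rule arg_cong[where f=norm]) simp
      then have "norm (davenport a x - davenport a y) \<le> norm (davenport a x - P x) + norm (davenport a y - P y) + norm (P x - P y)"
        using norm_triangle_ineq[of "(davenport a x - P x) - (davenport a y - P y)" "P x - P y"]
          norm_triangle_ineq4[of "davenport a x - P x" "davenport a y - P y"] by linarith
      then show ?case using close[of x] close[of y] elim unfolding x_def y_def by linarith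
    qed
    then have "norm (- Asum a q) \<le> (2 * C) * r powr \<alpha>"
      by (intro tendsto_le[OF _ lim tendsto_norm[OF J]]) auto
    then show ?thesis by simp
  qed
  then show thesis using C R by (intro that[of "2 * C" R]) auto
qed

end


section \<open>Pointwise regularity away from the hyperplanes\<close>

lemma polynomial_deg_less_const: "0 < \<alpha> \<Longrightarrow> polynomial_deg_less \<alpha> (\<lambda>x. b)"
  unfolding polynomial_deg_less_def
  by (intro exI[of _ "{\<lambda>_. 0}"] exI[of _ "\<lambda>_. b"]) auto

lemma polynomial_deg_less_affine:
  fixes L :: "'d::finite \<Rightarrow> 'k::{real_normed_field,banach}"
  assumes "1 < \<alpha>"
  shows "polynomial_deg_less \<alpha> (\<lambda>x::real^'d. b + (\<Sum>i\<in>UNIV. L i * of_real (x $ i)))"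
proof -
  define e :: "'d \<Rightarrow> 'd \<Rightarrow> nat" where "e i j = (if j = i then 1 else 0)" for i j
  have inj: "inj e" by (rule injI) (metis e_def zero_neq_one)
  have e0: "e i \<noteq> (\<lambda>_. 0)" for i by (metis e_def zero_neq_one)
  have es: "(\<Sum>j\<in>UNIV. e i j) = 1" for i by (simp add: e_def)
  have ep: "(\<Prod>j\<in>UNIV. (x $ j) ^ e i j) = x $ i" for x :: "real^'d" and i
  proof -
    have "(\<Prod>j\<in>UNIV. (x $ j) ^ e i j) = (\<Prod>j\<in>UNIV. if i = j then x $ j else 1)"
      by (rule prod.cong) (auto simp: e_def)
    then show ?thesis by (simp add: prod.delta')
  qed
  define c where "c k = (if k = (\<lambda>_. 0) then b else L (inv e k))" for k
  show ?thesis unfolding polynomial_deg_less_def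
  proof (intro exI[of _ "insert (\<lambda>_. 0) (range e)"] exI[of _ c] conjI allI ballI)
    fix k assume "k \<in> insert (\<lambda>_. 0) (range e)"
    then show "real (\<Sum>i\<in>UNIV. k i) < \<alpha>" using assms es by (auto simp del: of_nat_sum)
  next
    fix x :: "real^'d"
    have "(\<Sum>k\<in>insert (\<lambda>_. 0) (range e). c k * of_real (\<Prod>i\<in>UNIV. (x $ i) ^ k i))
        = c (\<lambda>_. 0) * of_real (\<Prod>i\<in>UNIV. (x $ i) ^ 0) + (\<Sum>k\<in>range e. c k * of_real (\<Prod>i\<in>UNIV. (x $ i) ^ k i))"
      by (rule sum.insert) (use e0 in \<open>auto, metis\<close>)
    also have "(\<Sum>k\<in>range e. c k * of_real (\<Prod>i\<in>UNIV. (x $ i) ^ k i)) = (\<Sum>i\<in>UNIV. L i * of_real (x $ i))"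
      using inj by (subst sum.reindex) (simp_all add: ep c_def e0 del: of_real_prod)
    finally show "b + (\<Sum>i\<in>UNIV. L i * of_real (x $ i)) =
        (\<Sum>k\<in>insert (\<lambda>_. 0) (range e). c k * of_real (\<Prod>i\<in>UNIV. (x $ i) ^ k i))"
      by (simp add: c_def)
  qed auto
qed

lemma has_sum_finite_sum:
  fixes f :: "'i \<Rightarrow> 'a \<Rightarrow> 'b::topological_comm_monoid_add"
  assumes "finite I" "\<And>i. i \<in> I \<Longrightarrow> (f i has_sum s i) A"
  shows "((\<lambda>x. \<Sum>i\<in>I. f i x) has_sum (\<Sum>i\<in>I. s i)) A"
  using assms by (induction I rule: finite_induct) (auto intro: has_sum_add)

context sparse_davenport
begin

lemma davenport_has_sum_supp:
  "((\<lambda>n. a n * of_real (sawtooth (rvec n \<bullet> x))) has_sum davenport a x) (supp a)"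
  using davenport_has_sum[of x]
  by (subst has_sum_cong_neutral[where T="UNIV - {0}" and g="\<lambda>n. a n * of_real (sawtooth (rvec n \<bullet> x))"])
    (use zero_notin_supp in \<open>auto simp: supp_def\<close>)

text \<open>The sawtooth is affine between integers, so a polynomial of degree at most 1 suffices
  for every \<alpha>. With r = |x - x0|, a term either meets no integer between x0 and x, and its
  increment is exactly linear, or it satisfies c \<le> |n|^\<tau> r, and then a constant times
  (|n|^\<tau> r)^\<alpha> dominates it. Weighted by the coefficients these bounds have a finite sum
  because \<tau> \<alpha> < \<open>G\<close>.\<close>

lemma holder_at_davenport:
  assumes \<alpha>: "0 < \<alpha>" and \<tau>: "1 \<le> \<tau>" "\<tau> * \<alpha> < G" and c: "0 < c"
    and away: "\<And>n. n \<in> supp a \<Longrightarrow> c * rnorm n powr (1 - \<tau>) \<le> dist_int (rvec n \<bullet> x0)"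
  shows "holder_at (davenport a) \<alpha> x0"
proof -
  \<comment> \<open>The switch for the linear term: for \<alpha> \<le> 1 only constants are allowed
    and the sum of the gradients may diverge, while for \<alpha> > 1 it converges, since \<tau>
    \<ge> 1 forces \<open>G\<close> > 1.\<close>
  define s :: real where "s = (if \<alpha> \<le> 1 then 0 else 1)"
  have s: "\<alpha> \<le> 1 \<Longrightarrow> s = 0" "1 < \<alpha> \<Longrightarrow> s = 1" by (auto simp: s_def)
  obtain b where b: "\<And>y::real^'d. ((\<lambda>n. a n * of_real (s * (rvec n \<bullet> y))) has_sum (\<Sum>i\<in>UNIV. b i * of_real (y $ i))) (supp a)"
    and b0: "\<alpha> \<le> 1 \<Longrightarrow> b = (\<lambda>_. 0)"
  proof (cases "\<alpha> \<le> 1")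
    case True
    show thesis by (rule that[of "\<lambda>_. 0"]) (use True s in auto)
  next
    case False
    have "1 * \<alpha> \<le> \<tau> * \<alpha>" using \<tau> \<alpha> by (intro mult_right_mono) auto
    then have "1 < G" using False \<tau> by linarith
    then have S: "(\<lambda>n. norm (a n) * rnorm n powr 1) summable_on supp a" by (rule supp_summable_weighted)
    have summ: "(\<lambda>n. a n * of_real (rvec n $ i)) summable_on supp a" for i
    proof (rule abs_summable_summable, rule summable_on_comparison_test[OF S])
      fix n assume "n \<in> supp a"
      show "norm (a n * of_real (rvec n $ i)) \<le> norm (a n) * rnorm n powr 1"
        using component_le_norm_cart[of "rvec n" i] by (auto simp: norm_mult intro!: mult_left_mono)
    qed auto
    define L where "L i = infsum (\<lambda>n. a n * of_real (rvec n $ i)) (supp a)" for i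
    have hs: "((\<lambda>n. a n * of_real (rvec n $ i)) has_sum L i) (supp a)" for i
      unfolding L_def using summ by (rule has_sum_infsum)
    show thesis
    proof (rule that[of L])
      fix y :: "real^'d"
      have "((\<lambda>n. \<Sum>i\<in>UNIV. a n * of_real (rvec n $ i) * of_real (y $ i)) has_sum
          (\<Sum>i\<in>UNIV. L i * of_real (y $ i))) (supp a)"
        by (intro has_sum_finite_sum has_sum_cmult_left hs) auto
      moreover have "(\<Sum>i\<in>UNIV. a n * of_real (rvec n $ i) * of_real (y $ i)) = a n * of_real (s * (rvec n \<bullet> y))" for n
        using False s by (simp add: inner_vec_def sum_distrib_left mult.assoc)
      ultimately show "((\<lambda>n. a n * of_real (s * (rvec n \<bullet> y))) has_sum
          (\<Sum>i\<in>UNIV. L i * of_real (y $ i))) (supp a)" by simp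
    qed (use False in auto)
  qed
  define P where "P x = davenport a x0 + (\<Sum>i\<in>UNIV. b i * of_real ((x - x0) $ i))" for x :: "real^'d"
  have polyP: "polynomial_deg_less \<alpha> P"
  proof (cases "\<alpha> \<le> 1")
    case True
    then show ?thesis using polynomial_deg_less_const[OF \<alpha>] b0 by (simp add: P_def[abs_def])
  next
    case False
    have "P = (\<lambda>x. (davenport a x0 - (\<Sum>i\<in>UNIV. b i * of_real (x0 $ i))) + (\<Sum>i\<in>UNIV. b i * of_real (x $ i)))"
      by (rule ext) (simp add: P_def algebra_simps sum_subtractf)
    then show ?thesis using polynomial_deg_less_affine[of \<alpha>] False by simp
  qed
  \<comment> \<open>The summand 1 serves the terms that cross no integer when \<alpha> \<le> 1; the
    product serves those that may cross one.\<close>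
  define K where "K = (1 + c) * (1 / c) powr \<alpha> + 1"
  have K: "0 < K" using c by (simp add: K_def add_pos_pos)
  define T where "T = infsum (\<lambda>n. norm (a n) * rnorm n powr (\<tau> * \<alpha>)) (supp a)"
  have T: "((\<lambda>n. norm (a n) * rnorm n powr (\<tau> * \<alpha>)) has_sum T) (supp a)"
    unfolding T_def by (intro has_sum_infsum supp_summable_weighted \<tau>)
  have T0: "0 \<le> T" unfolding T_def by (rule infsum_nonneg) auto
  have bound: "norm (davenport a x - P x) \<le> (K * T + 1) * rpow (norm (x - x0)) \<alpha>" for x
  proof -
    define r where "r = norm (x - x0)"
    define d where "d n = sawtooth (rvec n \<bullet> x) - sawtooth (rvec n \<bullet> x0) - s * (rvec n \<bullet> (x - x0))" for n :: "int^'d"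
    have "((\<lambda>n. a n * of_real (sawtooth (rvec n \<bullet> x)) + - (a n * of_real (sawtooth (rvec n \<bullet> x0)))
        + - (a n * of_real (s * (rvec n \<bullet> (x - x0)))))
        has_sum (davenport a x + - davenport a x0 + - (\<Sum>i\<in>UNIV. b i * of_real ((x - x0) $ i)))) (supp a)"
      by (intro has_sum_add has_sum_uminusI davenport_has_sum_supp b)
    then have hs: "((\<lambda>n. a n * of_real (d n)) has_sum (davenport a x - P x)) (supp a)"
      by (simp add: d_def P_def algebra_simps)
    have dn: "\<bar>d n\<bar> \<le> K * (rnorm n powr (\<tau> * \<alpha>) * r powr \<alpha>)" if n: "n \<in> supp a" for n
    proof -
      define \<nu> where "\<nu> = rnorm n"
      have \<nu>: "1 \<le> \<nu>" using norm_supp_ge_1[OF n] by (simp add: \<nu>_def)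
      \<comment> \<open>The scale on which terms are compared: \<open>w\<close> dominates |n| r
        because \<tau> \<ge> 1, and \<open>w\<close> is at least \<open>c\<close> whenever an
        integer may be crossed.\<close>
      define w where "w = \<nu> powr \<tau> * r"
      have r0: "0 \<le> r" by (simp add: r_def)
      have wr: "\<nu> * r \<le> w"
      proof -
        have "\<nu> powr 1 \<le> \<nu> powr \<tau>" using \<nu> \<tau> by (intro powr_mono) auto
        then show ?thesis using \<nu> r0 by (simp add: w_def mult_right_mono)
      qed
      have w0: "0 \<le> w" using r0 by (simp add: w_def)
      have wa: "w powr \<alpha> = \<nu> powr (\<tau> * \<alpha>) * r powr \<alpha>"
        using r0 by (simp add: w_def powr_mult powr_powr)
      have diff: "\<bar>rvec n \<bullet> x - rvec n \<bullet> x0\<bar> \<le> \<nu> * r"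
        unfolding inner_diff_right[symmetric] \<nu>_def r_def by (rule Cauchy_Schwarz_ineq2)
      have "\<bar>d n\<bar> \<le> K * w powr \<alpha>"
      proof (cases "\<bar>rvec n \<bullet> x - rvec n \<bullet> x0\<bar> < dist_int (rvec n \<bullet> x0)")
        case True
        then have dd: "d n = (1 - s) * (rvec n \<bullet> x - rvec n \<bullet> x0)"
          using sawtooth_diff[OF True] by (simp add: d_def inner_diff_right algebra_simps)
        show ?thesis
        proof (cases "\<alpha> \<le> 1")
          case a1: True
          define y where "y = \<bar>rvec n \<bullet> x - rvec n \<bullet> x0\<bar>"
          have y: "0 \<le> y" "y \<le> 1" "y \<le> w"
            using True dist_int_le_half[of "rvec n \<bullet> x0"] diff wr by (auto simp: y_def)
          have "\<bar>d n\<bar> = y" using dd s(1)[OF a1] by (simp add: y_def)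
          also have "y \<le> y powr \<alpha>"
            using y a1 \<alpha> powr_mono'[of \<alpha> 1 y] by (cases "y = 0") auto
          also have "\<dots> \<le> w powr \<alpha>" using y \<alpha> by (intro powr_mono2) auto
          also have "\<dots> \<le> K * w powr \<alpha>" using c by (simp add: K_def algebra_simps)
          finally show ?thesis .
        next
          case False
          then have "d n = 0" using dd s by simp
          then show ?thesis using K by simp
        qed
      next
        case False
        have "c * \<nu> powr (1 - \<tau>) \<le> \<nu> * r"
          using away[OF n] False diff by (simp add: \<nu>_def)
        then have "c * \<nu> powr (1 - \<tau>) * \<nu> powr (\<tau> - 1) \<le> \<nu> * r * \<nu> powr (\<tau> - 1)"
          by (intro mult_right_mono) auto
        moreover have "c * \<nu> powr (1 - \<tau>) * \<nu> powr (\<tau> - 1) = c"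
          using \<nu> by (simp add: mult.assoc powr_add[symmetric])
        moreover have "\<nu> * r * \<nu> powr (\<tau> - 1) = w" using \<nu> by (simp add: w_def powr_diff)
        ultimately have cw: "c \<le> w" by simp
        define v where "v = w / c"
        have v1: "1 \<le> v" using cw c by (simp add: v_def)
        have va: "v powr \<alpha> = (1 / c) powr \<alpha> * w powr \<alpha>"
          using c w0 by (simp add: v_def powr_divide)
        have sd: "\<bar>sawtooth (rvec n \<bullet> x) - sawtooth (rvec n \<bullet> x0)\<bar> \<le> 1"
          using abs_sawtooth_le[of "rvec n \<bullet> x"] abs_sawtooth_le[of "rvec n \<bullet> x0"] by linarith
        have "\<bar>d n\<bar> \<le> (1 + c) * v powr \<alpha>"
        proof (cases "\<alpha> \<le> 1")
          case True
          have "1 \<le> v powr \<alpha>" using v1 \<alpha> by (intro ge_one_powr_ge_zero) auto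
          then have "1 * 1 \<le> (1 + c) * v powr \<alpha>" using c by (intro mult_mono) auto
          then show ?thesis using sd s(1)[OF True] by (simp add: d_def)
        next
          case a1: False
          have "\<bar>d n\<bar> \<le> 1 + \<nu> * r" using sd s(2) a1 diff by (simp add: d_def inner_diff_right)
          also have "\<dots> \<le> v + c * v"
          proof -
            have "c * v = w" using c by (simp add: v_def)
            then show ?thesis using v1 wr by linarith
          qed
          also have "\<dots> = (1 + c) * v powr 1" using v1 by (simp add: algebra_simps)
          also have "\<dots> \<le> (1 + c) * v powr \<alpha>" using v1 a1 c by (intro mult_left_mono powr_mono) auto
          finally show ?thesis .
        qed
        also have "\<dots> \<le> K * w powr \<alpha>" unfolding va by (simp add: K_def algebra_simps)
        finally show ?thesis .
      qed
      then show ?thesis using wa by (simp add: \<nu>_def)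
    qed
    have "norm (davenport a x - P x) \<le> K * r powr \<alpha> * T"
    proof (rule norm_infsum_le[OF hs has_sum_cmult_right[OF T]])
      fix n assume n: "n \<in> supp a"
      have "norm (a n * of_real (d n)) \<le> norm (a n) * (K * (rnorm n powr (\<tau> * \<alpha>) * r powr \<alpha>))"
        using dn[OF n] by (simp add: norm_mult mult_left_mono)
      then show "norm (a n * of_real (d n)) \<le> K * r powr \<alpha> * (norm (a n) * rnorm n powr (\<tau> * \<alpha>))"
        by (simp add: mult_ac)
    qed
    also have "\<dots> \<le> (K * T + 1) * r powr \<alpha>" by (simp add: algebra_simps)
    finally show ?thesis using \<alpha> by (simp add: r_def rpow_def)
  qed
  show ?thesis unfolding holder_at_def
    by (intro exI[of _ "K * T + 1"] exI[of _ P] conjI polyP always_eventually allI bound)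
      (use K T0 in \<open>simp add: add_nonneg_pos\<close>)
qed

end


section \<open>A Cantor set of well-approximated points\<close>

text \<open>The condition at \<open>k\<close> says that \<open>N k * g t + off k\<close> is within
  \<open>N k powr (1 - \<tau>)\<close> of an integer; \<open>off\<close> will carry the contribution
  of the other coordinates of a slice. The last condition is a Hoelder bound for the inverse of
  \<open>g\<close>: the image of Lebesgue measure under \<open>g\<close> gives a set of diameter r
  mass O(r^\<sigma>).\<close>

definition cantor_param ::
    "real \<Rightarrow> real \<Rightarrow> real \<Rightarrow> (nat \<Rightarrow> real) \<Rightarrow> (nat \<Rightarrow> real) \<Rightarrow> (real \<Rightarrow> real) \<Rightarrow> (real \<Rightarrow> real) \<Rightarrow> bool" where
  "cantor_param \<tau> u v N off C g \<longleftrightarrow>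
     (\<forall>t\<in>{0..<1}. g t \<in> {u..v} \<and>
        (\<forall>k. \<exists>p::int. \<bar>g t - (of_int p - off k) / N k\<bar> \<le> N k powr - \<tau>)) \<and>
      (\<forall>\<sigma>. 0 < \<sigma> \<longrightarrow> \<sigma> < 1 / \<tau> \<longrightarrow> (\<forall>t\<in>{0..<1}. \<forall>t'\<in>{0..<1}.
        \<bar>t - t'\<bar> \<le> C \<sigma> * \<bar>g t - g t'\<bar> powr \<sigma>))"

text \<open>The point \<open>g t\<close> is the intersection of nested intervals: level \<open>k + 1\<close> intervals have length
  \<open>N\<^sub>k\<^sup>-\<^sup>\<tau>\<close> and start at every second point of the shifted grid of mesh \<open>1 / N\<^sub>k\<close>, and the digits of
  \<open>t\<close> in mixed radix select the interval. The inverse of \<open>g\<close> is Hoelder of every order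
  \<open>\<sigma> < 1/\<tau>\<close> because \<open>N\<close> grows fast.\<close>

lemma cantor_map:
  fixes \<tau> u v :: real and A :: "nat \<Rightarrow> nat"
  assumes \<tau>: "1 \<le> \<tau>" and uv: "u < v" and unb: "\<And>B::real. \<exists>j. B \<le> real (A j)"
  obtains r :: "nat \<Rightarrow> nat" and C :: "real \<Rightarrow> real" where
    "\<And>k. real k + 1 \<le> real (A (r k))" "\<And>\<sigma>. 0 < C \<sigma>"
    "\<And>off :: nat \<Rightarrow> real. \<exists>g. cantor_param \<tau> u v (\<lambda>k. A (r k)) off C g"
proof -
  \<comment> \<open>An interval of length \<open>l\<close> has room for at least two children by the
    first condition. The second makes \<open>A j\<close> outgrow every fixed power of
    1/\<open>l\<close> as \<open>k\<close> increases, which yields every exponent below 1/\<tau>.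
    The third forces the chosen scales to infinity.\<close>
  define large where "large k l j \<longleftrightarrow> 8 \<le> l * real (A j) \<and> (4 / l) ^ Suc k \<le> real (A j) \<and> real k + 1 \<le> real (A j)"
    for k :: nat and l :: real and j
  have ex_large: "\<exists>j. large k l j" if l: "0 < l" for k l
  proof -
    obtain j where j: "max (8 / l) (max ((4 / l) ^ Suc k) (real k + 1)) \<le> real (A j)" using unb by blast
    then have "8 / l \<le> real (A j)" by simp
    then have "8 \<le> l * real (A j)" using l by (simp add: field_simps)
    then show ?thesis using j unfolding large_def by auto
  qed
  have "\<exists>r. \<forall>k. (0 < A (r k) \<and> (k = 0 \<longrightarrow> large 0 (v - u) (r k))) \<and>
      large (Suc k) (real (A (r k)) powr - \<tau>) (r (Suc k))"
  proof (rule dependent_nat_choice)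
    obtain j where j: "large 0 (v - u) j" using ex_large[of "v - u" 0] uv by auto
    then have "0 < A j" by (auto simp: large_def)
    then show "\<exists>x. 0 < A x \<and> (0 = 0 \<longrightarrow> large 0 (v - u) x)" using j by blast
    fix x k :: nat assume "0 < A x \<and> (k = 0 \<longrightarrow> large 0 (v - u) x)"
    then have "0 < real (A x) powr - \<tau>" by simp
    then obtain j where j: "large (Suc k) (real (A x) powr - \<tau>) j" using ex_large by blast
    then have "0 < A j" by (auto simp: large_def)
    then show "\<exists>y. (0 < A y \<and> (Suc k = 0 \<longrightarrow> large 0 (v - u) y)) \<and> large (Suc k) (real (A x) powr - \<tau>) y"
      using j by blast
  qed
  then obtain r where r: "\<And>k. 0 < A (r k)" "large 0 (v - u) (r 0)"
      "\<And>k. large (Suc k) (real (A (r k)) powr - \<tau>) (r (Suc k))" by blast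
  define N where "N k = real (A (r k))" for k
  define l where "l k = (case k of 0 \<Rightarrow> v - u | Suc j \<Rightarrow> N j powr - \<tau>)" for k
  have l0: "l 0 = v - u" and lS: "l (Suc k) = N k powr - \<tau>" for k by (simp_all add: l_def)
  have N: "8 \<le> l k * N k" "(4 / l k) ^ Suc k \<le> N k" "real k + 1 \<le> N k" for k
    using r(2) r(3)[of "k - 1"] unfolding l_def N_def large_def by (cases k; simp)+
  have N1: "1 \<le> N k" for k using N(3)[of k] by linarith
  have lpos: "0 < l k" for k using uv r(1) by (cases k) (auto simp: l0 lS N_def)
  have lN: "l (Suc k) \<le> 1 / N k" for k
  proof -
    have "N k powr - \<tau> \<le> N k powr - 1" using N1[of k] \<tau> by (intro powr_mono) auto
    then show ?thesis using N1[of k] by (simp add: lS powr_minus_divide)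
  qed
  \<comment> \<open>The number of children of a level \<open>k\<close> interval: one mesh is lost by
    rounding up to the grid, the starts are two meshes apart, and the last child is at most one mesh
    long. Taking every second grid point leaves a gap of at least one mesh between siblings.\<close>
  define M where "M k = nat \<lfloor>(l k * N k - 1) / 2\<rfloor>" for k
  have M: "2 * real (M k) + 1 \<le> l k * N k" "l k * N k / 4 \<le> real (M k)" "2 \<le> real (M k)" for k
  proof -
    define x where "x = l k * N k"
    define f where "f = real_of_int \<lfloor>(x - 1) / 2\<rfloor>"
    have x: "8 \<le> x" using N(1)[of k] by (simp add: x_def)
    then have "0 \<le> \<lfloor>(x - 1) / 2\<rfloor>" by simp
    then have Mf: "real (M k) = f" by (simp add: M_def x_def f_def)
    have f: "f \<le> (x - 1) / 2" "(x - 1) / 2 - 1 \<le> f" unfolding f_def by linarith+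
    have "2 * f + 1 \<le> x" "x / 4 \<le> f" "2 \<le> f" using x f by (simp_all add: field_simps)
    then show "2 * real (M k) + 1 \<le> l k * N k" "l k * N k / 4 \<le> real (M k)" "2 \<le> real (M k)"
      unfolding Mf x_def by auto
  qed
  define Pi where "Pi k = (\<Prod>j<k. real (M j))" for k
  have Pi0: "Pi 0 = 1" and PiS: "Pi (Suc k) = Pi k * real (M k)" for k by (simp_all add: Pi_def)
  have Pi2: "2 ^ k \<le> Pi k" for k
  proof (induction k)
    case (Suc k)
    have "2 ^ k * 2 \<le> Pi k * real (M k)" using Suc M(3)[of k]
      by (intro mult_mono) (auto simp: Pi_def intro: prod_nonneg)
    then show ?case by (simp add: PiS mult.commute)
  qed (simp add: Pi0)
  have Pi1: "1 \<le> Pi k" for k using Pi2[of k] one_le_power[of "2::real" k] by linarith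
  \<comment> \<open>The number \<open>Pi k\<close> of level \<open>k\<close> intervals dominates
    their length to the power -\<sigma>. With e = 1 - \<tau> \<sigma> and j large, 4 /
    \<open>l j\<close> \<le> \<open>N j powr e\<close>, so already the last factor
    \<open>M j\<close> \<ge> \<open>l j * N j / 4\<close> is at least
    \<open>N j powr (\<tau> * \<sigma>)\<close>, which is \<open>l (Suc j) powr - \<sigma>\<close>.
    The finitely many early levels go into \<open>C\<close>.\<close>
  have "\<exists>C>0. (0 < \<sigma> \<longrightarrow> \<sigma> < 1 / \<tau> \<longrightarrow> (\<forall>k. l k powr - \<sigma> \<le> C * Pi k))" for \<sigma>
  proof (cases "0 < \<sigma> \<and> \<sigma> < 1 / \<tau>")
    case True
    define e where "e = 1 - \<tau> * \<sigma>"
    have e: "0 < e" using True \<tau> by (simp add: e_def field_simps)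
    obtain K :: nat where K: "1 / e \<le> real K" using real_arch_simple by blast
    have big: "l (Suc j) powr - \<sigma> \<le> Pi (Suc j)" if "K \<le> j" for j
    proof -
      have "1 / e \<le> real (Suc j)" using K that by simp
      then have e': "1 / real (Suc j) \<le> e" using e by (simp add: field_simps)
      have lj: "0 < 4 / l j" using lpos[of j] by simp
      have "4 / l j = ((4 / l j) ^ Suc j) powr (1 / real (Suc j))"
        using lj by (subst powr_realpow[symmetric]) (auto simp: powr_powr)
      also have "\<dots> \<le> N j powr (1 / real (Suc j))"
        using N(2)[of j] lj by (intro powr_mono2) auto
      also have "\<dots> \<le> N j powr e" using e' N1[of j] by (intro powr_mono) auto
      finally have "4 / l j \<le> N j powr e" .
      moreover have "N j powr e * N j powr (\<tau> * \<sigma>) = N j"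
        using N1[of j] by (simp add: powr_add[symmetric] e_def)
      ultimately have "4 / l j * N j powr (\<tau> * \<sigma>) \<le> N j"
        by (metis mult_right_mono powr_ge_zero)
      then have "N j powr (\<tau> * \<sigma>) \<le> l j * N j / 4" using lpos[of j] by (simp add: field_simps)
      also have "\<dots> \<le> 1 * real (M j)" using M(2)[of j] by simp
      also have "\<dots> \<le> Pi (Suc j)" unfolding PiS using Pi1[of j] by (intro mult_right_mono) auto
      finally show ?thesis using N1[of j] by (simp add: lS powr_powr)
    qed
    define C where "C = 1 + (\<Sum>k\<le>K. l k powr - \<sigma>)"
    have C1: "1 \<le> C" by (simp add: C_def sum_nonneg)
    have "l k powr - \<sigma> \<le> C * Pi k" for k
    proof (cases "k \<le> K")
      case True
      then have "l k powr - \<sigma> \<le> (\<Sum>k\<le>K. l k powr - \<sigma>)" by (intro member_le_sum) auto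
      also have "\<dots> \<le> C * 1" by (simp add: C_def)
      also have "\<dots> \<le> C * Pi k" using C1 Pi1[of k] by (intro mult_left_mono) auto
      finally show ?thesis .
    next
      case False
      then obtain j where j: "k = Suc j" "K \<le> j" by (cases k) auto
      have "l k powr - \<sigma> \<le> 1 * Pi k" using big[OF j(2)] j by simp
      also have "\<dots> \<le> C * Pi k" using C1 Pi1[of k] by (intro mult_right_mono) auto
      finally show ?thesis .
    qed
    then show ?thesis using C1 by (intro exI[of _ C]) auto
  qed (auto intro: exI[of _ 1])
  then obtain C where C: "\<And>\<sigma>. 0 < C \<sigma>" "\<And>\<sigma> k. 0 < \<sigma> \<Longrightarrow> \<sigma> < 1 / \<tau> \<Longrightarrow> l k powr - \<sigma> \<le> C \<sigma> * Pi k"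
    by metis
  have main: "\<exists>g. cantor_param \<tau> u v N off (\<lambda>\<sigma>. 8 * C \<sigma>) g" for off :: "nat \<Rightarrow> real"
  proof -
    \<comment> \<open>\<open>fl k t\<close> is the index of the level \<open>k\<close> cell of the
      parameter interval containing \<open>t\<close>, and \<open>D k t\<close> is the mixed-radix
      digit that selects the next child.\<close>
    define fl where "fl k t = \<lfloor>t * Pi k\<rfloor>" for k and t :: real
    define D where "D k t = fl (Suc k) t - int (M k) * fl k t" for k and t :: real
    have D: "0 \<le> D k t" "D k t \<le> int (M k) - 1" for k t
    proof -
      define y where "y = t * Pi k"
      have y: "fl k t = \<lfloor>y\<rfloor>" "fl (Suc k) t = \<lfloor>y * real (M k)\<rfloor>"
        by (simp_all add: fl_def y_def PiS mult.assoc)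
      have "real_of_int (int (M k) * \<lfloor>y\<rfloor>) \<le> y * real (M k)"
        using mult_right_mono[of "real_of_int \<lfloor>y\<rfloor>" y "real (M k)"] by (simp add: mult.commute)
      then show "0 \<le> D k t" unfolding D_def y by (simp add: le_floor_iff)
      have "y * real (M k) < (of_int \<lfloor>y\<rfloor> + 1) * real (M k)"
        using M(3)[of k] by (intro mult_strict_right_mono) linarith+
      also have "\<dots> = real_of_int (int (M k) * \<lfloor>y\<rfloor> + int (M k))" by (simp add: algebra_simps)
      finally have "\<lfloor>y * real (M k)\<rfloor> < int (M k) * \<lfloor>y\<rfloor> + int (M k)" by (simp only: floor_less_iff)
      then show "D k t \<le> int (M k) - 1" unfolding D_def y by simp
    qed
    \<comment> \<open>The first point of the shifted grid at or to the right of
      \<open>p\<close>.\<close>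
    define gr where "gr k p = (of_int \<lceil>N k * p + off k\<rceil> - off k) / N k" for k p
    have gr: "p \<le> gr k p" "gr k p \<le> p + 1 / N k" for k p
    proof -
      have "N k * p \<le> of_int \<lceil>N k * p + off k\<rceil> - off k" "of_int \<lceil>N k * p + off k\<rceil> - off k \<le> N k * p + 1"
        by linarith+
      moreover have "(N k * p + 1) / N k = p + 1 / N k" using N1[of k] by (simp add: field_simps)
      ultimately show "p \<le> gr k p" "gr k p \<le> p + 1 / N k"
        using N1[of k] divide_right_mono[of "of_int \<lceil>N k * p + off k\<rceil> - off k" "N k * p + 1" "N k"]
        by (auto simp: gr_def pos_le_divide_eq mult.commute)
    qed
    define pos where "pos t = rec_nat u (\<lambda>k p. gr k p + 2 * of_int (D k t) / N k)" for t
    have pos0: "pos t 0 = u" and posS: "pos t (Suc k) = gr k (pos t k) + 2 * of_int (D k t) / N k" for t k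
      by (simp_all add: pos_def)
    have up: "pos t k \<le> pos t (Suc k)" for t k
    proof -
      have "0 \<le> 2 * of_int (D k t) / N k" using D(1)[of k t] N1[of k] by simp
      then show ?thesis using gr(1)[of "pos t k" k] by (simp add: posS)
    qed
    have down: "pos t (Suc k) + l (Suc k) \<le> pos t k + l k" for t k
    proof -
      have "2 * real_of_int (D k t) \<le> 2 * (real (M k) - 1)" using D(2)[of k t] by simp
      then have "2 * of_int (D k t) / N k \<le> 2 * (real (M k) - 1) / N k"
        using N1[of k] by (intro divide_right_mono) auto
      then have "pos t (Suc k) + l (Suc k) \<le> pos t k + 1 / N k + 2 * (real (M k) - 1) / N k + 1 / N k"
        using gr(2)[of k "pos t k"] lN[of k] by (simp add: posS)
      also have "\<dots> = pos t k + 2 * real (M k) / N k" using N1[of k] by (simp add: field_simps)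
      also have "\<dots> \<le> pos t k + l k" using M(1)[of k] N1[of k] by (simp add: field_simps)
      finally show ?thesis .
    qed
    have posle: "pos t j \<le> pos t k + l k" for t j k
    proof -
      have "pos t j \<le> pos t (max j k)" by (rule lift_Suc_mono_le[of "pos t"]) (use up in auto)
      also have "\<dots> \<le> pos t (max j k) + l (max j k)" using lpos[of "max j k"] by simp
      also have "\<dots> \<le> pos t k + l k"
        by (rule lift_Suc_antimono_le[of "\<lambda>k. pos t k + l k"]) (use down in auto)
      finally show ?thesis .
    qed
    define g where "g t = (SUP k. pos t k)" for t
    have g1: "pos t k \<le> g t" for t k
      unfolding g_def by (rule cSUP_upper) (use posle[of t _ 0] in \<open>auto intro!: bdd_aboveI2\<close>)
    have g2: "g t \<le> pos t k + l k" for t k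
      unfolding g_def by (rule cSUP_least) (use posle in auto)
    have range: "g t \<in> {u..v}" for t using g1[of t 0] g2[of t 0] by (simp add: pos0 l0)
    have grid: "\<exists>p::int. \<bar>g t - (of_int p - off k) / N k\<bar> \<le> N k powr - \<tau>" for t k
    proof -
      have "pos t (Suc k) = (of_int (\<lceil>N k * pos t k + off k\<rceil> + 2 * D k t) - off k) / N k"
        by (simp add: posS gr_def add_divide_distrib diff_divide_distrib)
      moreover have "\<bar>g t - pos t (Suc k)\<bar> \<le> N k powr - \<tau>"
        using g1[of t "Suc k"] g2[of t "Suc k"] by (simp add: lS)
      ultimately show ?thesis by metis
    qed
    have holder: "\<bar>t - t'\<bar> \<le> 8 * C \<sigma> * \<bar>g t - g t'\<bar> powr \<sigma>"
      if \<sigma>: "0 < \<sigma>" "\<sigma> < 1 / \<tau>" and om: "t \<in> {0..<1}" "t' \<in> {0..<1}" for \<sigma> t t'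
    proof (cases "t = t'")
      case False
      have "\<exists>k. fl k t \<noteq> fl k t'"
      proof -
        obtain k where "1 / \<bar>t - t'\<bar> < 2 ^ k" using real_arch_pow[of 2 "1 / \<bar>t - t'\<bar>"] by auto
        then have "1 / \<bar>t - t'\<bar> < Pi k" using Pi2[of k] by linarith
        then have "1 < \<bar>t - t'\<bar> * Pi k" using False by (simp add: field_simps)
        then have "1 < \<bar>t * Pi k - t' * Pi k\<bar>"
          using Pi1[of k] by (simp add: left_diff_distrib[symmetric] abs_mult)
        then have "fl k t \<noteq> fl k t'" unfolding fl_def by linarith
        then show ?thesis ..
      qed
      then have dif: "fl (LEAST k. fl k t \<noteq> fl k t') t \<noteq> fl (LEAST k. fl k t \<noteq> fl k t') t'" by (rule LeastI_ex)
      moreover have "fl 0 t = 0" "fl 0 t' = 0" using om by (simp_all add: fl_def Pi0 floor_eq_iff)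
      ultimately obtain j where j: "(LEAST k. fl k t \<noteq> fl k t') = Suc j"
        by (cases "LEAST k. fl k t \<noteq> fl k t'") auto
      have eq: "fl i t = fl i t'" if "i \<le> j" for i
        using not_less_Least[of i "\<lambda>k. fl k t \<noteq> fl k t'"] that j by auto
      have poseq: "pos t i = pos t' i" if "i \<le> j" for i
        using that by (induction i) (simp_all add: pos0 posS D_def eq)
      \<comment> \<open>At the first level where the parameters separate, their intervals are
        children of one parent whose digits differ by \<Delta>. The parameters are then at most 2
        \<Delta> / \<open>Pi (Suc j)\<close> apart, and the points at least \<Delta> /
        \<open>N j\<close>.\<close>
      define \<Delta> where "\<Delta> = \<bar>real_of_int (fl (Suc j) t - fl (Suc j) t')\<bar>"
      have "fl (Suc j) t \<noteq> fl (Suc j) t'" using dif j by simp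
      then have \<Delta>1: "1 \<le> \<Delta>" unfolding \<Delta>_def by linarith
      have Dd: "\<bar>real_of_int (D j t) - of_int (D j t')\<bar> = \<Delta>"
        unfolding \<Delta>_def D_def using eq[of j] by simp
      have \<Delta>M: "\<Delta> \<le> real (M j)"
      proof -
        have "0 \<le> real_of_int (D j t)" "0 \<le> real_of_int (D j t')" using D(1) by auto
        moreover have "real_of_int (D j t) \<le> real (M j) - 1" "real_of_int (D j t') \<le> real (M j) - 1"
          using D(2)[of j t] D(2)[of j t'] by auto
        ultimately show ?thesis using Dd by linarith
      qed
      have "pos t (Suc j) - pos t' (Suc j) = 2 * (of_int (D j t) - of_int (D j t')) / N j"
        by (simp add: posS poseq diff_divide_distrib algebra_simps)
      then have "\<bar>pos t (Suc j) - pos t' (Suc j)\<bar> = 2 * \<Delta> / N j"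
        using N1[of j] Dd by (simp add: abs_mult)
      then have "2 * \<Delta> / N j - l (Suc j) \<le> \<bar>g t - g t'\<bar>"
        using g1[of t "Suc j"] g2[of t "Suc j"] g1[of t' "Suc j"] g2[of t' "Suc j"] by linarith
      moreover have "l (Suc j) \<le> \<Delta> / N j" using lN[of j] \<Delta>1 N1[of j]
        by (meson divide_right_mono order_trans zero_le_one)
      ultimately have gap: "\<Delta> / N j \<le> \<bar>g t - g t'\<bar>" by simp
      define y where "y = \<Delta> / N j"
      have y0: "0 < y" using \<Delta>1 N1[of j] by (simp add: y_def)
      have yl: "y \<le> l j"
      proof -
        have "\<Delta> \<le> l j * N j" using \<Delta>M M(1)[of j] \<Delta>1 by linarith
        then show ?thesis using N1[of j] by (simp add: y_def field_simps)
      qed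
      have "\<bar>t * Pi (Suc j) - t' * Pi (Suc j)\<bar> \<le> \<Delta> + 1"
        unfolding \<Delta>_def fl_def by linarith
      then have "\<bar>t - t'\<bar> * Pi (Suc j) \<le> 2 * \<Delta>"
        using Pi1[of "Suc j"] \<Delta>1 by (simp add: left_diff_distrib[symmetric] abs_mult)
      then have "\<bar>t - t'\<bar> * (Pi j * (l j * N j / 4)) \<le> 2 * \<Delta>"
      proof (rule order_trans[rotated])
        show "\<bar>t - t'\<bar> * (Pi j * (l j * N j / 4)) \<le> \<bar>t - t'\<bar> * Pi (Suc j)"
          unfolding PiS using M(2)[of j] Pi1[of j] by (intro mult_left_mono) auto
      qed
      then have "\<bar>t - t'\<bar> * (Pi j * l j) \<le> 8 * y"
        using N1[of j] by (simp add: y_def field_simps)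
      then have "\<bar>t - t'\<bar> \<le> 8 * y / (Pi j * l j)"
        using Pi1[of j] lpos[of j] by (subst pos_le_divide_eq) auto
      \<comment> \<open>Only the power \<sigma> of \<open>y\<close> is kept; since \<open>y\<close>
        \<le> \<open>l j\<close> and \<sigma> \<le> 1, the remaining power is bounded by that of
        \<open>l j\<close>, and the count of intervals absorbs it.\<close>
      also have "\<dots> = 8 * y powr \<sigma> * (y powr (1 - \<sigma>) / (Pi j * l j))"
        using y0 by (simp add: powr_diff)
      also have "\<dots> \<le> 8 * y powr \<sigma> * (l j powr (1 - \<sigma>) / (Pi j * l j))"
      proof (intro mult_left_mono divide_right_mono powr_mono2)
        have "1 / \<tau> \<le> 1" using \<tau> by simp
        then show "0 \<le> 1 - \<sigma>" using \<sigma> by linarith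
      qed (use y0 yl Pi1[of j] lpos[of j] in auto)
      also have "l j powr (1 - \<sigma>) / (Pi j * l j) = l j powr - \<sigma> / Pi j"
        using lpos[of j] by (simp add: powr_diff powr_minus field_simps)
      also have "8 * y powr \<sigma> * (l j powr - \<sigma> / Pi j) \<le> 8 * y powr \<sigma> * C \<sigma>"
        using C(2)[OF \<sigma>, of j] Pi1[of j] by (intro mult_left_mono) (auto simp: divide_le_eq)
      also have "\<dots> \<le> 8 * \<bar>g t - g t'\<bar> powr \<sigma> * C \<sigma>"
        using gap y0 \<sigma> C(1)[of \<sigma>] by (intro mult_right_mono mult_left_mono powr_mono2) (auto simp: y_def)
      finally show ?thesis by (simp add: mult_ac)
    qed simp
    show ?thesis unfolding cantor_param_def by (intro exI[of _ g]) (use range grid holder in auto)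
  qed
  show thesis
    by (rule that[of r "\<lambda>\<sigma>. 8 * C \<sigma>"]) (use N(3) C(1) main in \<open>auto simp: N_def[abs_def]\<close>)
qed


section \<open>Slicing\<close>

definition vec_upd :: "'d \<Rightarrow> 'a \<Rightarrow> 'a ^ 'd \<Rightarrow> 'a ^ 'd" where
  "vec_upd i t y = (\<chi> j. if j = i then t else y $ j)"

lemma vec_upd_nth [simp]: "vec_upd i t y $ j = (if j = i then t else y $ j)"
  by (simp add: vec_upd_def)

lemma emeasure_lebesgue_cbox_cart:
  fixes lo hi :: "real^'d"
  assumes "\<And>j. lo $ j \<le> hi $ j"
  shows "emeasure lebesgue (cbox lo hi) = ennreal (\<Prod>j\<in>UNIV. hi $ j - lo $ j)"
proof -
  have "cbox lo hi \<noteq> {}" using assms by (simp add: interval_ne_empty_cart)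
  then have "measure lborel (cbox lo hi) = (\<Prod>j\<in>UNIV. hi $ j - lo $ j)" by (rule content_cbox_cart)
  moreover have "emeasure lborel (cbox lo hi) = ennreal (measure lborel (cbox lo hi))"
    using emeasure_lborel_cbox_finite[of lo hi] by (intro emeasure_eq_ennreal_measure) auto
  ultimately show ?thesis by simp
qed

text \<open>A Fubini argument applied to a cover of \<open>E\<close>. A covering set of diameter r
  meets only the slices whose base points lie in a box of volume \<open>K\<close> r^(d-1).
  Integrating the slice estimate over all base points gives c vol \<le> \<open>K\<close> \<Sum>
  r^(d-1+\<sigma>) \<le> \<open>K\<close> \<Sum> r^s, which contradicts a small cover. The base
  point \<open>y\<close> is a full vector whose coordinate \<open>i\<close> is overwritten, so the
  integral stays in the original space.\<close>

lemma hausdorff_measure_slicing: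
  fixes E :: "(real^'d) set"
  assumes s: "0 \<le> s" "s \<le> real CARD('d) - 1 + \<sigma>" and \<sigma>: "0 \<le> \<sigma>" and c: "0 < c"
    and box: "\<And>j. lo $ j < hi $ j" and Z: "negligible Z"
    and slice: "\<And>y (J::nat set) V r. y \<in> cbox lo hi - Z \<Longrightarrow>
       (\<And>j. j \<in> J \<Longrightarrow> 0 \<le> r j) \<Longrightarrow> (\<And>j t t'. j \<in> J \<Longrightarrow> t \<in> V j \<Longrightarrow> t' \<in> V j \<Longrightarrow> \<bar>t - t'\<bar> \<le> r j) \<Longrightarrow>
       {t. vec_upd i t y \<in> E} \<subseteq> (\<Union>j\<in>J. V j) \<Longrightarrow>
       ennreal c \<le> (\<Sum>j. if j \<in> J then ennreal (rpow (r j) \<sigma>) else 0)"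
  shows "hausdorff_measure s E \<noteq> 0"
proof
  assume H: "hausdorff_measure s E = 0"
  define vol where "vol = (\<Prod>j\<in>UNIV. hi $ j - lo $ j)"
  have vol: "0 < vol" unfolding vol_def using box by (intro prod_pos) auto
  define K where "K = (hi $ i - lo $ i) * 2 ^ (CARD('d) - 1)"
  have K: "0 < K" using box[of i] by (simp add: K_def)
  have eta: "0 < ennreal (c * vol / K)" using c vol K by simp
  obtain U where U: "E \<subseteq> (\<Union>j. U j)" "\<And>j. bounded (U j)" "\<And>j. diameter (U j) \<le> 1"
      "(\<Sum>j. hausdorff_gauge s (U j)) < ennreal (c * vol / K)"
    using hausdorff_measure_0_cover[OF H zero_less_one eta] by metis
  define J where "J = {j. U j \<noteq> {}}"
  define u where "u j = (SOME x. x \<in> U j)" for j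
  have u: "u j \<in> U j" if "j \<in> J" for j using that by (simp add: J_def u_def some_in_eq)
  define r where "r j = diameter (U j)" for j
  have r: "0 \<le> r j" "r j \<le> 1" for j using U(2,3) by (auto simp: r_def diameter_ge_0)
  \<comment> \<open>The base points of the slices that meet \<open>U j\<close>, unrestricted in the
    slicing coordinate within the given box.\<close>
  define B where "B j = cbox (\<chi> m. if m = i then lo $ i else u j $ m - r j) (\<chi> m. if m = i then hi $ i else u j $ m + r j)" for j
  have mB: "emeasure lebesgue (B j) = ennreal (K * r j ^ (CARD('d) - 1))" for j
  proof -
    have "emeasure lebesgue (B j) = ennreal (\<Prod>m\<in>UNIV. if m = i then hi $ i - lo $ i else 2 * r j)"
      unfolding B_def using box[of i] r(1)[of j]
      by (subst emeasure_lebesgue_cbox_cart) (auto intro!: arg_cong[where f=ennreal] prod.cong)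
    also have "(\<Prod>m\<in>UNIV. if m = i then hi $ i - lo $ i else 2 * r j) = (hi $ i - lo $ i) * (\<Prod>m\<in>UNIV - {i}. 2 * r j)"
      by (subst prod.remove[of UNIV i]) (auto intro!: prod.cong)
    also have "\<dots> = K * r j ^ (CARD('d) - 1)" by (simp add: K_def power_mult_distrib)
    finally show ?thesis .
  qed
  have sB: "B j \<in> sets lebesgue" for j by (simp add: B_def)
  define F where "F y = (\<Sum>j. (if j \<in> J then ennreal (rpow (r j) \<sigma>) else 0) * indicator (B j) y)" for y
  have pt: "ennreal c * indicator (cbox lo hi) y \<le> F y" if y: "y \<notin> Z" for y
  proof (cases "y \<in> cbox lo hi")
    case True
    define J' where "J' = {j\<in>J. y \<in> B j}"
    have "ennreal c \<le> (\<Sum>j. if j \<in> J' then ennreal (rpow (r j) \<sigma>) else 0)"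
    proof (rule slice[where V="\<lambda>j. {t. vec_upd i t y \<in> U j}"])
      fix j t t' assume "t \<in> {t. vec_upd i t y \<in> U j}" "t' \<in> {t. vec_upd i t y \<in> U j}"
      then have "norm (vec_upd i t y - vec_upd i t' y) \<le> r j"
        using diameter_bounded_bound[OF U(2), of "vec_upd i t y" j "vec_upd i t' y"] by (simp add: r_def dist_norm)
      then show "\<bar>t - t'\<bar> \<le> r j"
        using component_le_norm_cart[of "vec_upd i t y - vec_upd i t' y" i] by simp
    next
      show "{t. vec_upd i t y \<in> E} \<subseteq> (\<Union>j\<in>J'. {t. vec_upd i t y \<in> U j})"
      proof
        fix t assume "t \<in> {t. vec_upd i t y \<in> E}"
        then obtain j where j: "vec_upd i t y \<in> U j" using U(1) by auto
        then have jJ: "j \<in> J" by (auto simp: J_def)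
        have "norm (vec_upd i t y - u j) \<le> r j"
          using diameter_bounded_bound[OF U(2) j u[OF jJ]] by (simp add: r_def dist_norm)
        then have "\<bar>(vec_upd i t y - u j) $ m\<bar> \<le> r j" for m
          using component_le_norm_cart[of "vec_upd i t y - u j" m] by linarith
        then have "\<bar>y $ m - u j $ m\<bar> \<le> r j" if "m \<noteq> i" for m using that by (metis vec_upd_nth vector_minus_component)
        then have "y \<in> B j" using True by (auto simp: B_def mem_box_cart abs_le_iff algebra_simps)
        then show "t \<in> (\<Union>j\<in>J'. {t. vec_upd i t y \<in> U j})" using j jJ by (auto simp: J'_def)
      qed
    qed (use True y r in auto)
    also have "\<dots> = F y" unfolding F_def by (rule suminf_cong) (auto simp: J'_def indicator_def)
    finally show ?thesis using True by simp
  qed simp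
  have volc: "emeasure lebesgue (cbox lo hi) = ennreal vol"
    unfolding vol_def by (rule emeasure_lebesgue_cbox_cart) (rule less_imp_le[OF box])
  have "ennreal (c * vol) = (\<integral>\<^sup>+y. ennreal c * indicator (cbox lo hi) y \<partial>lebesgue)"
    using c vol by (subst nn_integral_cmult_indicator, simp, subst volc) (simp add: ennreal_mult)
  also have "\<dots> \<le> (\<integral>\<^sup>+y. F y \<partial>lebesgue)"
  proof (rule nn_integral_mono_AE)
    have "AE y in lebesgue. y \<notin> Z" using Z by (intro AE_not_in) (simp add: negligible_iff_null_sets)
    then show "AE y in lebesgue. ennreal c * indicator (cbox lo hi) y \<le> F y" by (rule AE_mp) (use pt in auto)
  qed
  also have "\<dots> = (\<Sum>j. \<integral>\<^sup>+y. (if j \<in> J then ennreal (rpow (r j) \<sigma>) else 0) * indicator (B j) y \<partial>lebesgue)"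
    unfolding F_def
    by (intro nn_integral_suminf borel_measurable_times_ennreal borel_measurable_const borel_measurable_indicator sB)
  also have "\<dots> = (\<Sum>j. (if j \<in> J then ennreal (rpow (r j) \<sigma>) else 0) * ennreal (K * r j ^ (CARD('d) - 1)))"
    unfolding mB[symmetric] by (rule suminf_cong, rule nn_integral_cmult_indicator) (simp add: B_def)
  also have "\<dots> \<le> (\<Sum>j. ennreal K * hausdorff_gauge s (U j))"
  proof (rule suminf_le)
    fix j
    show "(if j \<in> J then ennreal (rpow (r j) \<sigma>) else 0) * ennreal (K * r j ^ (CARD('d) - 1)) \<le> ennreal K * hausdorff_gauge s (U j)"
    proof (cases "j \<in> J")
      case True
      have cd: "real (CARD('d) - 1) = real CARD('d) - 1" by (simp add: of_nat_diff Suc_leI)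
      \<comment> \<open>The exponents add and r \<le> 1 makes the larger exponent give the smaller
        value. The cases s = 0 and r = 0 are split off because \<open>rpow\<close> is 1 at exponent
        0.\<close>
      have "rpow (r j) \<sigma> * r j ^ (CARD('d) - 1) \<le> rpow (r j) s"
      proof (cases "s = 0")
        case s0: True
        have "rpow (r j) \<sigma> \<le> 1"
          using r[of j] \<sigma> powr_mono2[of \<sigma> "r j" 1] by (auto simp: rpow_def)
        moreover have "r j ^ (CARD('d) - 1) \<le> 1" using r[of j] by (intro power_le_one) auto
        ultimately show ?thesis using s0 r[of j] by (simp add: rpow_def mult_le_one rpow_nonneg)
      next
        case False
        show ?thesis
        proof (cases "r j = 0")
          case True
          show ?thesis
          proof (cases "\<sigma> = 0")
            case s0: True
            then have "0 < CARD('d) - 1" using s False cd by linarith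
            then have "r j ^ (CARD('d) - 1) = 0" using True by (simp add: zero_power)
            then have "rpow (r j) \<sigma> * r j ^ (CARD('d) - 1) = 0" by (simp only: mult_zero_right)
            then show ?thesis using rpow_nonneg[of "r j" s] r[of j] by linarith
          next
            case False
            then show ?thesis using True \<open>s \<noteq> 0\<close> by (simp add: rpow_def)
          qed
        next
          case r0: False
          then have rp: "0 < r j" using r[of j] by simp
          have "rpow (r j) \<sigma> = r j powr \<sigma>" using r0 by (simp add: rpow_def)
          moreover have "r j ^ (CARD('d) - 1) = r j powr (real CARD('d) - 1)"
            using rp by (simp add: powr_realpow[symmetric] cd)
          ultimately have "rpow (r j) \<sigma> * r j ^ (CARD('d) - 1) = r j powr (real CARD('d) - 1 + \<sigma>)"
            by (simp add: powr_add mult.commute)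
          also have "\<dots> \<le> r j powr s" using rp r[of j] s by (intro powr_mono') auto
          finally show ?thesis using False by (simp add: rpow_def)
        qed
      qed
      then have "K * (rpow (r j) \<sigma> * r j ^ (CARD('d) - 1)) \<le> K * rpow (r j) s"
        using K by (intro mult_left_mono) auto
      then have "ennreal (K * (rpow (r j) \<sigma> * r j ^ (CARD('d) - 1))) \<le> ennreal (K * rpow (r j) s)"
        by (rule ennreal_leI)
      moreover have "ennreal (rpow (r j) \<sigma>) * ennreal (K * r j ^ (CARD('d) - 1)) = ennreal (K * (rpow (r j) \<sigma> * r j ^ (CARD('d) - 1)))"
        using r[of j] K by (subst ennreal_mult[symmetric]) (auto simp: rpow_nonneg mult_ac)
      moreover have "ennreal K * hausdorff_gauge s (U j) = ennreal (K * rpow (r j) s)"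
        using True r[of j] K by (simp add: hausdorff_gauge_def J_def r_def ennreal_mult rpow_nonneg)
      ultimately show ?thesis using True by simp
    qed simp
  qed auto
  also have "\<dots> = ennreal K * (\<Sum>j. hausdorff_gauge s (U j))" by simp
  also have "\<dots> < ennreal K * ennreal (c * vol / K)"
    using U(4) K by (intro ennreal_mult_strict_left_mono) auto
  also have "\<dots> = ennreal (c * vol)" using K c vol by (simp add: ennreal_mult[symmetric])
  finally show False by simp
qed


lemma inner_vec_upd:
  fixes v y :: "real^'d"
  shows "v \<bullet> vec_upd i t y = v \<bullet> y + v $ i * (t - y $ i)"
proof -
  have "vec_upd i t y = y + (t - y $ i) *\<^sub>R axis i 1" by (simp add: vec_eq_iff axis_def)
  then show ?thesis by (simp add: inner_add_right inner_axis mult.commute)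
qed

lemma finite_int_vec_norm_le: "finite {q :: int^'d. rnorm q \<le> R}"
proof (rule finite_subset)
  let ?A = "{- \<lfloor>R\<rfloor>..\<lfloor>R\<rfloor>}"
  show "{q :: int^'d. rnorm q \<le> R} \<subseteq> vec_lambda ` (PiE UNIV (\<lambda>_. ?A))"
  proof
    fix q :: "int^'d" assume "q \<in> {q. rnorm q \<le> R}"
    then have "\<bar>real_of_int (q $ i)\<bar> \<le> R" for i using component_le_norm_cart[of "rvec q" i] by simp
    then have "q $ i \<le> \<lfloor>R\<rfloor>" "- (q $ i) \<le> \<lfloor>R\<rfloor>" for i
      by (simp_all add: le_floor_iff abs_le_iff)
    then have "q $ i \<in> ?A" for i by (simp add: minus_le_iff)
    then have "(\<lambda>i. q $ i) \<in> PiE UNIV (\<lambda>_. ?A)" by (intro PiE_I) auto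
    moreover have "q = vec_lambda (\<lambda>i. q $ i)" by (simp add: vec_eq_iff)
    ultimately show "q \<in> vec_lambda ` (PiE UNIV (\<lambda>_. ?A))" by (metis image_eqI)
  qed
  show "finite (vec_lambda ` (PiE (UNIV::'d set) (\<lambda>_. ?A)))" by (intro finite_imageI finite_PiE) auto
qed

lemma finite_positive_lower_bound:
  fixes f :: "'a \<Rightarrow> real"
  assumes "finite Q" "\<And>q. q \<in> Q \<Longrightarrow> 0 < f q"
  obtains \<delta> where "0 < \<delta>" "\<And>q. q \<in> Q \<Longrightarrow> \<delta> \<le> f q"
proof -
  have "\<exists>\<delta>>0. \<forall>q\<in>Q. \<delta> \<le> f q" using assms
  proof (induction Q rule: finite_induct)
    case (insert x Q)
    then obtain \<delta> where "0 < \<delta>" "\<forall>q\<in>Q. \<delta> \<le> f q" by auto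
    then show ?case using insert.prems by (intro exI[of _ "min \<delta> (f x)"]) auto
  qed (auto intro: exI[of _ 1])
  then show thesis using that by blast
qed

text \<open>Each nonempty \<open>B j\<close> sits in an interval of length \<open>2 * d j\<close>
  about one of its points. The intervals are measurable and cover the unit interval up to a null
  set, so their lengths add up to at least 1.\<close>

lemma unit_interval_cover:
  fixes B :: "nat \<Rightarrow> real set"
  assumes neg: "negligible \<Omega>" and d: "\<And>j. j \<in> J \<Longrightarrow> 0 \<le> d j"
    and B: "\<And>j x y. j \<in> J \<Longrightarrow> x \<in> B j \<Longrightarrow> y \<in> B j \<Longrightarrow> \<bar>x - y\<bar> \<le> d j"
    and cov: "{0..<1} - \<Omega> \<subseteq> (\<Union>j\<in>J. B j)"
  shows "1 \<le> (\<Sum>j. if j \<in> J then ennreal (2 * d j) else 0)"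
proof -
  define x where "x j = (SOME x. x \<in> B j)" for j
  define I where "I j = (if j \<in> J then {x j - d j..x j + d j} else {})" for j
  have BI: "B j \<subseteq> I j" if "j \<in> J" for j
  proof
    fix y assume y: "y \<in> B j"
    then have "x j \<in> B j" unfolding x_def by (rule someI)
    then have "\<bar>y - x j\<bar> \<le> d j" using B that y by blast
    then show "y \<in> I j" using that by (simp add: I_def abs_le_iff)
  qed
  have "1 = emeasure lebesgue {0..<1::real}" by simp
  also have "\<dots> \<le> (\<integral>\<^sup>+y. indicator (\<Union>j. I j) y \<partial>lebesgue)"
  proof (subst nn_integral_indicator[symmetric], simp, rule nn_integral_mono_AE)
    have "AE y in lebesgue. y \<notin> \<Omega>" using neg by (intro AE_not_in) (simp add: negligible_iff_null_sets)
    then show "AE y in lebesgue. indicator {0..<1} y \<le> (indicator (\<Union>j. I j) y :: ennreal)"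
    proof (rule AE_mp, intro AE_I2 impI)
      fix y assume y: "y \<notin> \<Omega>"
      show "indicator {0..<1} y \<le> (indicator (\<Union>j. I j) y :: ennreal)"
      proof (cases "y \<in> {0..<1}")
        case True
        then obtain j where "j \<in> J" "y \<in> B j" using y cov by blast
        then have "y \<in> (\<Union>j. I j)" using BI by blast
        then show ?thesis by (simp add: indicator_def)
      qed simp
    qed
  qed
  also have "\<dots> = emeasure lebesgue (\<Union>j. I j)" by (rule nn_integral_indicator) (auto simp: I_def)
  also have "\<dots> \<le> (\<Sum>j. emeasure lebesgue (I j))" by (rule emeasure_subadditive_countably) (auto simp: I_def)
  also have "\<dots> = (\<Sum>j. if j \<in> J then ennreal (2 * d j) else 0)"
    by (rule suminf_cong) (use d in \<open>auto simp: I_def\<close>)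
  finally show ?thesis .
qed

text \<open>The convergence part of Borel-Cantelli, carried out in the parameter. For one
  \<open>n\<close> and one integer, the values of \<open>g\<close> lie within O(c |n|^(1-\<tau>) /
  m) of each other, m being the absolute value of \<open>n $ i\<close>; the parameters then lie in a
  set of diameter of that order to the power \<sigma>. There are O(m) integers to consider, and m
  \<le> |n| with \<sigma> \<le> 1 gives O(c^\<sigma> |n|^(1-\<tau>\<sigma>)) for each
  \<open>n\<close>.\<close>

lemma hausdorff_measure_bad_parameters:
  fixes S :: "(int^'d) set" and g w :: "_ \<Rightarrow> real"
  assumes g: "\<And>t. t \<in> D \<Longrightarrow> g t \<in> {u..v}"
    and hol: "\<And>t t'. t \<in> D \<Longrightarrow> t' \<in> D \<Longrightarrow> \<bar>t - t'\<bar> \<le> C * \<bar>g t - g t'\<bar> powr \<sigma>"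
    and C: "0 < C" and \<sigma>: "0 < \<sigma>" "\<sigma> \<le> 1" and \<tau>: "1 \<le> \<tau>"
    and summ: "(\<lambda>n. rnorm n powr (1 - \<tau> * \<sigma>)) summable_on S"
  shows "hausdorff_measure 1 {t\<in>D. \<forall>c>0. \<exists>n\<in>S. n $ i \<noteq> 0 \<and>
           dist_int (real_of_int (n $ i) * g t + w n) < c * rnorm n powr (1 - \<tau>)} = 0"
    (is "hausdorff_measure 1 ?E = 0")
proof (rule hausdorff_measure_0I)
  fix \<delta> \<eta> :: real assume \<delta>: "0 < \<delta>" and \<eta>: "0 < \<eta>"
  define S' where "S' = {n\<in>S. n $ i \<noteq> 0}"
  define T where "T = infsum (\<lambda>n. rnorm n powr (1 - \<tau> * \<sigma>)) S"
  have T: "0 \<le> T" unfolding T_def by (rule infsum_nonneg) auto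
  define L where "L = \<bar>v - u\<bar> + 5"
  define b where "b = C * 2 powr \<sigma>"
  have b: "0 < b" using C by (simp add: b_def)
  have L: "0 < L" by (simp add: L_def add_nonneg_pos)
  \<comment> \<open>This will be the value of \<open>c powr \<sigma>\<close>: the first entry makes
    all diameters at most \<delta>, the second makes the total at most \<eta>.\<close>
  define \<zeta> where "\<zeta> = min (\<delta> / b) (\<eta> / (L * b * (T + 1)))"
  have \<zeta>: "0 < \<zeta>" using \<delta> \<eta> b L T by (simp add: \<zeta>_def)
  define c where "c = \<zeta> powr (1 / \<sigma>)"
  have c: "0 < c" using \<zeta> by (simp add: c_def)
  have c\<sigma>: "c powr \<sigma> = \<zeta>" using \<zeta> \<sigma> by (simp add: c_def powr_powr)
  define e where "e n = c * rnorm n powr (1 - \<tau>)" for n :: "int^'d"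
  define m where "m n = \<bar>real_of_int (n $ i)\<bar>" for n :: "int^'d"
  define r where "r n = C * (2 * e n / m n) powr \<sigma>" for n
  \<comment> \<open>The integers near \<open>n $ i * g t + w n\<close> for \<open>g t\<close>
    between \<open>u\<close> and \<open>v\<close> start here. The -1, and the +4 in
    \<open>M\<close>, absorb the floor, the ceiling and the rounding to the nearest integer.\<close>
  define base where "base n = \<lfloor>min (real_of_int (n $ i) * u) (real_of_int (n $ i) * v) + w n\<rfloor> - 1" for n
  define M where "M n = nat (\<lceil>m n * \<bar>v - u\<bar>\<rceil> + 4)" for n
  define V where "V n k = {t\<in>D. \<bar>real_of_int (n $ i) * g t + w n - of_int (base n + int k)\<bar> < e n}" for n k
  have m1: "1 \<le> m n" "m n \<le> rnorm n" if "n \<in> S'" for n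
    using that component_le_norm_cart[of "rvec n" i] by (auto simp: S'_def m_def)
  have e0: "0 < e n" if "n \<in> S'" for n
    using m1[OF that] c unfolding e_def by (intro mult_pos_pos) auto
  have close: "\<bar>t - t'\<bar> \<le> r n" if n: "n \<in> S'" and "t \<in> V n k" "t' \<in> V n k" for n k t t'
  proof -
    have o: "t \<in> D" "t' \<in> D" using that by (auto simp: V_def)
    have "\<bar>real_of_int (n $ i) * (g t - g t')\<bar> \<le> 2 * e n"
      using that unfolding V_def by (auto simp: algebra_simps)
    then have "\<bar>g t - g t'\<bar> \<le> 2 * e n / m n"
      using m1[OF n] by (simp add: abs_mult m_def pos_le_divide_eq mult.commute)
    then have "C * \<bar>g t - g t'\<bar> powr \<sigma> \<le> r n"
      unfolding r_def using C \<sigma> by (intro mult_left_mono powr_mono2) auto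
    then show ?thesis using hol[OF o] by linarith
  qed
  have r0: "0 \<le> r n" for n using C by (simp add: r_def)
  have rn: "r n = b * \<zeta> * (rnorm n powr (1 - \<tau>) / m n) powr \<sigma>" if "n \<in> S'" for n
  proof -
    define X where "X = rnorm n powr (1 - \<tau>) / m n"
    have X: "0 \<le> X" using m1[OF that] by (simp add: X_def)
    have "2 * e n / m n = 2 * c * X" by (simp add: e_def X_def)
    then show ?thesis using c X by (simp add: r_def b_def powr_mult c\<sigma> X_def[symmetric])
  qed
  show "hausdorff_premeasure 1 \<delta> ?E \<le> ennreal \<eta>"
  proof (rule hausdorff_premeasure_family_le[where S=S' and M=M and V=V and r=r])
    show "?E \<subseteq> (\<Union>n\<in>S'. \<Union>k<M n. V n k)"
    proof
      fix t assume om: "t \<in> ?E"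
      then obtain n where n: "n \<in> S" "n $ i \<noteq> 0" "dist_int (real_of_int (n $ i) * g t + w n) < e n"
        using c unfolding e_def by blast
      define z where "z = real_of_int (n $ i) * g t + w n"
      define lo where "lo = min (real_of_int (n $ i) * u) (real_of_int (n $ i) * v) + w n"
      have gu: "u \<le> g t" "g t \<le> v" using om g[of t] by auto
      have "lo \<le> z \<and> z \<le> lo + m n * \<bar>v - u\<bar>"
      proof (cases "0 \<le> n $ i")
        case True
        then have "real_of_int (n $ i) * u \<le> real_of_int (n $ i) * g t" "real_of_int (n $ i) * g t \<le> real_of_int (n $ i) * v"
          using gu by (auto intro: mult_left_mono)
        moreover have "m n * \<bar>v - u\<bar> = real_of_int (n $ i) * v - real_of_int (n $ i) * u"
          using True gu by (simp add: m_def algebra_simps)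
        ultimately show ?thesis unfolding lo_def z_def by auto
      next
        case False
        then have "real_of_int (n $ i) * v \<le> real_of_int (n $ i) * g t" "real_of_int (n $ i) * g t \<le> real_of_int (n $ i) * u"
          using gu by (auto intro: mult_left_mono_neg)
        moreover have "m n * \<bar>v - u\<bar> = real_of_int (n $ i) * u - real_of_int (n $ i) * v"
          using False gu by (simp add: m_def algebra_simps)
        ultimately show ?thesis unfolding lo_def z_def by auto
      qed
      moreover have "\<bar>of_int (round z) - z\<bar> \<le> 1/2" by (rule of_int_round_abs_le)
      moreover have "real_of_int \<lfloor>lo\<rfloor> \<le> lo" "lo < real_of_int \<lfloor>lo\<rfloor> + 1" "m n * \<bar>v - u\<bar> \<le> real_of_int \<lceil>m n * \<bar>v - u\<bar>\<rceil>" by linarith+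
      ultimately have bounds: "real_of_int (\<lfloor>lo\<rfloor> - 1) \<le> of_int (round z)"
          "real_of_int (round z) < of_int (\<lfloor>lo\<rfloor> - 1 + (\<lceil>m n * \<bar>v - u\<bar>\<rceil> + 4))"
        unfolding of_int_diff of_int_add of_int_numeral of_int_1 by linarith+
      have base: "base n = \<lfloor>lo\<rfloor> - 1" by (simp add: base_def lo_def)
      define k where "k = nat (round z - base n)"
      have rz: "base n \<le> round z" "round z < base n + (\<lceil>m n * \<bar>v - u\<bar>\<rceil> + 4)"
        using bounds unfolding base by (simp_all only: of_int_le_iff of_int_less_iff)
      have "k < M n" using rz unfolding k_def M_def by linarith
      moreover have "t \<in> V n k"
        using om n(3) rz(1) by (simp add: V_def k_def z_def dist_int_def)
      moreover have "n \<in> S'" using n by (simp add: S'_def)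
      ultimately show "t \<in> (\<Union>n\<in>S'. \<Union>k<M n. V n k)" by blast
    qed
    show "r n \<le> \<delta>" if n: "n \<in> S'" for n
    proof -
      have "rnorm n powr (1 - \<tau>) \<le> 1"
        using m1[OF n] \<tau> powr_mono[of "1 - \<tau>" 0 "rnorm n"] by (auto split: if_splits)
      then have "rnorm n powr (1 - \<tau>) / m n \<le> 1" using m1[OF n] by (simp add: divide_le_eq)
      then have "(rnorm n powr (1 - \<tau>) / m n) powr \<sigma> \<le> 1"
        using \<sigma> m1[OF n] powr_mono2[of \<sigma> "rnorm n powr (1 - \<tau>) / m n" 1] by auto
      then have "r n \<le> b * \<zeta>" unfolding rn[OF n] using b \<zeta> by (simp add: mult_left_le)
      also have "\<dots> \<le> \<delta>"
      proof -
        have "\<zeta> \<le> \<delta> / b" by (simp add: \<zeta>_def)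
        then show ?thesis using b by (simp add: field_simps)
      qed
      finally show ?thesis .
    qed
    fix F assume F: "finite F" "F \<subseteq> S'"
    have cell: "real (M n) * rpow (r n) 1 \<le> L * b * \<zeta> * rnorm n powr (1 - \<tau> * \<sigma>)" if n: "n \<in> S'" for n
    proof -
      define \<nu> where "\<nu> = rnorm n"
      have \<nu>: "1 \<le> m n" "m n \<le> \<nu>" using m1[OF n] by (auto simp: \<nu>_def)
      have "real (M n) \<le> m n * \<bar>v - u\<bar> + 5"
      proof -
        have "0 \<le> m n * \<bar>v - u\<bar>" using \<nu> by simp
        then have "0 \<le> \<lceil>m n * \<bar>v - u\<bar>\<rceil>" by (metis ceiling_mono ceiling_zero)
        then have "real (M n) = real_of_int \<lceil>m n * \<bar>v - u\<bar>\<rceil> + 4" by (simp add: M_def)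
        then show ?thesis using of_int_ceiling_le_add_one[of "m n * \<bar>v - u\<bar>"] by linarith
      qed
      also have "\<dots> \<le> L * m n" using \<nu> by (simp add: L_def algebra_simps)
      finally have Mn: "real (M n) \<le> L * m n" .
      have "real (M n) * rpow (r n) 1 = real (M n) * r n" using r0[of n] by (simp add: rpow_def)
      also have "\<dots> \<le> L * m n * r n" using Mn r0 by (rule mult_right_mono)
      also have "\<dots> = L * b * \<zeta> * (m n * (\<nu> powr (1 - \<tau>) / m n) powr \<sigma>)"
        unfolding rn[OF n] \<nu>_def by simp
      also have "m n * (\<nu> powr (1 - \<tau>) / m n) powr \<sigma> = m n powr (1 - \<sigma>) * \<nu> powr ((1 - \<tau>) * \<sigma>)"
      proof -
        have "m n * (Y / m n) powr \<sigma> = m n powr (1 - \<sigma>) * Y powr \<sigma>" if "0 \<le> Y" for Y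
          using \<nu> that by (simp add: powr_divide powr_diff)
        then show ?thesis by (simp add: powr_powr)
      qed
      also have "L * b * \<zeta> * (m n powr (1 - \<sigma>) * \<nu> powr ((1 - \<tau>) * \<sigma>)) \<le> L * b * \<zeta> * (\<nu> powr (1 - \<sigma>) * \<nu> powr ((1 - \<tau>) * \<sigma>))"
        using \<nu> \<sigma> L b \<zeta> by (intro mult_left_mono mult_right_mono powr_mono2) auto
      also have "\<nu> powr (1 - \<sigma>) * \<nu> powr ((1 - \<tau>) * \<sigma>) = \<nu> powr (1 - \<tau> * \<sigma>)"
        by (simp add: powr_add[symmetric] algebra_simps)
      finally show ?thesis by (simp add: \<nu>_def)
    qed
    have "(\<Sum>n\<in>F. real (M n) * rpow (r n) 1) \<le> (\<Sum>n\<in>F. L * b * \<zeta> * rnorm n powr (1 - \<tau> * \<sigma>))"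
      using F by (intro sum_mono cell) auto
    also have "\<dots> = L * b * \<zeta> * (\<Sum>n\<in>F. rnorm n powr (1 - \<tau> * \<sigma>))" by (simp add: sum_distrib_left)
    also have "\<dots> \<le> L * b * \<zeta> * (T + 1)"
    proof (rule mult_left_mono)
      have "(\<Sum>n\<in>F. rnorm n powr (1 - \<tau> * \<sigma>)) \<le> T"
        unfolding T_def using F summ by (intro finite_sum_le_infsum) (auto simp: S'_def)
      then show "(\<Sum>n\<in>F. rnorm n powr (1 - \<tau> * \<sigma>)) \<le> T + 1" by simp
    qed (use L b \<zeta> in auto)
    also have "\<dots> \<le> \<eta>"
    proof -
      have "\<zeta> \<le> \<eta> / (L * b * (T + 1))" by (simp add: \<zeta>_def)
      moreover have "0 < L * b * (T + 1)" using L b T by simp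
      ultimately show ?thesis by (simp add: pos_le_divide_eq mult_ac)
    qed
    finally show "(\<Sum>n\<in>F. real (M n) * rpow (r n) 1) \<le> \<eta>" .
  next
    fix n k assume n: "n \<in> S'"
    show "bounded (V n k)" unfolding bounded_def dist_real_def using close[OF n] by blast
    show "diameter (V n k) \<le> r n" by (rule diameter_le) (use close[OF n] r0 in auto)
  qed (use \<delta> r0 in auto)
qed


section \<open>Pointwise exponents from the order of approximation by hyperplanes\<close>

context sparse_davenport
begin

abbreviation level_set :: "real \<Rightarrow> (real ^ 'd) set" where
  "level_set h \<equiv> {x. holder_exponent (davenport a) x = ereal h}"

text \<open>The series is bounded, which is the case \<alpha> = 0 with the zero polynomial. Without
  a member in the set, the supremum would be -\<infinity>.\<close>

lemma holder_exponent_nonneg: "0 \<le> holder_exponent (davenport a) x"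
proof -
  define T where "T = infsum (\<lambda>n. norm (a n)) (UNIV - {0})"
  have "(\<lambda>n. norm (a n)) summable_on UNIV - {0}" by (rule summable_on_subset_banach[OF summable]) auto
  then have T: "((\<lambda>n. norm (a n)) has_sum T) (UNIV - {0})" unfolding T_def by (rule has_sum_infsum)
  have b: "norm (davenport a y) \<le> T" for y
  proof (rule norm_infsum_le[OF davenport_has_sum T])
    fix n :: "int^'d"
    have "\<bar>sawtooth (rvec n \<bullet> y)\<bar> \<le> 1" using abs_sawtooth_le[of "rvec n \<bullet> y"] by linarith
    then show "norm (a n * of_real (sawtooth (rvec n \<bullet> y))) \<le> norm (a n)"
      by (simp add: norm_mult mult_left_le)
  qed
  have b': "norm (davenport a y) \<le> T + 1" for y using b[of y] by linarith
  have T0: "0 \<le> T" using b[of 0] norm_ge_zero order_trans by blast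
  have "polynomial_deg_less 0 (\<lambda>_::real^'d. 0::'k)"
    unfolding polynomial_deg_less_def by (intro exI[of _ "{}"]) auto
  then have "holder_at (davenport a) 0 x" unfolding holder_at_def
    by (intro exI[of _ "T + 1"] conjI exI[of _ "\<lambda>_. 0"] always_eventually allI)
      (use b' T0 in \<open>auto simp: rpow_def add_nonneg_pos\<close>)
  then have "ereal 0 \<le> holder_exponent (davenport a) x" unfolding holder_exponent_def
    by (intro Sup_upper) blast
  then show ?thesis by (simp add: zero_ereal_def)
qed

lemma holder_at_le_exponent: "0 \<le> \<alpha> \<Longrightarrow> holder_at (davenport a) \<alpha> x \<Longrightarrow> ereal \<alpha> \<le> holder_exponent (davenport a) x"
  unfolding holder_exponent_def by (intro Sup_upper) blast

lemma holder_at_if_not_bad: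
  assumes "0 < \<alpha>" "1 \<le> \<tau>" "\<tau> * \<alpha> < G" "x \<notin> bad_set (supp a) \<tau>"
  shows "holder_at (davenport a) \<alpha> x"
proof -
  obtain c where "0 < c" "\<And>n. n \<in> supp a \<Longrightarrow> c * rnorm n powr (1 - \<tau>) \<le> dist_int (rvec n \<bullet> x)"
    using assms(4) by (auto simp: bad_set_def not_less)
  then show ?thesis using assms by (intro holder_at_davenport) auto
qed

lemma not_bad_imp_notin_Ints:
  assumes "x \<notin> bad_set (supp a) \<tau>" "n \<in> supp a"
  shows "rvec n \<bullet> x \<notin> \<int>"
proof -
  obtain c where c: "0 < c" "\<And>n. n \<in> supp a \<Longrightarrow> c * rnorm n powr (1 - \<tau>) \<le> dist_int (rvec n \<bullet> x)"
    using assms(1) by (auto simp: bad_set_def not_less)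
  have "rvec n \<noteq> 0" using norm_supp_ge_1[OF assms(2)] by auto
  then have "0 < c * rnorm n powr (1 - \<tau>)" using c(1) by simp
  then have "0 < dist_int (rvec n \<bullet> x)" using c(2)[OF assms(2)] by linarith
  then show ?thesis by (simp add: dist_int_pos_iff)
qed

lemma holder_exponent_ge:
  assumes h: "0 < h" "h \<le> G" and good: "\<And>\<epsilon>. 0 < \<epsilon> \<Longrightarrow> x \<notin> bad_set (supp a) (G / h + \<epsilon>)"
  shows "ereal h \<le> holder_exponent (davenport a) x"
proof (rule ccontr)
  assume "\<not> ereal h \<le> holder_exponent (davenport a) x"
  then obtain b where b: "holder_exponent (davenport a) x = ereal b" "0 \<le> b" "b < h"
    using holder_exponent_nonneg[of x] by (cases "holder_exponent (davenport a) x") auto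
  define \<alpha> where "\<alpha> = (b + h) / 2"
  have \<alpha>: "0 < \<alpha>" "b < \<alpha>" "\<alpha> < h" using b h by (auto simp: \<alpha>_def)
  \<comment> \<open>Chosen so that (\<open>G\<close> / h + \<epsilon>) \<alpha> is the midpoint of
    \<open>G\<close> / h * \<alpha> and \<open>G\<close>.\<close>
  define \<epsilon> where "\<epsilon> = (G - G / h * \<alpha>) / (2 * \<alpha>)"
  have "G / h * \<alpha> < G" using \<alpha> h by (simp add: field_simps)
  then have \<epsilon>: "0 < \<epsilon>" using \<alpha> by (simp add: \<epsilon>_def)
  have "(G / h + \<epsilon>) * \<alpha> = (G / h * \<alpha> + G) / 2" using \<alpha> by (simp add: \<epsilon>_def field_simps)
  then have "(G / h + \<epsilon>) * \<alpha> < G" using \<open>G / h * \<alpha> < G\<close> by simp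
  moreover have "1 \<le> G / h" using h by simp
  then have "1 \<le> G / h + \<epsilon>" using \<epsilon> by linarith
  ultimately have "holder_at (davenport a) \<alpha> x"
    using \<alpha> \<epsilon> good[OF \<epsilon>] by (intro holder_at_if_not_bad) auto
  then have "ereal \<alpha> \<le> ereal b" using holder_at_le_exponent[of \<alpha> x] \<alpha> b by simp
  then show False using \<alpha> by simp
qed

text \<open>Cancelling the common factor does not move the hyperplane, so the distance from
  \<open>x\<close>, written as a normalized residue, is preserved. The bound \<open>R\<close> brings
  \<open>q\<close> into the range where \<open>Asum_lower\<close> applies.\<close>

definition reduces_beyond :: "real \<Rightarrow> real^'d \<Rightarrow> int^'d \<Rightarrow> int \<Rightarrow> bool" where
  "reduces_beyond R x n p \<longleftrightarrow> (\<exists>l q p'. 1 \<le> l \<and> n = int l *s q \<and> reduced q p' \<and> R \<le> rnorm q \<and>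
        \<bar>rvec q \<bullet> x - of_int p'\<bar> / rnorm q = \<bar>rvec n \<bullet> x - of_int p\<bar> / rnorm n)"

text \<open>If \<open>n \<bullet> x\<close> is close to \<open>p\<close>, then \<open>gcd(n, p)\<close> is small compared with \<open>n\<close>: otherwise \<open>x\<close> would lie
  on one of the finitely many relevant hyperplanes of small denominator.\<close>

lemma reduced_large:
  assumes x: "\<forall>n\<in>supp a. rvec n \<bullet> x \<notin> \<int>"
  obtains \<delta> where "0 < \<delta>"
    "\<forall>n\<in>supp a. \<forall>p::int. \<bar>rvec n \<bullet> x - of_int p\<bar> < \<delta> * rnorm n \<longrightarrow>
      reduces_beyond R x n p"
proof -
  \<comment> \<open>Short vectors with a multiple in the support: a finite set. \<open>x\<close>
    lies on none of their hyperplanes, because the multiple would then take an integer value at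
    \<open>x\<close>, so \<delta> can be taken below its distance to all of them.\<close>
  define Q where "Q = {q::int^'d. rnorm q \<le> R \<and> q \<noteq> 0 \<and> (\<exists>l\<ge>1. int l *s q \<in> supp a)}"
  have "finite Q" by (rule finite_subset[OF _ finite_int_vec_norm_le[of R]]) (auto simp: Q_def)
  moreover have "0 < dist_int (rvec q \<bullet> x) / rnorm q" if q: "q \<in> Q" for q
  proof -
    obtain l :: nat where l: "1 \<le> l" "int l *s q \<in> supp a" using q unfolding Q_def by blast
    have "rvec q \<bullet> x \<notin> \<int>"
    proof
      assume "rvec q \<bullet> x \<in> \<int>"
      then have "rvec (int l *s q) \<bullet> x \<in> \<int>" by (simp add: rvec_smult)
      then show False using bspec[OF x l(2)] by blast
    qed
    moreover have "1 \<le> rnorm q" using q norm_rvec_ge_1 by (auto simp: Q_def)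
    ultimately show ?thesis by (intro divide_pos_pos) (auto simp: dist_int_pos_iff)
  qed
  ultimately obtain \<delta> where \<delta>: "0 < \<delta>" "\<And>q. q \<in> Q \<Longrightarrow> \<delta> \<le> dist_int (rvec q \<bullet> x) / rnorm q"
    using finite_positive_lower_bound[of Q "\<lambda>q. dist_int (rvec q \<bullet> x) / rnorm q"] by metis
  show thesis
  proof (rule that[OF \<delta>(1)], intro ballI allI impI)
    fix n p assume n: "n \<in> supp a" and close: "\<bar>rvec n \<bullet> x - of_int p\<bar> < \<delta> * rnorm n"
    have "n \<noteq> 0" using n zero_notin_supp by metis
    then obtain l q p' where l: "1 \<le> l" "n = int l *s q" "p = int l * p'" "reduced q p'"
      by (rule exists_reduced)
    have q0: "q \<noteq> 0" using l by (simp add: reduced_def)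
    have nq: "1 \<le> rnorm q" by (rule norm_rvec_ge_1[OF q0])
    have "rvec n \<bullet> x - of_int p = real l * (rvec q \<bullet> x - of_int p')"
      using l by (simp add: rvec_smult algebra_simps)
    moreover have "rnorm n = real l * rnorm q" using l by (simp add: rvec_smult)
    ultimately have eq: "\<bar>rvec q \<bullet> x - of_int p'\<bar> / rnorm q = \<bar>rvec n \<bullet> x - of_int p\<bar> / rnorm n"
      using l(1) by (simp add: abs_mult)
    have "R \<le> rnorm q"
    proof (rule ccontr)
      assume "\<not> R \<le> rnorm q"
      then have "q \<in> Q" using l n q0 by (auto simp: Q_def)
      then have "\<delta> \<le> dist_int (rvec q \<bullet> x) / rnorm q" by (rule \<delta>(2))
      also have "\<dots> \<le> \<bar>rvec q \<bullet> x - of_int p'\<bar> / rnorm q"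
        by (intro divide_right_mono dist_int_le) auto
      also have "\<dots> < \<delta>" unfolding eq using close norm_supp_ge_1[OF n]
        by (subst pos_divide_less_eq) auto
      finally show False by simp
    qed
    then show "reduces_beyond R x n p"
      unfolding reduces_beyond_def using l eq by blast
  qed
qed

text \<open>Reduce an extremal \<open>n\<close> to \<open>q\<close>. The hyperplane stays within
  O(|n|^(-\<tau>)) of \<open>x\<close>, and the jump across it is at least |a n|^(1+e) \<ge>
  |n|^(-(\<open>G\<close>+e)(1+e)), since \<open>n\<close> is one of the multiples of
  \<open>q\<close>. Smoothness of order \<alpha> bounds the jump by O(|n|^(-\<tau>\<alpha>)), which
  is impossible for \<tau> \<alpha> > \<open>G\<close>, small e and long \<open>n\<close>.\<close>

lemma holder_exponent_le:
  assumes \<tau>: "1 \<le> \<tau>" and K: "0 < K" and x: "\<forall>n\<in>supp a. rvec n \<bullet> x \<notin> \<int>"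
    and approx: "\<And>e R. 0 < e \<Longrightarrow> \<exists>n\<in>supp a. R \<le> rnorm n \<and> rnorm n powr - (G + e) \<le> norm (a n) \<and>
      (\<exists>p::int. \<bar>rvec n \<bullet> x - of_int p\<bar> \<le> K * rnorm n powr (1 - \<tau>))"
  shows "holder_exponent (davenport a) x \<le> ereal (G / \<tau>)"
  unfolding holder_exponent_def
proof (rule Sup_least, clarify)
  fix \<alpha> :: real assume \<alpha>0: "0 \<le> \<alpha>" and hol: "holder_at (davenport a) \<alpha> x"
  have "\<alpha> \<le> G / \<tau>"
  proof (rule ccontr)
    assume "\<not> \<alpha> \<le> G / \<tau>"
    then have big: "G < \<tau> * \<alpha>" using \<tau> by (simp add: field_simps)
    then have \<alpha>: "0 < \<alpha>" using G_pos \<alpha>0 by (cases "\<alpha> = 0") auto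
    obtain C R0 where CR: "0 < C" "0 < R0" "\<And>q p z r. reduced q p \<Longrightarrow> rvec q \<bullet> z = of_int p \<Longrightarrow> dist z x < r \<Longrightarrow>
        r < R0 \<Longrightarrow> norm (Asum a q) \<le> C * r powr \<alpha>"
      using holder_at_jump_bound[OF hol \<alpha>] by blast
    define gap where "gap = \<tau> * \<alpha> - G"
    \<comment> \<open>(\<open>G\<close> + e)(1 + e) = \<open>G\<close> + e (\<open>G\<close> + 1 +
      e) \<le> \<open>G\<close> + e (\<open>G\<close> + 2), so this choice leaves half of
      \<open>gap\<close> between that exponent and \<tau> \<alpha>.\<close>
    define e where "e = min 1 (gap / (2 * (G + 2)))"
    have e: "0 < e" "e \<le> 1" using big G_pos by (auto simp: e_def gap_def)
    have "e * (G + 2) \<le> gap / 2"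
    proof -
      have "e \<le> gap / (2 * (G + 2))" by (simp add: e_def)
      then show ?thesis using G_pos by (simp add: field_simps)
    qed
    moreover have "(G + e) * (1 + e) = G + e * (G + 1 + e)" by (simp add: algebra_simps)
    moreover have "e * (G + 1 + e) \<le> e * (G + 2)" using e by (intro mult_left_mono) auto
    ultimately have "(G + e) * (1 + e) \<le> G + gap / 2" by linarith
    moreover have "\<tau> * \<alpha> = G + gap" by (simp add: gap_def)
    ultimately have eg: "gap / 2 \<le> \<tau> * \<alpha> - (G + e) * (1 + e)" by linarith
    have gap: "0 < gap" using big by (simp add: gap_def)
    obtain R1 where R1: "\<And>q l. R1 \<le> rnorm q \<Longrightarrow> 1 \<le> l \<Longrightarrow> int l *s q \<in> supp a \<Longrightarrow>
        norm (a (int l *s q)) powr (1 + e) \<le> norm (Asum a q) \<and> Asum a q \<noteq> 0"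
      by (rule Asum_lower[OF e(1)]) blast
    obtain \<delta> where \<delta>: "0 < \<delta>" "\<forall>n\<in>supp a. \<forall>p::int. \<bar>rvec n \<bullet> x - of_int p\<bar> < \<delta> * rnorm n \<longrightarrow>
      reduces_beyond R1 x n p"
      using x by (rule reduced_large[of x R1])
    have t0: "((\<lambda>\<nu>::real. \<nu> powr - \<tau>) \<longlongrightarrow> 0) at_top"
      using \<tau> by (intro tendsto_neg_powr filterlim_ident) auto
    have "((\<lambda>\<nu>::real. 2 * K * \<nu> powr - \<tau>) \<longlongrightarrow> 2 * K * 0) at_top" by (intro tendsto_mult tendsto_const t0)
    then have "\<forall>\<^sub>F \<nu> in at_top. 2 * K * \<nu> powr - \<tau> < min R0 \<delta>"
      using CR(2) \<delta>(1) by (intro order_tendstoD(2)) auto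
    moreover have "((\<lambda>\<nu>::real. \<nu> powr - (gap / 2)) \<longlongrightarrow> 0) at_top"
      using gap by (intro tendsto_neg_powr filterlim_ident) auto
    then have "\<forall>\<^sub>F \<nu>::real in at_top. \<nu> powr - (gap / 2) < 1 / (C * (2 * K) powr \<alpha>)"
      using CR(1) K by (intro order_tendstoD(2)) auto
    ultimately have "\<forall>\<^sub>F \<nu> in at_top. 2 * K * \<nu> powr - \<tau> < min R0 \<delta> \<and> \<nu> powr - (gap / 2) < 1 / (C * (2 * K) powr \<alpha>)"
      by eventually_elim auto
    then obtain R where R: "\<And>\<nu>. R \<le> \<nu> \<Longrightarrow> 2 * K * \<nu> powr - \<tau> < min R0 \<delta>"
        "\<And>\<nu>. R \<le> \<nu> \<Longrightarrow> \<nu> powr - (gap / 2) < 1 / (C * (2 * K) powr \<alpha>)"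
      unfolding eventually_at_top_linorder by blast
    obtain n p where n: "n \<in> supp a" "R \<le> rnorm n" "rnorm n powr - (G + e) \<le> norm (a n)"
        "\<bar>rvec n \<bullet> x - of_int p\<bar> \<le> K * rnorm n powr (1 - \<tau>)"
      using approx[OF e(1), of R] by blast
    define \<nu> where "\<nu> = rnorm n"
    have \<nu>: "1 \<le> \<nu>" using norm_supp_ge_1[OF n(1)] by (simp add: \<nu>_def)
    define \<rho> where "\<rho> = K * \<nu> powr - \<tau>"
    have "0 < \<rho>" unfolding \<rho>_def using K \<nu> by (intro mult_pos_pos) auto
    then have \<rho>: "0 < \<rho>" "2 * \<rho> < R0" "2 * \<rho> < \<delta>" using R(1)[OF n(2)] by (auto simp: \<rho>_def \<nu>_def)
    have \<rho>\<nu>: "K * \<nu> powr (1 - \<tau>) = \<rho> * \<nu>" using \<nu> by (simp add: \<rho>_def powr_diff powr_minus field_simps)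
    have "\<rho> * \<nu> < \<delta> * \<nu>" using \<rho> \<nu> by (intro mult_strict_right_mono) auto
    then have "\<bar>rvec n \<bullet> x - of_int p\<bar> < \<delta> * rnorm n"
      using n(4) \<rho>\<nu> by (simp add: \<nu>_def)
    then obtain l q p' where q: "1 \<le> l" "n = int l *s q" "reduced q p'" "R1 \<le> rnorm q"
        "\<bar>rvec q \<bullet> x - of_int p'\<bar> / rnorm q = \<bar>rvec n \<bullet> x - of_int p\<bar> / rnorm n"
      using \<delta>(2) n(1) unfolding reduces_beyond_def by blast
    have q1: "1 \<le> rnorm q" using q(3) norm_rvec_ge_1 by (auto simp: reduced_def)
    \<comment> \<open>The orthogonal projection of \<open>x\<close> to the hyperplane. Its distance
      from \<open>x\<close> is at most \<rho>, and the radius 2 \<rho> makes the inequality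
      strict.\<close>
    define z where "z = x + ((of_int p' - rvec q \<bullet> x) / (rvec q \<bullet> rvec q)) *\<^sub>R rvec q"
    have qq: "rvec q \<bullet> rvec q = rnorm q * rnorm q"
      by (simp add: power2_norm_eq_inner[symmetric] power2_eq_square)
    have "rvec q \<bullet> z = of_int p'" using q1 by (simp add: z_def inner_add_right) auto
    moreover have "dist z x < 2 * \<rho>"
    proof -
      have "dist z x = \<bar>rvec q \<bullet> x - of_int p'\<bar> / rnorm q"
        using q1 by (simp add: z_def dist_norm qq abs_minus_commute)
      also have "\<dots> \<le> \<rho>" unfolding q(5) using n(4) \<rho>\<nu> \<nu> by (subst pos_divide_le_eq) (auto simp: \<nu>_def)
      finally show ?thesis using \<rho> by linarith
    qed
    ultimately have "norm (Asum a q) \<le> C * (2 * \<rho>) powr \<alpha>" using CR(3)[OF q(3)] \<rho> by blast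
    moreover have "norm (a n) powr (1 + e) \<le> norm (Asum a q)" using R1[OF q(4,1)] q(2) n(1) by blast
    moreover have "(\<nu> powr - (G + e)) powr (1 + e) \<le> norm (a n) powr (1 + e)"
      using n(3) e by (intro powr_mono2) (auto simp: \<nu>_def)
    ultimately have "(\<nu> powr - (G + e)) powr (1 + e) \<le> C * (2 * \<rho>) powr \<alpha>" by linarith
    also have "(\<nu> powr - (G + e)) powr (1 + e) = \<nu> powr (- ((G + e) * (1 + e)))"
      by (simp only: powr_powr mult_minus_left)
    also have "C * (2 * \<rho>) powr \<alpha> = C * (2 * K) powr \<alpha> * \<nu> powr (- (\<tau> * \<alpha>))"
    proof -
      have "2 * \<rho> = (2 * K) * \<nu> powr - \<tau>" by (simp add: \<rho>_def)
      then show ?thesis using K by (simp only: powr_mult powr_powr mult_minus_left mult.assoc)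
    qed
    finally have "\<nu> powr (- ((G + e) * (1 + e))) * \<nu> powr (\<tau> * \<alpha>) \<le> C * (2 * K) powr \<alpha> * \<nu> powr (- (\<tau> * \<alpha>)) * \<nu> powr (\<tau> * \<alpha>)"
      by (rule mult_right_mono) simp
    moreover have "\<nu> powr (- ((G + e) * (1 + e))) * \<nu> powr (\<tau> * \<alpha>) = \<nu> powr (\<tau> * \<alpha> - (G + e) * (1 + e))"
      by (simp add: powr_add[symmetric])
    moreover have "C * (2 * K) powr \<alpha> * \<nu> powr (- (\<tau> * \<alpha>)) * \<nu> powr (\<tau> * \<alpha>) = C * (2 * K) powr \<alpha>"
    proof -
      have "\<nu> powr (- (\<tau> * \<alpha>)) * \<nu> powr (\<tau> * \<alpha>) = 1" using \<nu> by (simp add: powr_add[symmetric])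
      then show ?thesis by (simp only: mult.assoc mult_1_right)
    qed
    moreover have "\<nu> powr (gap / 2) \<le> \<nu> powr (\<tau> * \<alpha> - (G + e) * (1 + e))" using eg \<nu> by (intro powr_mono) auto
    ultimately have "\<nu> powr (gap / 2) \<le> C * (2 * K) powr \<alpha>" by linarith
    moreover have "1 / \<nu> powr (gap / 2) < 1 / (C * (2 * K) powr \<alpha>)"
      using R(2)[OF n(2)] by (simp only: powr_minus_divide \<nu>_def)
    moreover have "0 < \<nu> powr (gap / 2)" using \<nu> by simp
    ultimately show False using frac_le[of 1 1 "\<nu> powr (gap / 2)" "C * (2 * K) powr \<alpha>"] by linarith
  qed
  then show "ereal \<alpha> \<le> ereal (G / \<tau>)" by simp
qed

text \<open>Here \<open>x\<close> itself lies on the hyperplane, so the jump bound applies with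
  every small radius and forces the jump to vanish unless \<alpha> = 0.\<close>

lemma holder_exponent_zero:
  assumes "reduced q p" "rvec q \<bullet> x = of_int p" "Asum a q \<noteq> 0"
  shows "holder_exponent (davenport a) x = 0"
proof (rule antisym[OF _ holder_exponent_nonneg])
  show "holder_exponent (davenport a) x \<le> 0"
    unfolding holder_exponent_def
  proof (rule Sup_least, clarify)
    fix \<alpha> :: real assume \<alpha>0: "0 \<le> \<alpha>" and hol: "holder_at (davenport a) \<alpha> x"
    have "\<alpha> = 0"
    proof (rule ccontr)
      assume "\<alpha> \<noteq> 0"
      then have \<alpha>: "0 < \<alpha>" using \<alpha>0 by simp
      obtain C R where CR: "0 < C" "0 < R" "\<And>q p z r. reduced q p \<Longrightarrow> rvec q \<bullet> z = of_int p \<Longrightarrow> dist z x < r \<Longrightarrow>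
          r < R \<Longrightarrow> norm (Asum a q) \<le> C * r powr \<alpha>"
        using holder_at_jump_bound[OF hol \<alpha>] by blast
      define A where "A = norm (Asum a q)"
      have A: "0 < A" using assms(3) by (simp add: A_def)
      define r where "r = min (R / 2) ((A / (2 * C)) powr (1 / \<alpha>))"
      have r: "0 < r" "r < R" using CR A by (auto simp: r_def)
      have "A \<le> C * r powr \<alpha>" unfolding A_def using CR(3)[OF assms(1,2)] r by simp
      also have "\<dots> \<le> C * ((A / (2 * C)) powr (1 / \<alpha>)) powr \<alpha>"
        using CR \<alpha> r by (intro mult_left_mono powr_mono2) (auto simp: r_def)
      also have "\<dots> = A / 2" using \<alpha> A CR(1) by (simp add: powr_powr)
      finally show False using A by simp
    qed
    then show "ereal \<alpha> \<le> 0" by simp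
  qed
qed

end


section \<open>Hausdorff measures of the level sets\<close>

lemma cbox_in_open_cart:
  fixes W :: "(real^'d) set"
  assumes "open W" "x \<in> W"
  obtains \<kappa> where "0 < \<kappa>" "\<And>y. (\<And>j. \<bar>y $ j - x $ j\<bar> \<le> \<kappa>) \<Longrightarrow> y \<in> W"
proof -
  obtain e where e: "0 < e" "ball x e \<subseteq> W" using assms by (auto simp: open_contains_ball)
  define \<kappa> where "\<kappa> = e / (2 * real CARD('d))"
  have cd: "0 < real CARD('d)" by simp
  have \<kappa>: "0 < \<kappa>" using e cd by (simp add: \<kappa>_def)
  have "y \<in> W" if y: "\<And>j. \<bar>y $ j - x $ j\<bar> \<le> \<kappa>" for y
  proof -
    have "norm (y - x) \<le> (\<Sum>j\<in>(UNIV::'d set). \<kappa>)"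
      by (rule order_trans[OF norm_le_l1_cart sum_mono]) (use y in simp)
    also have "\<dots> = e / 2" by (simp add: \<kappa>_def)
    finally have "y \<in> ball x e" using e by (simp add: dist_norm norm_minus_commute)
    then show ?thesis using e by blast
  qed
  with \<kappa> show thesis by (rule that)
qed

context sparse_davenport
begin

lemma bad_set_negligible:
  assumes "1 < \<tau>"
  shows "negligible (bad_set (supp a) \<tau>)"
proof (rule hausdorff_measure_DIM_0_imp_negligible)
  have "hausdorff_measure (real CARD('d) - 1 + 1) (bad_set (supp a) \<tau>) = 0"
    using assms supp_summable_powr[of "\<tau> - 1"] zero_notin_supp by (intro hausdorff_measure_bad_set) auto
  then show "hausdorff_measure (real DIM(real^'d)) (bad_set (supp a) \<tau>) = 0" by simp
qed

text \<open>For h < \<open>G\<close> choose \<alpha> slightly above h and \<tau> between max(1,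
  1/\<sigma>) and \<open>G\<close>/\<alpha>; a point outside the bad set would have exponent at
  least \<alpha>. For h = \<open>G\<close> no such \<tau> \<ge> 1 remains, but then \<sigma> > 1 and
  some \<tau> < 1 is admissible. For it the bad set is the whole space, because c |n|^(1-\<tau>)
  exceeds 1/2 for long \<open>n\<close>.\<close>

lemma level_set_subset_bad_set:
  assumes h: "0 \<le> h" "h \<le> G" and \<sigma>: "h / G < \<sigma>"
  obtains \<tau> where "0 \<le> \<tau>" "1 < \<tau> * \<sigma>" "level_set h \<subseteq> bad_set (supp a) \<tau>"
proof (cases "h = G")
  case True
  then have \<sigma>1: "1 < \<sigma>" using \<sigma> G_pos by simp
  define \<tau> where "\<tau> = (1 + 1 / \<sigma>) / 2"
  have \<tau>: "0 \<le> \<tau>" "\<tau> < 1" "1 < \<tau> * \<sigma>" using \<sigma>1 by (auto simp: \<tau>_def field_simps)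
  have "x \<in> bad_set (supp a) \<tau>" for x unfolding bad_set_def
  proof (clarify)
    fix c :: real assume c: "0 < c"
    obtain n where n: "n \<in> supp a" "(1 / c) powr (1 / (1 - \<tau>)) \<le> rnorm n"
      using coeff_lower[of "G + 1" "(1 / c) powr (1 / (1 - \<tau>))"] by auto
    have "1 / c = ((1 / c) powr (1 / (1 - \<tau>))) powr (1 - \<tau>)" using c \<tau> by (simp add: powr_powr)
    also have "\<dots> \<le> rnorm n powr (1 - \<tau>)" using n \<tau> by (intro powr_mono2) auto
    finally have "1 \<le> c * rnorm n powr (1 - \<tau>)" using c by (simp add: field_simps)
    then have "dist_int (rvec n \<bullet> x) < c * rnorm n powr (1 - \<tau>)"
      using dist_int_le_half[of "rvec n \<bullet> x"] by linarith
    then show "\<exists>n\<in>supp a. dist_int (rvec n \<bullet> x) < c * rnorm n powr (1 - \<tau>)" using n by blast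
  qed
  then show thesis using that \<tau> by blast
next
  case False
  then have hG: "h < G" using h by simp
  have hs: "h < \<sigma> * G" using \<sigma> G_pos by (simp add: field_simps)
  have "0 \<le> h / G" using h G_pos by simp
  then have \<sigma>0: "0 < \<sigma>" using \<sigma> by linarith
  have "h < min G (\<sigma> * G)" using hG hs by simp
  then obtain \<alpha> where "h < \<alpha>" "\<alpha> < min G (\<sigma> * G)" using dense by blast
  then have \<alpha>: "h < \<alpha>" "\<alpha> < G" "\<alpha> < \<sigma> * G" "0 < \<alpha>" using h by auto
  have "max 1 (1 / \<sigma>) < G / \<alpha>" using \<alpha> \<sigma>0 by (auto simp: field_simps)
  then obtain \<tau> where "max 1 (1 / \<sigma>) < \<tau>" "\<tau> < G / \<alpha>" using dense by blast
  then have \<tau>: "1 \<le> \<tau>" "1 / \<sigma> < \<tau>" "\<tau> < G / \<alpha>" by auto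
  have \<tau>2: "1 < \<tau> * \<sigma>" "\<tau> * \<alpha> < G" using \<tau> \<alpha> \<sigma>0 by (auto simp: field_simps)
  have "x \<in> bad_set (supp a) \<tau>" if x: "holder_exponent (davenport a) x = ereal h" for x
  proof (rule ccontr)
    assume "x \<notin> bad_set (supp a) \<tau>"
    then have "holder_at (davenport a) \<alpha> x" using \<alpha> \<tau> \<tau>2 by (intro holder_at_if_not_bad) auto
    then have "ereal \<alpha> \<le> ereal h" using holder_at_le_exponent[of \<alpha> x] \<alpha> x by simp
    then show False using \<alpha> by simp
  qed
  then show thesis using that[of \<tau>] \<tau> \<tau>2 by auto
qed

lemma hausdorff_measure_level_set_upper:
  assumes h: "0 \<le> h" "h \<le> G" and s: "real CARD('d) - 1 + h / G < s"
  shows "hausdorff_measure s (level_set h) = 0"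
proof -
  define \<sigma> where "\<sigma> = s - (real CARD('d) - 1)"
  have "h / G < \<sigma>" using s by (simp add: \<sigma>_def)
  then obtain \<tau> where \<tau>: "0 \<le> \<tau>" "1 < \<tau> * \<sigma>" "level_set h \<subseteq> bad_set (supp a) \<tau>"
    using level_set_subset_bad_set[OF h] by blast
  have "0 \<le> h / G" using h G_pos by simp
  then have "0 < \<sigma>" using \<open>h / G < \<sigma>\<close> by linarith
  then have "hausdorff_measure (real CARD('d) - 1 + \<sigma>) (bad_set (supp a) \<tau>) = 0"
    using \<tau> supp_summable_powr[of "\<tau> * \<sigma> - 1"] zero_notin_supp by (intro hausdorff_measure_bad_set) auto
  then have "hausdorff_measure s (bad_set (supp a) \<tau>) = 0" by (simp add: \<sigma>_def)
  then show ?thesis using \<tau>(3) by (rule hausdorff_measure_0_mono)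
qed

text \<open>The exponent vanishes on a whole hyperplane with nonzero jump, and a long support vector
  has one close to any given point. Slicing with \<sigma> = 0 only asks that each slice be nonempty,
  since every covering set then counts as 1. The point \<open>x0\<close> avoids all hyperplanes of
  the support so that \<open>reduced_large\<close> applies.\<close>

lemma hausdorff_measure_level_set_0:
  assumes W: "open W" "W \<noteq> {}" and s: "0 \<le> s" "s \<le> real CARD('d) - 1"
  shows "hausdorff_measure s (level_set 0 \<inter> W) \<noteq> 0"
proof -
  define D where "D = real CARD('d)"
  have D: "1 \<le> D" by (simp add: D_def Suc_leI)
  have "\<not> W \<subseteq> bad_set (supp a) 2"
    using negligible_subset[OF bad_set_negligible[of 2]] open_not_negligible[OF W] by auto
  then obtain x0 where x0: "x0 \<in> W" "x0 \<notin> bad_set (supp a) 2" by blast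
  obtain \<rho> where \<rho>: "0 < \<rho>" "\<And>y. (\<And>j. \<bar>y $ j - x0 $ j\<bar> \<le> \<rho>) \<Longrightarrow> y \<in> W"
    using cbox_in_open_cart[OF W(1) x0(1)] by blast
  obtain R1 where R1: "\<And>q l. R1 \<le> rnorm q \<Longrightarrow> 1 \<le> l \<Longrightarrow> int l *s q \<in> supp a \<Longrightarrow>
      norm (a (int l *s q)) powr (1 + 1) \<le> norm (Asum a q) \<and> Asum a q \<noteq> 0"
    by (rule Asum_lower[of 1]) auto
  obtain \<delta> where \<delta>: "0 < \<delta>" "\<forall>n\<in>supp a. \<forall>p::int. \<bar>rvec n \<bullet> x0 - of_int p\<bar> < \<delta> * rnorm n \<longrightarrow>
      reduces_beyond R1 x0 n p"
    using not_bad_imp_notin_Ints[OF x0(2)] reduced_large[of x0 R1] by blast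
  obtain n where n: "n \<in> supp a" "max (1 / \<delta>) (2 * D / \<rho>) \<le> rnorm n"
    using coeff_lower[of "G + 1" "max (1 / \<delta>) (2 * D / \<rho>)"] by auto
  define \<nu> where "\<nu> = rnorm n"
  have \<nu>: "1 \<le> \<nu>" "1 \<le> \<delta> * \<nu>" "2 * D \<le> \<rho> * \<nu>"
    using norm_supp_ge_1[OF n(1)] n(2) \<delta>(1) \<rho>(1) by (auto simp: \<nu>_def field_simps)
  define p where "p = round (rvec n \<bullet> x0)"
  have p: "\<bar>rvec n \<bullet> x0 - of_int p\<bar> \<le> 1/2"
    using dist_int_le_half[of "rvec n \<bullet> x0"] by (simp add: p_def dist_int_def)
  then have "\<bar>rvec n \<bullet> x0 - of_int p\<bar> < \<delta> * rnorm n" using \<nu>(2) by (simp add: \<nu>_def)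
  then obtain l q p' where q: "1 \<le> l" "n = int l *s q" "reduced q p'" "R1 \<le> rnorm q"
      "\<bar>rvec q \<bullet> x0 - of_int p'\<bar> / rnorm q = \<bar>rvec n \<bullet> x0 - of_int p\<bar> / rnorm n"
    using \<delta>(2) n(1) unfolding reduces_beyond_def by blast
  have A: "Asum a q \<noteq> 0" using R1[OF q(4,1)] q(2) n(1) by blast
  define \<mu> where "\<mu> = rnorm q"
  have \<mu>: "1 \<le> \<mu>" unfolding \<mu>_def using q(3) norm_rvec_ge_1 by (auto simp: reduced_def)
  obtain i where i: "\<mu> \<le> D * \<bar>rvec q $ i\<bar>" unfolding \<mu>_def D_def by (metis exists_dominant_coordinate)
  then have qi: "0 < \<bar>rvec q $ i\<bar>" using \<mu> D by (cases "rvec q $ i = 0") auto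
  \<comment> \<open>A line through a point of the box meets the hyperplane at a coordinate
    \<open>i\<close> that differs from that of \<open>x0\<close> by at most \<kappa> + D D \<kappa>
    + \<rho>/2: the first two terms come from the box, the last from the distance of
    \<open>x0\<close> to the hyperplane. The choice of \<kappa> makes the total \<rho>.\<close>
  define E where "E = 1 + D * D"
  have E: "0 < E" using D by (simp add: E_def add_pos_pos)
  define \<kappa> where "\<kappa> = \<rho> / (2 * E)"
  have \<kappa>: "0 < \<kappa>" "\<kappa> * E = \<rho> / 2" using \<rho>(1) E by (auto simp: \<kappa>_def)
  have \<kappa>D: "\<kappa> + D * D * \<kappa> = \<rho> / 2" using \<kappa>(2) by (simp add: E_def algebra_simps)
  have \<kappa>\<rho>: "\<kappa> \<le> \<rho>"
  proof -
    have "0 \<le> D * D * \<kappa>" using \<kappa>(1) D by simp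
    then show ?thesis using \<kappa>D \<rho>(1) by linarith
  qed
  define lo hi where "lo = (\<chi> j. x0 $ j - \<kappa>)" and "hi = (\<chi> j. x0 $ j + \<kappa>)"
  have hit: "\<exists>t. vec_upd i t y \<in> level_set 0 \<inter> W" if y: "y \<in> cbox lo hi" for y
  proof -
    have yk: "\<bar>y $ j - x0 $ j\<bar> \<le> \<kappa>" for j
      using y by (auto simp: lo_def hi_def mem_box_cart abs_le_iff algebra_simps)
    define t where "t = y $ i + (of_int p' - rvec q \<bullet> y) / rvec q $ i"
    have on: "rvec q \<bullet> vec_upd i t y = of_int p'"
      unfolding inner_vec_upd t_def using qi by simp
    have "norm (y - x0) \<le> (\<Sum>j\<in>(UNIV::'d set). \<kappa>)"
      by (rule order_trans[OF norm_le_l1_cart sum_mono]) (use yk in simp)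
    then have nyx: "norm (y - x0) \<le> D * \<kappa>" by (simp add: D_def)
    have "\<bar>rvec q \<bullet> (y - x0)\<bar> \<le> \<mu> * (D * \<kappa>)"
      unfolding \<mu>_def by (rule order_trans[OF Cauchy_Schwarz_ineq2 mult_left_mono[OF nyx]]) simp
    moreover have "\<bar>rvec q \<bullet> x0 - of_int p'\<bar> \<le> \<mu> * (\<rho> / (2 * D))"
    proof -
      have "\<bar>rvec q \<bullet> x0 - of_int p'\<bar> / \<mu> \<le> 1 / \<nu>"
        unfolding \<mu>_def q(5) \<nu>_def using p by (intro divide_right_mono) auto
      also have "\<dots> \<le> \<rho> / (2 * D)" using \<nu> D by (simp add: field_simps)
      finally show ?thesis using \<mu> by (simp add: pos_divide_le_eq mult.commute)
    qed
    ultimately have "\<bar>of_int p' - rvec q \<bullet> y\<bar> \<le> \<mu> * (\<rho> / (2 * D)) + \<mu> * (D * \<kappa>)"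
      by (simp add: inner_diff_right)
    also have "\<dots> = \<mu> * (\<rho> / (2 * D) + D * \<kappa>)" by (simp add: algebra_simps)
    also have "\<dots> \<le> D * \<bar>rvec q $ i\<bar> * (\<rho> / (2 * D) + D * \<kappa>)"
      using i \<rho>(1) D \<kappa>(1) by (intro mult_right_mono) auto
    also have "\<dots> = \<bar>rvec q $ i\<bar> * (\<rho> / 2 + D * D * \<kappa>)" using D by (simp add: field_simps)
    finally have "\<bar>(of_int p' - rvec q \<bullet> y) / rvec q $ i\<bar> \<le> \<rho> / 2 + D * D * \<kappa>"
      using qi unfolding abs_divide by (subst pos_divide_le_eq) (auto simp: mult.commute)
    then have "\<bar>t - x0 $ i\<bar> \<le> \<rho>" using yk[of i] \<kappa>D unfolding t_def by linarith
    moreover have "\<bar>y $ j - x0 $ j\<bar> \<le> \<rho>" for j using yk[of j] \<kappa>\<rho> by linarith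
    ultimately have "vec_upd i t y \<in> W" by (intro \<rho>(2)) auto
    moreover have "holder_exponent (davenport a) (vec_upd i t y) = ereal 0"
      using holder_exponent_zero[OF q(3) on A] by (simp add: zero_ereal_def)
    ultimately show ?thesis by blast
  qed
  show ?thesis
  proof (rule hausdorff_measure_slicing[where \<sigma>=0 and c=1 and lo=lo and hi=hi and Z="{}" and i=i])
    fix y and J :: "nat set" and V and r :: "nat \<Rightarrow> real"
    assume y: "y \<in> cbox lo hi - {}"
      and cov: "{t. vec_upd i t y \<in> level_set 0 \<inter> W} \<subseteq> (\<Union>j\<in>J. V j)"
    then obtain j where j: "j \<in> J" using hit[of y] by blast
    have "ennreal 1 = (\<Sum>k\<in>{j}. if k \<in> J then ennreal (rpow (r k) 0) else 0)" using j by (simp add: rpow_def)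
    also have "\<dots> \<le> (\<Sum>k. if k \<in> J then ennreal (rpow (r k) 0) else 0)" by (rule sum_le_suminf) auto
    finally show "ennreal 1 \<le> (\<Sum>k. if k \<in> J then ennreal (rpow (r k) 0) else 0)" .
  qed (use s \<kappa> in \<open>auto simp: lo_def hi_def\<close>)
qed

text \<open>The slicing direction must serve all tolerances and all radii at once. If every
  coordinate failed for some tolerance and radius, an extremal vector for the smallest tolerance and
  the largest radius would have no dominant coordinate.\<close>

lemma dominant_direction:
  obtains i :: 'd where "\<And>e R. 0 < e \<Longrightarrow> \<exists>n\<in>supp a. R \<le> rnorm n \<and> rnorm n powr - (G + e) \<le> norm (a n) \<and>
    rnorm n \<le> real CARD('d) * \<bar>rvec n $ i\<bar>"
proof (rule ccontr)
  assume "\<not> thesis"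
  then have "\<forall>i. \<exists>e R. 0 < e \<and> \<not> (\<exists>n\<in>supp a. R \<le> rnorm n \<and> rnorm n powr - (G + e) \<le> norm (a n) \<and>
    rnorm n \<le> real CARD('d) * \<bar>rvec n $ i\<bar>)"
    using that by metis
  then obtain e R where eR: "\<And>i. 0 < e i" "\<And>i. \<not> (\<exists>n\<in>supp a. R i \<le> rnorm n \<and> rnorm n powr - (G + e i) \<le> norm (a n) \<and>
    rnorm n \<le> real CARD('d) * \<bar>rvec n $ i\<bar>)"
    by metis
  define e0 where "e0 = Min (range e)"
  define R0 where "R0 = Max (range R)"
  have e0: "0 < e0" "e0 \<le> e i" and R0: "R i \<le> R0" for i using eR(1) by (auto simp: e0_def R0_def)
  obtain n where n: "n \<in> supp a" "R0 \<le> rnorm n" "rnorm n powr - (G + e0) \<le> norm (a n)"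
    using coeff_lower[of "G + e0" R0] e0(1) by auto
  obtain i where i: "rnorm n \<le> real CARD('d) * \<bar>rvec n $ i\<bar>" by (metis exists_dominant_coordinate)
  have "rnorm n powr - (G + e i) \<le> rnorm n powr - (G + e0)"
    using e0(2)[of i] norm_supp_ge_1[OF n(1)] by (intro powr_mono) auto
  then have "rnorm n powr - (G + e i) \<le> norm (a n)" using n(3) by linarith
  moreover have "R i \<le> rnorm n" using R0[of i] n(2) by linarith
  ultimately show False using eR(2)[of i] n(1) i by blast
qed


text \<open>On almost every line in direction \<open>i\<close>, almost all parameters of a Cantor
  set give points with exponent exactly h. A cover of the slice pulls back to a cover of almost all
  of the unit interval, which bounds the sum of its powers from below.\<close>

lemma hausdorff_measure_level_set_pos:
  assumes W: "open W" "W \<noteq> {}" and h: "0 < h" "h \<le> G"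
    and s: "0 \<le> s" "s < real CARD('d) - 1 + h / G"
  shows "hausdorff_measure s (level_set h \<inter> W) \<noteq> 0"
proof -
  define D where "D = real CARD('d)"
  have D: "1 \<le> D" by (simp add: D_def Suc_leI)
  define \<tau> where "\<tau> = G / h"
  have \<tau>: "1 \<le> \<tau>" using h by (simp add: \<tau>_def)
  have \<tau>inv: "1 / \<tau> = h / G" by (simp add: \<tau>_def)
  \<comment> \<open>\<open>s\<close> may be less than D - 1; the second entry keeps \<sigma>
    positive in that case.\<close>
  define \<sigma> where "\<sigma> = max (s - (D - 1)) (h / G / 2)"
  have hG: "0 < h / G" "h / G \<le> 1" using h G_pos by auto
  have \<sigma>: "0 < \<sigma>" "\<sigma> < 1 / \<tau>" "s \<le> D - 1 + \<sigma>"
    using hG s by (auto simp: \<sigma>_def \<tau>inv D_def)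
  obtain x0 where x0: "x0 \<in> W" using W by blast
  obtain \<kappa> where \<kappa>: "0 < \<kappa>" "\<And>y. (\<And>j. \<bar>y $ j - x0 $ j\<bar> \<le> \<kappa>) \<Longrightarrow> y \<in> W"
    using cbox_in_open_cart[OF W(1) x0] by blast
  define lo hi where "lo = (\<chi> j. x0 $ j - \<kappa>)" and "hi = (\<chi> j. x0 $ j + \<kappa>)"
  have boxW: "cbox lo hi \<subseteq> W"
  proof
    fix y assume "y \<in> cbox lo hi"
    then have "\<bar>y $ j - x0 $ j\<bar> \<le> \<kappa>" for j
      by (auto simp: lo_def hi_def mem_box_cart abs_le_iff algebra_simps)
    then show "y \<in> W" by (rule \<kappa>(2))
  qed
  obtain i :: 'd where i: "\<And>e R. 0 < e \<Longrightarrow> \<exists>n\<in>supp a. R \<le> rnorm n \<and> rnorm n powr - (G + e) \<le> norm (a n) \<and>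
      rnorm n \<le> D * \<bar>rvec n $ i\<bar>"
    using dominant_direction unfolding D_def by blast
  have "\<forall>j::nat. \<exists>n. n \<in> supp a \<and> real j + 1 \<le> rnorm n \<and> rnorm n powr - (G + 1 / real (Suc j)) \<le> norm (a n) \<and>
      rnorm n \<le> D * \<bar>rvec n $ i\<bar>"
  proof
    fix j :: nat
    have "0 < 1 / real (Suc j)" by simp
    from i[OF this, of "real j + 1"] show "\<exists>n. n \<in> supp a \<and> real j + 1 \<le> rnorm n \<and>
        rnorm n powr - (G + 1 / real (Suc j)) \<le> norm (a n) \<and> rnorm n \<le> D * \<bar>rvec n $ i\<bar>" by blast
  qed
  then obtain m where m: "\<And>j. m j \<in> supp a" "\<And>j. real j + 1 \<le> rnorm (m j)"
      "\<And>j. rnorm (m j) powr - (G + 1 / real (Suc j)) \<le> norm (a (m j))"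
      "\<And>j. rnorm (m j) \<le> D * \<bar>rvec (m j) $ i\<bar>"
    by metis
  define A where "A j = nat \<bar>m j $ i\<bar>" for j
  have A: "real (A j) = \<bar>rvec (m j) $ i\<bar>" for j by (simp add: A_def)
  have unb: "\<exists>j. B \<le> real (A j)" for B :: real
  proof -
    obtain j :: nat where "D * B \<le> real j" using real_arch_simple by blast
    then have "D * B \<le> D * real (A j)" using m(2,4)[of j] by (simp add: A)
    then have "B \<le> real (A j)" using D by simp
    then show ?thesis ..
  qed
  have lohi: "lo $ i < hi $ i" using \<kappa>(1) by (simp add: lo_def hi_def)
  \<comment> \<open>The scales \<open>r\<close> and the constants \<open>C\<close> are fixed before
    the slice \<open>y\<close>. Only \<open>g\<close> depends on \<open>y\<close>, through the
    offsets, so the slice estimate holds with one constant.\<close>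
  obtain r C where r: "\<And>k. real k + 1 \<le> real (A (r k))" and C: "\<And>\<sigma>. 0 < C \<sigma>"
    and maps: "\<And>off :: nat \<Rightarrow> real. \<exists>g. cantor_param \<tau> (lo $ i) (hi $ i) (\<lambda>k. A (r k)) off C g"
    by (rule cantor_map[OF \<tau> lohi unb]) blast
  \<comment> \<open>For \<open>n\<close> with \<open>n $ i = 0\<close> the product with
    \<open>n\<close> is constant along the line, so good behaviour there must already hold at
    \<open>y\<close>. Almost every \<open>y\<close> is approximated to no order above 1.\<close>
  define Z where "Z = (\<Union>j::nat. bad_set (supp a) (1 + 1 / real (Suc j)))"
  have Z: "negligible Z" unfolding Z_def
    by (rule negligible_countable_Union) (auto intro!: bad_set_negligible)
  define E where "E = level_set h \<inter> W"
  have "hausdorff_measure s E \<noteq> 0"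
  proof (rule hausdorff_measure_slicing[where \<sigma>=\<sigma> and c="1 / (2 * C \<sigma>)" and lo=lo and hi=hi and Z=Z and i=i])
    fix y and J :: "nat set" and V and rr :: "nat \<Rightarrow> real"
    assume y: "y \<in> cbox lo hi - Z"
      and rr: "\<And>j. j \<in> J \<Longrightarrow> 0 \<le> rr j"
      and V: "\<And>j t t'. j \<in> J \<Longrightarrow> t \<in> V j \<Longrightarrow> t' \<in> V j \<Longrightarrow> \<bar>t - t'\<bar> \<le> rr j"
      and cov: "{t. vec_upd i t y \<in> E} \<subseteq> (\<Union>j\<in>J. V j)"
    define w where "w n = rvec n \<bullet> vec_upd i 0 y" for n
    \<comment> \<open>The grids have positive scale |\<open>n $ i\<close>|. Multiplying by the sign
      of \<open>n $ i\<close> turns n \<bullet> X into the form N t + off.\<close>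
    define off where "off k = sgn (rvec (m (r k)) $ i) * w (m (r k))" for k
    obtain g where g: "\<And>\<omega>. \<omega> \<in> {0..<1} \<Longrightarrow> g \<omega> \<in> {lo $ i..hi $ i}"
        "\<And>\<omega> k. \<omega> \<in> {0..<1} \<Longrightarrow> \<exists>p::int. \<bar>g \<omega> - (of_int p - off k) / real (A (r k))\<bar> \<le> real (A (r k)) powr - \<tau>"
        "\<And>\<sigma> \<omega> \<omega>'. 0 < \<sigma> \<Longrightarrow> \<sigma> < 1 / \<tau> \<Longrightarrow> \<omega> \<in> {0..<1} \<Longrightarrow> \<omega>' \<in> {0..<1} \<Longrightarrow> \<bar>\<omega> - \<omega>'\<bar> \<le> C \<sigma> * \<bar>g \<omega> - g \<omega>'\<bar> powr \<sigma>"
      using maps[of off] unfolding cantor_param_def by blast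
    have inner: "rvec n \<bullet> vec_upd i t y = real_of_int (n $ i) * t + w n" for n t
      by (simp add: w_def inner_vec_upd algebra_simps)
    define Bad where "Bad j = {\<omega>\<in>{0..<1}. \<forall>c>0. \<exists>n\<in>supp a. n $ i \<noteq> 0 \<and>
        dist_int (real_of_int (n $ i) * g \<omega> + w n) < c * rnorm n powr (1 - (\<tau> + 1 / real (Suc j)))}" for j :: nat
    have "negligible (Bad j)" for j
    proof -
      define \<tau>' where "\<tau>' = \<tau> + 1 / real (Suc j)"
      have \<tau>': "\<tau> < \<tau>'" "1 \<le> \<tau>'" using \<tau> by (auto simp: \<tau>'_def add_increasing2)
      have inv: "0 < 1 / \<tau>'" "1 / \<tau>' < 1 / \<tau>" "1 / \<tau> \<le> 1" using \<tau> \<tau>' by (auto simp: frac_less2)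
      \<comment> \<open>Below 1/\<tau>, so that the inverse of \<open>g\<close> is Hoelder of this
        order; above 1/\<tau>', so that the series for the order \<tau>' converges.\<close>
      obtain \<sigma>' where \<sigma>1: "1 / \<tau>' < \<sigma>'" "\<sigma>' < 1 / \<tau>" using dense[OF inv(2)] by blast
      have "0 < \<sigma>'" using inv(1) \<sigma>1(1) by (rule less_trans)
      moreover have "\<sigma>' \<le> 1" using \<sigma>1(2) inv(3) by linarith
      ultimately have \<sigma>': "0 < \<sigma>'" "1 / \<tau>' < \<sigma>'" "\<sigma>' < 1 / \<tau>" "\<sigma>' \<le> 1" using \<sigma>1 by auto
      have "1 < \<tau>' * \<sigma>'" using \<sigma>'(2) \<tau>' by (simp add: field_simps)
      then have summ: "(\<lambda>n. rnorm n powr (1 - \<tau>' * \<sigma>')) summable_on supp a"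
        using supp_summable_powr[of "\<tau>' * \<sigma>' - 1"] by simp
      have "hausdorff_measure 1 (Bad j) = 0"
        unfolding Bad_def \<tau>'_def[symmetric]
      proof (rule hausdorff_measure_bad_parameters[OF _ _ C \<sigma>'(1,4) \<tau>'(2) summ])
        show "g \<omega> \<in> {lo $ i..hi $ i}" if "\<omega> \<in> {0..<1}" for \<omega> by (rule g(1)[OF that])
        show "\<bar>\<omega> - \<omega>'\<bar> \<le> C \<sigma>' * \<bar>g \<omega> - g \<omega>'\<bar> powr \<sigma>'" if "\<omega> \<in> {0..<1}" "\<omega>' \<in> {0..<1}" for \<omega> \<omega>'
          by (rule g(3)[OF \<sigma>'(1,3) that])
      qed
      then show ?thesis by (intro hausdorff_measure_DIM_0_imp_negligible) simp
    qed
    then have neg: "negligible (\<Union>j. Bad j)" by (intro negligible_countable_Union) auto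
    have good: "vec_upd i (g \<omega>) y \<in> E" if om: "\<omega> \<in> {0..<1} - (\<Union>j. Bad j)" for \<omega>
    proof -
      define X where "X = vec_upd i (g \<omega>) y"
      have om1: "\<omega> \<in> {0..<1}" using om by blast
      have notbad: "X \<notin> bad_set (supp a) (\<tau> + \<epsilon>)" if \<epsilon>: "0 < \<epsilon>" for \<epsilon>
      proof -
        obtain j :: nat where j: "1 / \<epsilon> \<le> real (Suc j)"
          using real_arch_simple[of "1 / \<epsilon>"] by (metis le_SucI of_nat_le_iff order_trans order_refl)
        then have j\<epsilon>: "1 / real (Suc j) \<le> \<epsilon>" using \<epsilon> by (simp add: field_simps)
        have "\<omega> \<notin> Bad j" using om by blast
        then obtain c1 where c1: "0 < c1" "\<And>n. n \<in> supp a \<Longrightarrow> n $ i \<noteq> 0 \<Longrightarrow>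
            c1 * rnorm n powr (1 - (\<tau> + 1 / real (Suc j))) \<le> dist_int (rvec n \<bullet> X)"
          using om1 by (auto simp: Bad_def not_less X_def inner)
        have "y \<notin> bad_set (supp a) (1 + 1 / real (Suc j))" using y by (auto simp: Z_def)
        then obtain c2 where c2: "0 < c2" "\<And>n. n \<in> supp a \<Longrightarrow>
            c2 * rnorm n powr (1 - (1 + 1 / real (Suc j))) \<le> dist_int (rvec n \<bullet> y)"
          by (auto simp: bad_set_def not_less)
        define c where "c = min c1 c2"
        have c: "0 < c" "c \<le> c1" "c \<le> c2" using c1(1) c2(1) by (auto simp: c_def)
        have "c * rnorm n powr (1 - (\<tau> + \<epsilon>)) \<le> dist_int (rvec n \<bullet> X)" if n: "n \<in> supp a" for n
        proof (cases "n $ i = 0")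
          case True
          have "dist_int (rvec n \<bullet> X) = dist_int (rvec n \<bullet> y)" using True by (simp add: X_def inner_vec_upd)
          moreover have "c * rnorm n powr (1 - (\<tau> + \<epsilon>)) \<le> c2 * rnorm n powr (1 - (1 + 1 / real (Suc j)))"
            using c j\<epsilon> \<tau> norm_supp_ge_1[OF n] by (intro mult_mono powr_mono) auto
          ultimately show ?thesis using c2(2)[OF n] by linarith
        next
          case False
          have "c * rnorm n powr (1 - (\<tau> + \<epsilon>)) \<le> c1 * rnorm n powr (1 - (\<tau> + 1 / real (Suc j)))"
            using c j\<epsilon> norm_supp_ge_1[OF n] by (intro mult_mono powr_mono) auto
          then show ?thesis using c1(2)[OF n False] by linarith
        qed
        then show ?thesis using c(1) by (force simp: bad_set_def not_less)
      qed
      have ge: "ereal h \<le> holder_exponent (davenport a) X"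
        using notbad by (intro holder_exponent_ge h) (simp add: \<tau>_def)
      have notint: "\<forall>n\<in>supp a. rvec n \<bullet> X \<notin> \<int>" using not_bad_imp_notin_Ints[OF notbad[OF zero_less_one]] by blast
      have le: "holder_exponent (davenport a) X \<le> ereal (G / \<tau>)"
      proof (rule holder_exponent_le[OF \<tau> _ notint])
        \<comment> \<open>The Cantor set controls powers of |\<open>n $ i\<close>|, whereas the
          exponent bound is stated in |n|. As |\<open>n $ i\<close>| \<ge> |n| / D and 1 - \<tau>
          \<le> 0, the comparison costs this factor.\<close>
        show "0 < D powr (\<tau> - 1)" using D by simp
        fix e R :: real assume e: "0 < e"
        obtain j0 :: nat where j0: "1 / e \<le> real j0" using real_arch_simple by blast
        obtain k0 :: nat where k0: "R \<le> real k0" using real_arch_simple by blast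
        \<comment> \<open>The scales \<open>r\<close> need not increase. Since A (r k) exceeds
          \<open>k\<close>, adding this sum to \<open>k\<close> rules out all indices
          \<open>r k\<close> below \<open>j0\<close>.\<close>
        define k where "k = k0 + (\<Sum>j<j0. A j)"
        have rk: "j0 \<le> r k"
        proof (rule ccontr)
          assume "\<not> j0 \<le> r k"
          then have "A (r k) \<le> (\<Sum>j<j0. A j)" by (intro member_le_sum) auto
          then have "A (r k) \<le> k" by (simp add: k_def)
          then have "real (A (r k)) \<le> real k" by (simp only: of_nat_le_iff)
          then show False using r[of k] by linarith
        qed
        define n where "n = m (r k)"
        define N where "N = real (A (r k))"
        have "real k0 \<le> real k" by (simp add: k_def del: of_nat_add of_nat_sum)
        then have N1: "1 \<le> N" "R \<le> N" using r[of k] k0 by (auto simp: N_def)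
        have Nn: "N = \<bar>rvec n $ i\<bar>" by (simp add: N_def A n_def)
        have N\<nu>: "N \<le> rnorm n" unfolding Nn by (rule component_le_norm_cart)
        have n: "n \<in> supp a" by (simp add: n_def m)
        have "real j0 \<le> real (Suc (r k))" using rk by simp
        then have "1 / e \<le> real (Suc (r k))" using j0 by (rule order_trans[rotated])
        then have "1 / real (Suc (r k)) \<le> e" using e by (simp add: field_simps)
        then have "rnorm n powr - (G + e) \<le> rnorm n powr - (G + 1 / real (Suc (r k)))"
          using norm_supp_ge_1[OF n] by (intro powr_mono) auto
        then have an: "rnorm n powr - (G + e) \<le> norm (a n)" using m(3)[of "r k"] by (simp add: n_def)
        obtain p :: int where p: "\<bar>g \<omega> - (of_int p - off k) / N\<bar> \<le> N powr - \<tau>"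
          using g(2)[OF om1, of k] by (auto simp: N_def)
        define sg where "sg = sgn (n $ i)"
        have ni: "n $ i \<noteq> 0" using N1 Nn by auto
        have sg: "real_of_int (n $ i) = real_of_int sg * N" "real_of_int sg * real_of_int sg = 1" "\<bar>real_of_int sg\<bar> = 1"
          using ni by (auto simp: sg_def Nn sgn_if)
        have offk: "off k = real_of_int sg * w n" using ni by (auto simp: off_def n_def sg_def sgn_if)
        have "rvec n \<bullet> X - of_int (sg * p) = real_of_int sg * (N * (g \<omega> - (of_int p - off k) / N))"
        proof -
          have cancel: "N * (t - t' / N) = N * t - t'" for t t'
            using N1 by (simp add: right_diff_distrib)
          have "real_of_int sg * (N * (g \<omega> - (of_int p - off k) / N)) =
              (real_of_int sg * N) * g \<omega> - real_of_int sg * of_int p + (real_of_int sg * real_of_int sg) * w n"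
            unfolding cancel offk by (simp add: algebra_simps)
          then show ?thesis unfolding X_def inner sg(1) sg(2) by simp
        qed
        then have "\<bar>rvec n \<bullet> X - of_int (sg * p)\<bar> = N * \<bar>g \<omega> - (of_int p - off k) / N\<bar>"
          using N1 sg(3) by (simp add: abs_mult)
        also have "\<dots> \<le> N * N powr - \<tau>" using p N1 by (intro mult_left_mono) auto
        also have "\<dots> = N powr (1 - \<tau>)" using N1 by (simp add: powr_diff powr_minus divide_inverse)
        also have "\<dots> \<le> (rnorm n / D) powr (1 - \<tau>)"
        proof (rule powr_mono2')
          show "rnorm n / D \<le> N" using m(4)[of "r k"] D by (simp add: Nn n_def field_simps)
          show "0 < rnorm n / D" using D norm_supp_ge_1[OF n] by (intro divide_pos_pos) auto
        qed (use \<tau> in auto)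
        also have "\<dots> = D powr (\<tau> - 1) * rnorm n powr (1 - \<tau>)"
          using D by (simp add: powr_divide powr_diff field_simps)
        finally have "\<bar>rvec n \<bullet> X - of_int (sg * p)\<bar> \<le> D powr (\<tau> - 1) * rnorm n powr (1 - \<tau>)" .
        moreover have "R \<le> rnorm n" using N1 N\<nu> by linarith
        ultimately show "\<exists>n\<in>supp a. R \<le> rnorm n \<and> rnorm n powr - (G + e) \<le> norm (a n) \<and>
            (\<exists>p::int. \<bar>rvec n \<bullet> X - of_int p\<bar> \<le> D powr (\<tau> - 1) * rnorm n powr (1 - \<tau>))"
          using n an by blast
      qed
      have "holder_exponent (davenport a) X = ereal h"
        using ge le h G_pos by (simp add: \<tau>_def)
      moreover have "X \<in> cbox lo hi" using y g(1)[OF om1] by (auto simp: X_def mem_box_cart)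
      ultimately show ?thesis using boxW by (auto simp: E_def X_def)
    qed
    \<comment> \<open>The cover of the slice is pulled back through \<open>g\<close>; the Hoelder
      bound for the inverse turns diameter \<open>rr j\<close> into a parameter length of order
      \<open>rr j powr \<sigma>\<close>.\<close>
    define B where "B j = {\<omega>\<in>{0..<1}. g \<omega> \<in> V j}" for j
    define T where "T = (\<Sum>j. if j \<in> J then ennreal (rpow (rr j) \<sigma>) else 0)"
    have "1 \<le> (\<Sum>j. if j \<in> J then ennreal (2 * (C \<sigma> * rr j powr \<sigma>)) else 0)"
    proof (rule unit_interval_cover[OF neg])
      show "{0..<1} - (\<Union>j. Bad j) \<subseteq> (\<Union>j\<in>J. B j)"
      proof
        fix \<omega> assume om: "\<omega> \<in> {0..<1} - (\<Union>j. Bad j)"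
        then have "g \<omega> \<in> (\<Union>j\<in>J. V j)" using good[OF om] cov by blast
        then show "\<omega> \<in> (\<Union>j\<in>J. B j)" using om unfolding B_def by blast
      qed
      fix j \<omega> \<omega>' assume j: "j \<in> J" and "\<omega> \<in> B j" "\<omega>' \<in> B j"
      then have o: "\<omega> \<in> {0..<1}" "\<omega>' \<in> {0..<1}" "\<bar>g \<omega> - g \<omega>'\<bar> \<le> rr j"
        using V by (auto simp: B_def)
      have "C \<sigma> * \<bar>g \<omega> - g \<omega>'\<bar> powr \<sigma> \<le> C \<sigma> * rr j powr \<sigma>"
        using o(3) \<sigma> C[of \<sigma>] by (intro mult_left_mono powr_mono2) auto
      then show "\<bar>\<omega> - \<omega>'\<bar> \<le> C \<sigma> * rr j powr \<sigma>"
        using g(3)[OF \<sigma>(1,2) o(1,2)] by linarith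
    qed (use C[of \<sigma>] in auto)
    also have "\<dots> = (\<Sum>j. ennreal (2 * C \<sigma>) * (if j \<in> J then ennreal (rpow (rr j) \<sigma>) else 0))"
      using C[of \<sigma>] \<sigma> by (intro suminf_cong) (auto simp: rpow_def ennreal_mult[symmetric] mult.assoc)
    also have "\<dots> = ennreal (2 * C \<sigma>) * T" unfolding T_def by simp
    finally have "ennreal (1 / (2 * C \<sigma>)) * 1 \<le> ennreal (1 / (2 * C \<sigma>)) * (ennreal (2 * C \<sigma>) * T)"
      by (intro mult_left_mono) auto
    also have "\<dots> = T" using C[of \<sigma>] by (simp add: mult.assoc[symmetric] ennreal_mult[symmetric])
    finally show "ennreal (1 / (2 * C \<sigma>)) \<le> (\<Sum>j. if j \<in> J then ennreal (rpow (rr j) \<sigma>) else 0)"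
      by (simp add: T_def)
  qed (use s \<sigma> C[of \<sigma>] Z \<kappa>(1) in \<open>auto simp: lo_def hi_def D_def\<close>)
  then show ?thesis by (simp add: E_def)
qed

end

theorem theorem2:
  fixes a :: "int ^ 'd \<Rightarrow> 'k::{real_normed_field,banach}"
    and h :: real and W :: "(real ^ 'd) set"
  assumes odd: "\<And>n. a (- n) = - a n"
    and summable: "(\<lambda>n. norm (a n)) summable_on UNIV"
    and sparse: "sparse_set (rvec ` supp a)"
    and theta: "theta a \<le> 1"
    and gamma: "0 < gamma a" "gamma a < \<infinity>"
    and h: "0 \<le> h" "ereal h \<le> gamma a"
    and W: "open W" "W \<noteq> {}"
  shows "hausdorff_dim ({x. holder_exponent (davenport a) x = ereal h} \<inter> W)
           = ereal (real CARD('d) - 1) + ereal h / gamma a"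
proof -
  interpret sparse_davenport a
    by unfold_locales (rule odd summable sparse theta gamma)+
  define E where "E = level_set h \<inter> W"
  define D where "D = real CARD('d) - 1 + h / G"
  have hG: "h \<le> G" using h(2) by (simp add: gamma_eq)
  have rhs: "ereal (real CARD('d) - 1) + ereal h / gamma a = ereal D"
    using G_pos by (simp add: gamma_eq D_def)
  have D0: "0 \<le> D" using h(1) G_pos by (simp add: D_def Suc_leI)
  have "hausdorff_dim E \<le> ereal D"
  proof (rule ereal_le_epsilon2)
    fix e :: real assume e: "0 < e"
    have "hausdorff_measure (D + e) (level_set h) = 0"
      using h(1) hG e by (intro hausdorff_measure_level_set_upper) (auto simp: D_def)
    then have "hausdorff_measure (D + e) E = 0" by (rule hausdorff_measure_0_mono) (auto simp: E_def)
    then have "hausdorff_dim E \<le> ereal (D + e)"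
      unfolding hausdorff_dim_def using D0 e by (intro Inf_lower) auto
    then show "hausdorff_dim E \<le> ereal D + ereal e" by simp
  qed
  moreover have "ereal D \<le> hausdorff_dim E"
    unfolding hausdorff_dim_def
  proof (rule Inf_greatest, clarify)
    fix s :: real assume s: "0 \<le> s" "hausdorff_measure s E = 0"
    show "ereal D \<le> ereal s"
    proof (rule ccontr)
      assume "\<not> ereal D \<le> ereal s"
      then have sD: "s < D" by simp
      have "hausdorff_measure s E \<noteq> 0"
      proof (cases "h = 0")
        case True
        have "hausdorff_measure s (level_set 0 \<inter> W) \<noteq> 0"
          by (rule hausdorff_measure_level_set_0[OF W s(1)]) (use sD True in \<open>simp add: D_def\<close>)
        then show ?thesis unfolding E_def True .
      next
        case False
        then show ?thesis unfolding E_def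
          using h(1) hG s sD by (intro hausdorff_measure_level_set_pos W) (auto simp: D_def)
      qed
      then show False using s(2) by simp
    qed
  qed
  ultimately show ?thesis unfolding rhs E_def by (rule antisym)
qed

end
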